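(* Let $m>1$, let $A\subset\mathbb{R}^m$ be finite with $\dim\mathrm{conv}(A)=m$, $\alpha_a>0$ for $a\in A$, let $a_0\in\mathbb{R}^m\setminus A$ be arbitrary and $\alpha_0>0$. Let $\mathcal{E}(x)=\sum_{a\in A}\xi_a\alpha_ae^{\langle a,x\rangle}$ and $\mathcal{E}_0(x)=\mathcal{E}(x)+\xi_0\alpha_0e^{\langle a_0,x\rangle}$ with $\xi_0,\xi_a$ ($a\in A$) independent standard real Gaussians. Let $$\Phi_0(x)=\tfrac12\log\Big(\sum_{a\in A}\alpha_a^2e^{2\langle a,x\rangle}\Big)-\log\alpha_0-\langle a_0,x\rangle,$$ let $\Lambda_t:=\{x\in\mathbb{R}^m\mid\Phi_0(x)\le t\}$, let $t_{\min}$ be the minimal value attained by $\Phi_0$, let $t>t_{\min}$ and let $S_t:=\partial\Lambda_t$ (a smooth convex hypersurface). For any admissible random field $W\in C^\infty(S_t,\mathbb{R}^{m-2})$ on $S_t$, independent of $\mathcal{E}$ and $\mathcal{E}_0$, and every open set $U\subset S_t$, $$\mathbb{E}\#\mathcal{S}\{\mathcal{E}_0|_{S_t},W;U\}\le\mathbb{E}\#\mathcal{S}\{\mathcal{E}|_{S_t},W;U\}.$$ In particular $$\mathbb{E}\mathbb{S}\{\mathcal{E}_0|_{S_t};U\}\le\mathbb{E}\mathbb{S}\{\mathcal{E}|_{S_t};U\}.$$ In both cases, the inequality is an equality if and only if the right-hand side is zero, in which case every term is equal to zero.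
   Context: $\mathcal{S}\{f_1,\dots,f_k;U\}$ is the set of common zeros in $U$ of the (scalar or vector valued) functions $f_1,\dots,f_k$. For a scalar random field $\mathcal{Y}$ on a manifold $S$ of dimension $n$, $\mathbb{E}\mathbb{S}\{\mathcal{Y};U\}$ is the (possibly infinite) expected number of common zeros in $U$ of $n$ i.i.d. copies of $\mathcal{Y}$ (here $n=m-1$ for $S=S_t$). A random field $W\in C^\infty(S,\mathbb{R}^k)$ is admissible if there is a finite dimensional subspace $\mathscr{G}\subset C^\infty(S,\mathbb{R}^k)$ with a scalar product such that $W\in\mathscr{G}$ almost surely, (i) for all $x\in S$ the evaluation map $\mathscr{G}\to\mathbb{R}^k$, $f\mapsto f(x)$, is surjective, and (ii) $W$ has a continuous density $\rho:\mathscr{G}\to[0,\infty)$ with $\rho(0)>0$ and $\rho(f)=O(\|f\|^{-\beta})$ as $\|f\|\to\infty$ for some $\beta>\dim\mathscr{G}$. If $m=2$, $W$ is absent. *)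

theory Defs
  imports
    "HOL-Probability.Probability"
    "HOL-Library.Function_Algebras"
    "HOL-Library.Landau_Symbols"
begin

section \<open>Smooth functions on subsets of a Euclidean space\<close>

text \<open>Only meaningful for open \<open>T\<close>: all partial derivatives of order at most \<open>n\<close> exist and are
  continuous.\<close>

primrec C_k_on :: "nat \<Rightarrow> ('a::euclidean_space \<Rightarrow> real) \<Rightarrow> 'a set \<Rightarrow> bool" where
  "C_k_on 0 f T \<longleftrightarrow> continuous_on T f"
| "C_k_on (Suc n) f T \<longleftrightarrow>
     (\<forall>x\<in>T. f differentiable (at x)) \<and>
     (\<forall>v. C_k_on n (\<lambda>x. frechet_derivative f (at x) v) T)"

text \<open>For an embedded submanifold \<open>S\<close> the following is smoothness with respect to the induced manifold
  structure.\<close>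

definition smooth_on :: "'a::euclidean_space set \<Rightarrow> ('a \<Rightarrow> real) \<Rightarrow> bool" where
  "smooth_on S f \<longleftrightarrow>
     (\<forall>x\<in>S. \<exists>T g. open T \<and> x \<in> T \<and> (\<forall>n. C_k_on n g T) \<and> (\<forall>y\<in>S \<inter> T. g y = f y))"

text \<open>The space $C^\infty(S,\mathbb{R}^k)$. A vector in $\mathbb{R}^k$ is given by its components with
  index \<open>i < k\<close>, so that \<open>k = 0\<close> is allowed. To make fields on \<open>S\<close> correspond to unique functions,
  they are extended by zero outside \<open>S\<close> and for indices \<open>i \<ge> k\<close>. For \<open>k = 0\<close> the space consists of
  the zero function only.\<close>

definition smooth_fields :: "'a::euclidean_space set \<Rightarrow> nat \<Rightarrow> ('a \<Rightarrow> nat \<Rightarrow> real) set" where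
  "smooth_fields S k =
     {f. (\<forall>i<k. smooth_on S (\<lambda>x. f x i)) \<and> (\<forall>x i. x \<notin> S \<or> k \<le> i \<longrightarrow> f x i = 0)}"

text \<open>The $\sigma$-algebra on $C^\infty(S,\mathbb{R}^k)$ is the one generated by the evaluations at the
  points of \<open>S\<close>, which is the Borel $\sigma$-algebra of the $C^\infty$ topology. Only the space and the
  measurable sets of this measure are ever used.\<close>

definition field_space :: "'a::euclidean_space set \<Rightarrow> nat \<Rightarrow> ('a \<Rightarrow> nat \<Rightarrow> real) measure" where
  "field_space S k =
     restrict_space (PiM UNIV (\<lambda>_. PiM UNIV (\<lambda>_. borel))) (smooth_fields S k)"


section \<open>Admissible random fields\<close>

definition fscale :: "real \<Rightarrow> ('a \<Rightarrow> nat \<Rightarrow> real) \<Rightarrow> ('a \<Rightarrow> nat \<Rightarrow> real)" where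
  "fscale c f = (\<lambda>x i. c * f x i)"

definition scalar_product_on ::
  "('a \<Rightarrow> nat \<Rightarrow> real) set \<Rightarrow> (('a \<Rightarrow> nat \<Rightarrow> real) \<Rightarrow> ('a \<Rightarrow> nat \<Rightarrow> real) \<Rightarrow> real) \<Rightarrow> bool" where
  "scalar_product_on G ip \<longleftrightarrow>
     (\<forall>f\<in>G. \<forall>g\<in>G. ip f g = ip g f) \<and>
     (\<forall>f\<in>G. \<forall>g\<in>G. \<forall>h\<in>G. ip (f + g) h = ip f h + ip g h) \<and>
     (\<forall>c. \<forall>f\<in>G. \<forall>g\<in>G. ip (fscale c f) g = c * ip f g) \<and>
     (\<forall>f\<in>G. f \<noteq> 0 \<longrightarrow> 0 < ip f f)"

definition ip_norm ::
  "(('a \<Rightarrow> nat \<Rightarrow> real) \<Rightarrow> ('a \<Rightarrow> nat \<Rightarrow> real) \<Rightarrow> real) \<Rightarrow> ('a \<Rightarrow> nat \<Rightarrow> real) \<Rightarrow> real" where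
  "ip_norm ip f = sqrt (ip f f)"

text \<open>The existence of such \<open>d\<close> and \<open>b\<close> says that \<open>G\<close> is finite dimensional, with \<open>d\<close> its dimension.\<close>

definition orthonormal_basis_of ::
  "('a \<Rightarrow> nat \<Rightarrow> real) set \<Rightarrow> (('a \<Rightarrow> nat \<Rightarrow> real) \<Rightarrow> ('a \<Rightarrow> nat \<Rightarrow> real) \<Rightarrow> real) \<Rightarrow>
     nat \<Rightarrow> (nat \<Rightarrow> 'a \<Rightarrow> nat \<Rightarrow> real) \<Rightarrow> bool" where
  "orthonormal_basis_of G ip d b \<longleftrightarrow>
     (\<forall>i<d. b i \<in> G) \<and>
     (\<forall>i<d. \<forall>j<d. ip (b i) (b j) = (if i = j then 1 else 0)) \<and>
     (\<forall>f\<in>G. \<exists>c. f = (\<Sum>i<d. fscale (c i) (b i)))"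

text \<open>Lebesgue measure on the Euclidean space with orthonormal basis \<open>b 0, \<dots>, b (d - 1)\<close>, as a measure
  on $C^\infty(S,\mathbb{R}^k)$. It depends only on the scalar product, not on the orthonormal basis.
  For \<open>d = 0\<close> it is the unit mass at the zero function.\<close>

definition lebesgue_span ::
  "'a::euclidean_space set \<Rightarrow> nat \<Rightarrow> nat \<Rightarrow> (nat \<Rightarrow> 'a \<Rightarrow> nat \<Rightarrow> real) \<Rightarrow> ('a \<Rightarrow> nat \<Rightarrow> real) measure" where
  "lebesgue_span S k d b =
     distr (PiM {..<d} (\<lambda>_. lborel)) (field_space S k) (\<lambda>c. \<Sum>i<d. fscale (c i) (b i))"

text \<open>The density \<open>\<rho>\<close> is a function on \<open>G\<close>; its values outside \<open>G\<close> play no role.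
  The filter in the last clause is \<open>\<parallel>f\<parallel> \<rightarrow> \<infinity>\<close> within \<open>G\<close>. The clause \<open>W \<in> measurable M (field_space S k)\<close>,
  saying that \<open>W\<close> is a random element of $C^\infty(S,\mathbb{R}^k)$, is part of \<open>distributed\<close> as well.\<close>

definition admissible ::
  "'w measure \<Rightarrow> 'a::euclidean_space set \<Rightarrow> nat \<Rightarrow> ('w \<Rightarrow> 'a \<Rightarrow> nat \<Rightarrow> real) \<Rightarrow> bool" where
  "admissible M S k W \<longleftrightarrow>
     W \<in> measurable M (field_space S k) \<and>
     (\<exists>G ip d b.
        G \<subseteq> smooth_fields S k \<and> module.subspace fscale G \<and>
        scalar_product_on G ip \<and> orthonormal_basis_of G ip d b \<and>
        (AE \<omega> in M. W \<omega> \<in> G) \<and>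
        (\<forall>x\<in>S. \<forall>v. \<exists>f\<in>G. \<forall>i<k. f x i = v i) \<and>
        (\<exists>\<rho> \<beta>.
           (\<forall>f\<in>G. 0 \<le> \<rho> f) \<and>
           (\<forall>f\<in>G. \<forall>e>0. \<exists>\<delta>>0. \<forall>g\<in>G. ip_norm ip (g - f) < \<delta> \<longrightarrow> \<bar>\<rho> g - \<rho> f\<bar> < e) \<and>
           distributed M (lebesgue_span S k d b) W (\<lambda>f. ennreal (indicator G f * \<rho> f)) \<and>
           0 < \<rho> 0 \<and>
           real d < \<beta> \<and>
           \<rho> \<in> O[inf (filtercomap (ip_norm ip) at_top) (principal G)](\<lambda>f. ip_norm ip f powr (- \<beta>))))"

text \<open>Independence of random elements of possibly different types, which \<open>indep_var\<close> does not cover.\<close>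

definition indep_rv :: "'w measure \<Rightarrow> 'b measure \<Rightarrow> ('w \<Rightarrow> 'b) \<Rightarrow> 'c measure \<Rightarrow> ('w \<Rightarrow> 'c) \<Rightarrow> bool" where
  "indep_rv M N X N' Y \<longleftrightarrow>
     X \<in> measurable M N \<and> Y \<in> measurable M N' \<and>
     prob_space.indep_set M
       {X -` B \<inter> space M | B. B \<in> sets N} {Y -` B \<inter> space M | B. B \<in> sets N'}"


section \<open>Expected numbers of zeros\<close>

definition common_zeros :: "('a \<Rightarrow> real) set \<Rightarrow> 'a set \<Rightarrow> 'a set" where
  "common_zeros F U = {x\<in>U. \<forall>f\<in>F. f x = 0}"

definition ecount :: "'a set \<Rightarrow> ennreal" where
  "ecount Z = emeasure (count_space UNIV) Z"

text \<open>A scalar random field together with a $k$-dimensional one.\<close>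

definition expected_zeros ::
  "'w measure \<Rightarrow> ('w \<Rightarrow> 'a \<Rightarrow> real) \<Rightarrow> nat \<Rightarrow> ('w \<Rightarrow> 'a \<Rightarrow> nat \<Rightarrow> real) \<Rightarrow> 'a set \<Rightarrow> ennreal" where
  "expected_zeros M Y k W U =
     (\<integral>\<^sup>+ \<omega>. ecount (common_zeros (insert (Y \<omega>) ((\<lambda>i x. W \<omega> x i) ` {..<k})) U) \<partial>M)"

text \<open>The $n$ i.i.d. copies of \<open>Y\<close> are realised on the $n$-fold product probability space.\<close>

definition expected_zeros_iid ::
  "'w measure \<Rightarrow> nat \<Rightarrow> ('w \<Rightarrow> 'a \<Rightarrow> real) \<Rightarrow> 'a set \<Rightarrow> ennreal" where
  "expected_zeros_iid M n Y U =
     (\<integral>\<^sup>+ \<omega>. ecount (common_zeros ((\<lambda>i. Y (\<omega> i)) ` {..<n}) U) \<partial>(PiM {..<n} (\<lambda>_. M)))"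


section \<open>Random exponential sums and the hypersurfaces\<close>

definition exp_sum ::
  "'a::euclidean_space set \<Rightarrow> ('a \<Rightarrow> real) \<Rightarrow> ('a \<Rightarrow> 'w \<Rightarrow> real) \<Rightarrow> 'w \<Rightarrow> 'a \<Rightarrow> real" where
  "exp_sum A \<alpha> \<xi> \<omega> x = (\<Sum>a\<in>A. \<xi> a \<omega> * \<alpha> a * exp (a \<bullet> x))"

definition exp_sum0 ::
  "'a::euclidean_space set \<Rightarrow> ('a \<Rightarrow> real) \<Rightarrow> ('a \<Rightarrow> 'w \<Rightarrow> real) \<Rightarrow>
     'a \<Rightarrow> real \<Rightarrow> ('w \<Rightarrow> real) \<Rightarrow> 'w \<Rightarrow> 'a \<Rightarrow> real" where
  "exp_sum0 A \<alpha> \<xi> a0 \<alpha>0 \<xi>0 \<omega> x = exp_sum A \<alpha> \<xi> \<omega> x + \<xi>0 \<omega> * \<alpha>0 * exp (a0 \<bullet> x)"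

definition Phi0 ::
  "'a::euclidean_space set \<Rightarrow> ('a \<Rightarrow> real) \<Rightarrow> 'a \<Rightarrow> real \<Rightarrow> 'a \<Rightarrow> real" where
  "Phi0 A \<alpha> a0 \<alpha>0 x =
     1 / 2 * ln (\<Sum>a\<in>A. (\<alpha> a)\<^sup>2 * exp (2 * (a \<bullet> x))) - ln \<alpha>0 - a0 \<bullet> x"

definition Lambda ::
  "'a::euclidean_space set \<Rightarrow> ('a \<Rightarrow> real) \<Rightarrow> 'a \<Rightarrow> real \<Rightarrow> real \<Rightarrow> 'a set" where
  "Lambda A \<alpha> a0 \<alpha>0 t = {x. Phi0 A \<alpha> a0 \<alpha>0 x \<le> t}"

definition S_hyp ::
  "'a::euclidean_space set \<Rightarrow> ('a \<Rightarrow> real) \<Rightarrow> 'a \<Rightarrow> real \<Rightarrow> real \<Rightarrow> 'a set" where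
  "S_hyp A \<alpha> a0 \<alpha>0 t = frontier (Lambda A \<alpha> a0 \<alpha>0 t)"

text \<open>Sanity check: \<open>module.subspace fscale\<close> is the usual notion of a linear subspace.\<close>

lemma module_fscale: "module (fscale :: real \<Rightarrow> ('a \<Rightarrow> nat \<Rightarrow> real) \<Rightarrow> _)"
  by unfold_locales (auto simp: fscale_def fun_eq_iff algebra_simps)

end

theory Submission
  imports Defs
begin

text \<open>Dividing by \<open>\<alpha>0 * exp (a0 \<bullet> x)\<close> turns $\mathcal{E}$ on $S_t$ into a Gaussian field
  $X = \sum_a \xi_a G_a$ of constant variance $\sigma^2 = \sum_a G_a^2 = e^{2t}$, and $\mathcal{E}_0$ into
  $X + \xi_0$. Let $R_u$ be the expected number of common zeros of $X + u$ and $W$. In the Kac-Rice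
  integral for $R_u$ at a point $x$, the translation of the coefficients \<open>\<xi>\<close> by $u\,G(x)/\sigma^2$ reduces the
  level $u$ to the level $0$ without changing the Jacobian, since $\sum_a G_a\,dG_a = 0$ along $S_t$, and
  multiplies the Gaussian density by $e^{-u^2/(2\sigma^2)}$. Hence $R_u = e^{-u^2/(2\sigma^2)} R_0$ with
  $R_0 < \infty$, and averaging over $u = \xi_0$ gives a factor strictly less than $1$. For independent copies
  one replaces $\mathcal{E}$ by $\mathcal{E}_0$ in one copy at a time.

  The Kac-Rice integral is obtained from the translation invariance of Lebesgue measure on the
  coefficient space and the area formula for maps between Euclidean spaces of equal dimension.\<close>

section \<open>Measurability of the number of zeros\<close>

text \<open>The area formula speaks of almost every level only, whereas the zeros sit at the fixed
  level 0. Perturbing the coefficients moves the level, so translation invariance trades the fixed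
  level for an average over levels; Sard's theorem then disposes of degenerate zeros, in place of an
  almost sure transversality argument. The directions of perturbation come from the surjectivity of
  the evaluations for W and from a nowhere vanishing coefficient function of the Gaussian field.

  Finiteness at level 0 carries the equality case: L = c R with c < 1 allows L = R when R is
  infinite. It is delicate because the density of W decays only like a power above its dimension,
  while the Jacobian grows like the power m - 2 of the coefficients of W. Bounds on derivatives hold
  only in small charts, so the identity and the finiteness are proved locally and assembled over the
  compact S_t by additivity of the count. F-sigma sets are used for the pieces: they survive these
  cuts, preimages under charts and continuous images.\<close>

lemma ecount_eq_card: "finite Z \<Longrightarrow> ecount Z = of_nat (card Z)"
  by (simp add: ecount_def)

lemma ecount_mono: "Y \<subseteq> Z \<Longrightarrow> ecount Y \<le> ecount Z"
  unfolding ecount_def by (rule emeasure_mono) auto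

lemma ecount_le_if_finite_subsets:
  assumes "\<And>T. finite T \<Longrightarrow> T \<subseteq> Z \<Longrightarrow> of_nat (card T) \<le> b"
  shows "ecount Z \<le> b"
proof (cases "finite Z")
  case True
  then show ?thesis using assms[of Z] by (simp add: ecount_eq_card)
next
  case False
  have "of_nat n \<le> b" for n
    using infinite_arbitrarily_large[OF False, of n] assms by blast
  then have "(SUP n. of_nat n :: ennreal) \<le> b"
    by (intro SUP_least)
  then show ?thesis by (simp add: ennreal_SUP_of_nat_eq_top top_unique)
qed

text \<open>Disjoint sets that meet \<open>Z\<close> contain different points of \<open>Z\<close>,
  so no disjoint family overcounts; separating finitely many points gives a family that reaches
  their number. This reduces the count to events of the form "\<open>B\<close> is hit".\<close>

lemma ecount_eq_SUP_hits:
  fixes \<C> :: "'a set set"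
  assumes sep: "\<And>T. finite T \<Longrightarrow> T \<subseteq> Z \<Longrightarrow>
    \<exists>B. (\<forall>x\<in>T. B x \<in> \<C> \<and> x \<in> B x) \<and> (\<forall>x\<in>T. \<forall>y\<in>T. x \<noteq> y \<longrightarrow> B x \<inter> B y = {})"
  shows "ecount Z = (SUP F\<in>{F. finite F \<and> F \<subseteq> \<C> \<and> disjoint F}. \<Sum>B\<in>F. indicator {B. B \<inter> Z \<noteq> {}} B)"
    (is "_ = (SUP F\<in>?\<F>. ?s F)")
proof (rule antisym)
  show "ecount Z \<le> (SUP F\<in>?\<F>. ?s F)"
  proof (rule ecount_le_if_finite_subsets)
    fix T assume T: "finite T" "T \<subseteq> Z"
    obtain B where B: "\<And>x. x \<in> T \<Longrightarrow> B x \<in> \<C> \<and> x \<in> B x"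
      and disj: "\<And>x y. x \<in> T \<Longrightarrow> y \<in> T \<Longrightarrow> x \<noteq> y \<Longrightarrow> B x \<inter> B y = {}"
      using sep[OF T] by metis
    have inj: "inj_on B T"
      using B disj by (force intro!: inj_onI)
    have "disjoint (B ` T)"
      using disj by (auto simp: disjoint_def)
    then have F: "B ` T \<in> ?\<F>" using B T by auto
    have "of_nat (card T) = (\<Sum>x\<in>T. 1::ennreal)" by simp
    also have "\<dots> = (\<Sum>x\<in>T. indicator {B. B \<inter> Z \<noteq> {}} (B x))"
      using B T by (intro sum.cong) (auto simp: indicator_def)
    also have "\<dots> = ?s (B ` T)"
      by (rule sum.reindex[OF inj, unfolded comp_def, symmetric])
    finally show "of_nat (card T) \<le> (SUP F\<in>?\<F>. ?s F)"
      by (simp only:) (rule SUP_upper[OF F])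
  qed
next
  show "(SUP F\<in>?\<F>. ?s F) \<le> ecount Z"
  proof (rule SUP_least)
    fix F assume F: "F \<in> ?\<F>"
    let ?H = "{B\<in>F. B \<inter> Z \<noteq> {}}"
    define p where "p B = (SOME x. x \<in> B \<inter> Z)" for B
    have p: "p B \<in> B \<inter> Z" if "B \<in> ?H" for B
      using that unfolding p_def some_in_eq by simp
    have inj: "inj_on p ?H"
    proof (rule inj_onI)
      fix B C assume "B \<in> ?H" "C \<in> ?H" "p B = p C"
      with p[of B] p[of C] F show "B = C"
        by (auto simp: disjoint_def)
    qed
    have "?s F = of_nat (card ?H)"
      using F by (simp add: indicator_def sum.If_cases Int_def)
    also have "\<dots> = of_nat (card (p ` ?H))"
      using inj by (simp add: card_image)
    also have "\<dots> = ecount (p ` ?H)"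
      using F by (simp add: ecount_eq_card)
    also have "\<dots> \<le> ecount Z"
      using p by (intro ecount_mono) auto
    finally show "?s F \<le> ecount Z" .
  qed
qed

text \<open>On a compact set the minimum of the absolute value is attained, so a zero exists as soon
  as arbitrarily small values occur on a countable dense subset. This replaces an uncountable union
  by countable operations.\<close>

lemma sets_exists_zero_on_compact:
  fixes r :: "'w \<Rightarrow> 'a::euclidean_space \<Rightarrow> real"
  assumes B: "compact B"
    and cont: "\<And>\<omega>. \<omega> \<in> space M \<Longrightarrow> continuous_on B (r \<omega>)"
    and meas: "\<And>x. x \<in> B \<Longrightarrow> (\<lambda>\<omega>. r \<omega> x) \<in> borel_measurable M"
  shows "{\<omega> \<in> space M. \<exists>x\<in>B. r \<omega> x = 0} \<in> sets M"
proof -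
  obtain D where D: "countable D" "D \<subseteq> B" "B \<subseteq> closure D"
    using separable[of B] by blast
  have "(\<exists>x\<in>B. r \<omega> x = 0) \<longleftrightarrow> (\<forall>n::nat. \<exists>y\<in>D. \<bar>r \<omega> y\<bar> < 1 / Suc n)" if \<omega>: "\<omega> \<in> space M" for \<omega>
  proof
    assume "\<exists>x\<in>B. r \<omega> x = 0"
    then obtain x where x: "x \<in> B" "r \<omega> x = 0" by auto
    show "\<forall>n::nat. \<exists>y\<in>D. \<bar>r \<omega> y\<bar> < 1 / Suc n"
    proof
      fix n :: nat
      have "0 < 1 / real (Suc n)" by simp
      then obtain d where "d > 0" and d: "\<And>y. y \<in> B \<Longrightarrow> dist y x < d \<Longrightarrow> dist (r \<omega> y) (r \<omega> x) < 1 / Suc n"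
        using cont[OF \<omega>] x(1) unfolding continuous_on_iff by metis
      obtain y where "y \<in> D" "dist y x < d"
        using D(3) x(1) \<open>d > 0\<close> by (meson closure_approachable subsetD)
      with d[of y] D(2) x(2) show "\<exists>y\<in>D. \<bar>r \<omega> y\<bar> < 1 / Suc n"
        by (auto simp: dist_real_def)
    qed
  next
    assume *: "\<forall>n::nat. \<exists>y\<in>D. \<bar>r \<omega> y\<bar> < 1 / Suc n"
    then have "B \<noteq> {}" using D(2) by auto
    have "continuous_on B (\<lambda>x. \<bar>r \<omega> x\<bar>)"
      by (intro continuous_intros cont \<omega>)
    then obtain x where x: "x \<in> B" "\<And>y. y \<in> B \<Longrightarrow> \<bar>r \<omega> x\<bar> \<le> \<bar>r \<omega> y\<bar>"
      using continuous_attains_inf[OF B \<open>B \<noteq> {}\<close>] by blast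
    have "\<bar>r \<omega> x\<bar> < 1 / Suc n" for n
      using * x(2) D(2) by (meson order_le_less_trans subsetD)
    then have "\<not> 0 < \<bar>r \<omega> x\<bar>"
      by (metis nat_approx_posE not_less_iff_gr_or_eq)
    with x show "\<exists>x\<in>B. r \<omega> x = 0" by auto
  qed
  then have eq: "{\<omega> \<in> space M. \<exists>x\<in>B. r \<omega> x = 0} =
      {\<omega> \<in> space M. \<forall>n::nat. \<exists>y\<in>D. \<bar>r \<omega> y\<bar> < 1 / Suc n}"
    by auto
  have "{\<omega> \<in> space M. \<bar>r \<omega> y\<bar> < 1 / Suc n} \<in> sets M" if "y \<in> D" for y n
  proof -
    have [measurable]: "(\<lambda>\<omega>. r \<omega> y) \<in> borel_measurable M"
      using meas D(2) that by blast
    show ?thesis by measurable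
  qed
  then have "{\<omega> \<in> space M. \<exists>y\<in>D. \<bar>r \<omega> y\<bar> < 1 / Suc n} \<in> sets M" for n :: nat
    by (rule sets.sets_Collect_countable_Ex'[OF _ D(1)])
  then show ?thesis
    unfolding eq by (rule sets.sets_Collect_countable_All)
qed

text \<open>The count is a countable supremum of sums of hit indicators of compact sets, each of
  which is measurable by compactness.\<close>

lemma borel_measurable_ecount_zeros:
  fixes r :: "'w \<Rightarrow> 'a::euclidean_space \<Rightarrow> real"
  assumes U: "fsigma U"
    and cont: "\<And>\<omega>. \<omega> \<in> space M \<Longrightarrow> continuous_on U (r \<omega>)"
    and meas: "\<And>x. x \<in> U \<Longrightarrow> (\<lambda>\<omega>. r \<omega> x) \<in> borel_measurable M"
  shows "(\<lambda>\<omega>. ecount {x \<in> U. r \<omega> x = 0}) \<in> borel_measurable M"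
proof -
  obtain K :: "nat \<Rightarrow> 'a set" where K: "\<And>n. compact (K n)" "U = (\<Union>n. K n)"
  proof -
    obtain F :: "nat \<Rightarrow> 'a set" where F: "range F \<subseteq> Collect compact" "U = \<Union>(range F)"
      using iffD1[OF fsigma_Union_compact U] by (elim exE conjE)
    show thesis
      by (rule that[of F]) (use F in auto)
  qed
  obtain D :: "'a set" where D: "countable D" "D \<subseteq> UNIV" "UNIV \<subseteq> closure D"
    by (rule separable)
  \<comment> \<open>Intersecting with the \<open>K j\<close> keeps the test sets inside
    \<open>U\<close>, where the paths are continuous; centres in a countable dense set and radii
    \<open>1 / Suc n\<close> keep the family countable.\<close>
  define \<C> where "\<C> = (\<lambda>(d, n, j). cball d (1 / Suc n) \<inter> K j) ` (D \<times> UNIV \<times> (UNIV::nat set))"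
  have cC: "countable \<C>" unfolding \<C>_def using D(1) by auto
  have CB: "compact B" "B \<subseteq> U" if "B \<in> \<C>" for B
    using that K by (auto simp: \<C>_def compact_Int)
  let ?\<F> = "{F. finite F \<and> F \<subseteq> \<C> \<and> disjoint F}"
  have cF: "countable ?\<F>"
    using countable_Collect_finite_subset[OF cC] by (rule countable_subset[rotated]) blast
  have eq: "ecount Z = (SUP F\<in>?\<F>. \<Sum>B\<in>F. indicator {B. B \<inter> Z \<noteq> {}} B)" if Z: "Z \<subseteq> U" for Z
  proof (rule ecount_eq_SUP_hits)
    fix T assume T: "finite T" "T \<subseteq> Z"
    obtain e where e: "e > 0" "\<And>x y. x \<in> T \<Longrightarrow> y \<in> T \<Longrightarrow> x \<noteq> y \<Longrightarrow> e \<le> dist x y"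
    proof -
      let ?S = "insert 1 ((\<lambda>(x, y). dist x y) ` {(x, y) \<in> T \<times> T. x \<noteq> y})"
      have fin: "finite ?S" using T(1) by (auto intro: finite_subset[of _ "T \<times> T"])
      show thesis
      proof
        show "Min ?S > 0" using fin by (subst Min_gr_iff) auto
        show "Min ?S \<le> dist x y" if "x \<in> T" "y \<in> T" "x \<noteq> y" for x y
          using fin that by (intro Min_le) auto
      qed
    qed
    \<comment> \<open>Two points whose test sets meet are at distance at most four radii: two for
      the displaced centres, two for the balls. Hence the factor 4.\<close>
    obtain n where n: "1 / real (Suc n) < e / 4"
      using nat_approx_posE[of "e / 4"] e(1) by auto
    have "\<exists>d. d \<in> D \<and> dist d x < 1 / Suc n" for x
    proof -
      have "x \<in> closure D" using D(3) by auto
      moreover have "0 < 1 / real (Suc n)" by simp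
      ultimately show ?thesis unfolding closure_approachable by blast
    qed
    then obtain d where d: "\<And>x. d x \<in> D" "\<And>x. dist (d x) x < 1 / Suc n" by metis
    obtain j where j: "\<And>x. x \<in> T \<Longrightarrow> x \<in> K (j x)"
      using T(2) Z K(2) by (metis (no_types, lifting) UN_E subsetD)
    let ?B = "\<lambda>x. cball (d x) (1 / Suc n) \<inter> K (j x)"
    have "?B x \<inter> ?B y = {}" if "x \<in> T" "y \<in> T" "x \<noteq> y" for x y
    proof (rule ccontr)
      assume "?B x \<inter> ?B y \<noteq> {}"
      then obtain p where p: "dist (d x) p \<le> 1 / Suc n" "dist (d y) p \<le> 1 / Suc n" by auto
      have "dist x y \<le> dist (d x) x + dist (d x) p + (dist (d y) p + dist (d y) y)"
        by (smt (verit) dist_commute dist_triangle)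
      also have "\<dots> < e" using p d(2)[of x] d(2)[of y] n by linarith
      finally show False using e(2)[OF that] by simp
    qed
    moreover have "?B x \<in> \<C> \<and> x \<in> ?B x" if "x \<in> T" for x
    proof
      show "?B x \<in> \<C>"
        unfolding \<C>_def by (rule image_eqI[of _ _ "(d x, n, j x)"]) (use d in auto)
      show "x \<in> ?B x" using d(2)[of x] j[OF that] by simp
    qed
    ultimately show "\<exists>B. (\<forall>x\<in>T. B x \<in> \<C> \<and> x \<in> B x) \<and> (\<forall>x\<in>T. \<forall>y\<in>T. x \<noteq> y \<longrightarrow> B x \<inter> B y = {})"
      by (intro exI[of _ ?B]) auto
  qed
  have hit: "(\<lambda>\<omega>. indicator {B. B \<inter> {x \<in> U. r \<omega> x = 0} \<noteq> {}} B :: ennreal) \<in> borel_measurable M"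
    if "B \<in> \<C>" for B
  proof -
    have "{\<omega> \<in> space M. \<exists>x\<in>B. r \<omega> x = 0} \<in> sets M"
      using CB[OF that] cont meas by (intro sets_exists_zero_on_compact) (auto intro: continuous_on_subset)
    moreover have "(\<lambda>\<omega>. indicator {B. B \<inter> {x \<in> U. r \<omega> x = 0} \<noteq> {}} B :: ennreal) =
        (\<lambda>\<omega>. if \<exists>x\<in>B. r \<omega> x = 0 then 1 else 0)"
      using CB(2)[OF that] by (auto simp: indicator_def fun_eq_iff)
    ultimately show ?thesis
      by (auto intro!: measurable_If)
  qed
  have "(\<lambda>\<omega>. SUP F\<in>?\<F>. \<Sum>B\<in>F. indicator {B. B \<inter> {x \<in> U. r \<omega> x = 0} \<noteq> {}} B :: ennreal)
      \<in> borel_measurable M"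
    using hit by (intro borel_measurable_SUP cF borel_measurable_sum) auto
  then show ?thesis
    by (subst eq) auto
qed

section \<open>The area formula\<close>

lemma ecount_empty [simp]: "ecount {} = 0"
  unfolding ecount_def by simp

section \<open>F-sigma sets in Euclidean space\<close>

lemma fsigma_closed: "closed S \<Longrightarrow> fsigma S"
  using fsigma.intros[of "\<lambda>_. S"] by simp

lemma fsigma_open:
  fixes S :: "'a::euclidean_space set"
  assumes "open S" shows "fsigma S"
proof -
  have "\<exists>C::nat \<Rightarrow> 'a set. (\<forall>n. closed (C n)) \<and> \<Union>(range C) = S"
  proof (rule open_Union_compact_subsets[OF assms])
    fix C :: "nat \<Rightarrow> 'a set"
    assume C: "\<And>n. compact (C n)" "\<Union>(range C) = S"
    show ?thesis using C by (intro exI[of _ C]) (auto intro: compact_imp_closed)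
  qed
  then show ?thesis using fsigma.intros by auto
qed

lemma fsigma_Int:
  assumes "fsigma A" "fsigma B" shows "fsigma (A \<inter> B)"
proof -
  obtain F :: "nat \<Rightarrow> 'a set" where F: "\<And>n. closed (F n)" "A = (\<Union>n. F n)"
    using assms(1) by (rule fsigma.cases) metis
  obtain G :: "nat \<Rightarrow> 'a set" where G: "\<And>n. closed (G n)" "B = (\<Union>n. G n)"
    using assms(2) by (rule fsigma.cases) metis
  let ?H = "\<lambda>n. F (fst (prod_decode n)) \<inter> G (snd (prod_decode n))"
  have "fsigma (\<Union>n. ?H n)"
    using F G by (intro fsigma.intros closed_Int)
  moreover have "(\<Union>n. ?H n) = A \<inter> B"
  proof
    show "A \<inter> B \<subseteq> (\<Union>n. ?H n)"
    proof
      fix x assume "x \<in> A \<inter> B"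
      then obtain i j where "x \<in> F i" "x \<in> G j" using F(2) G(2) by auto
      then have "x \<in> ?H (prod_encode (i, j))" by simp
      then show "x \<in> (\<Union>n. ?H n)" by blast
    qed
  qed (auto simp: F(2) G(2))
  ultimately show ?thesis by simp
qed

lemma fsigma_compact_cover:
  fixes S :: "'a::euclidean_space set"
  assumes "fsigma S"
  shows "\<exists>K::nat \<Rightarrow> 'a set. (\<forall>n. compact (K n)) \<and> S = (\<Union>n. K n)"
  using iffD1[OF fsigma_Union_compact assms] by (auto simp: image_subset_iff)

lemma fsigma_Union_of_compact:
  fixes K :: "nat \<Rightarrow> 'a::euclidean_space set"
  shows "(\<And>n. compact (K n)) \<Longrightarrow> fsigma (\<Union>n. K n)"
  by (intro fsigma.intros compact_imp_closed)

lemma fsigma_borel: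
  fixes S :: "'a::euclidean_space set"
  shows "fsigma S \<Longrightarrow> S \<in> sets borel"
  by (erule fsigma.cases) auto

text \<open>An F-sigma set in Euclidean space is a countable union of compact sets, and compactness
  passes to the image. Borel sets would not do here, since their continuous images need not be
  Borel.\<close>

lemma fsigma_continuous_image:
  fixes f :: "'a::euclidean_space \<Rightarrow> 'b::euclidean_space"
  assumes "fsigma S" "continuous_on S f"
  shows "fsigma (f ` S)"
proof -
  obtain K :: "nat \<Rightarrow> 'a set" where K: "\<And>n. compact (K n)" "S = (\<Union>n. K n)"
    using fsigma_compact_cover[OF assms(1)] by auto
  have "compact (f ` K n)" for n
    using K assms(2) by (intro compact_continuous_image) (auto intro: continuous_on_subset)
  then have "fsigma (\<Union>n. f ` K n)"
    by (rule fsigma_Union_of_compact)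
  then show ?thesis using K(2) by (simp add: image_UN)
qed

text \<open>The change of variables for finite values is an equivalence: either side being finite
  forces the other to agree. An infinite integral therefore excludes a finite measure of the image,
  which extends the equality to values in [0, \<infinity>].\<close>

lemma emeasure_lebesgue_differentiable_image:
  fixes h :: "real^'n::{finite,wellorder} \<Rightarrow> real^'n::_"
  assumes S: "S \<in> sets lebesgue"
    and der: "\<And>x. x \<in> S \<Longrightarrow> (h has_derivative h' x) (at x within S)"
    and inj: "inj_on h S"
    and meas: "(\<lambda>x. indicator S x * \<bar>det (matrix (h' x))\<bar>) \<in> borel_measurable borel"
    and img: "h ` S \<in> sets lebesgue"
  shows "emeasure lebesgue (h ` S) = (\<integral>\<^sup>+x. ennreal (indicator S x * \<bar>det (matrix (h' x))\<bar>) \<partial>lborel)"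
    (is "_ = ?I")
proof (cases "?I = \<infinity>")
  case False
  then obtain r where r: "r \<ge> 0" "?I = ennreal r"
    by (cases ?I) auto
  have "((\<lambda>x. indicator S x * \<bar>det (matrix (h' x))\<bar>) has_integral r) UNIV"
    using meas r by (intro nn_integral_has_integral) auto
  also have "(\<lambda>x. indicator S x * \<bar>det (matrix (h' x))\<bar>) =
      (\<lambda>x. if x \<in> S then \<bar>det (matrix (h' x))\<bar> else 0)"
    by auto
  finally have "((\<lambda>x. \<bar>det (matrix (h' x))\<bar>) has_integral r) S"
    by (simp only: has_integral_restrict_UNIV)
  then have "h ` S \<in> lmeasurable \<and> measure lebesgue (h ` S) = r"
    using has_measure_differentiable_image[OF S der inj] by blast
  then show ?thesis
    using r by (simp add: emeasure_eq_measure2)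
next
  case True
  have "emeasure lebesgue (h ` S) = \<infinity>"
  proof (rule ccontr)
    assume "emeasure lebesgue (h ` S) \<noteq> \<infinity>"
    then have "h ` S \<in> lmeasurable"
      using img by (intro fmeasurableI) (auto simp: top.not_eq_extremum)
    then have "((\<lambda>x. \<bar>det (matrix (h' x))\<bar>) has_integral measure lebesgue (h ` S)) S"
      using has_measure_differentiable_image[OF S der inj] by blast
    then have "?I = ennreal (measure lebesgue (h ` S))"
      by (intro nn_integral_has_integral_lebesgue) auto
    with True show False by simp
  qed
  with True show ?thesis by simp
qed

text \<open>The measure with density \<open>J\<close>, pushed forward by \<open>h\<close>, agrees on
  Borel sets with Lebesgue measure restricted to the image; integrating \<open>\<psi>\<close>
  against both gives the claim.\<close>

lemma nn_integral_differentiable_image: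
  fixes h :: "real^'n::{finite,wellorder} \<Rightarrow> real^'n::_"
  assumes P: "fsigma P"
    and der: "\<And>x. x \<in> P \<Longrightarrow> (h has_derivative h' x) (at x)"
    and inj: "inj_on h P"
    and meas: "(\<lambda>x. indicator P x * \<bar>det (matrix (h' x))\<bar>) \<in> borel_measurable borel"
    and \<psi>: "\<psi> \<in> borel_measurable borel"
  shows "(\<integral>\<^sup>+y. indicator (h ` P) y * \<psi> y \<partial>lborel) =
    (\<integral>\<^sup>+x. indicator P x * (\<psi> (h x) * ennreal \<bar>det (matrix (h' x))\<bar>) \<partial>lborel)"
proof -
  have cont: "continuous_on P h"
    using der by (intro continuous_at_imp_continuous_on) (auto intro: has_derivative_continuous)
  have hP: "h ` P \<in> sets borel"
    by (intro fsigma_borel fsigma_continuous_image P cont)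
  have Pb: "P \<in> sets borel" by (intro fsigma_borel P)
  \<comment> \<open>Extension by zero makes \<open>h\<close> Borel on the whole space; the density
    \<open>J\<close> vanishes where the values are artificial.\<close>
  define g where "g = (\<lambda>x. indicator P x *\<^sub>R h x)"
  have g[measurable]: "g \<in> borel_measurable borel"
    unfolding g_def using Pb cont by (rule borel_measurable_continuous_on_indicator)
  define J where "J x = indicator P x * \<bar>det (matrix (h' x))\<bar>" for x
  have J[measurable]: "J \<in> borel_measurable borel" unfolding J_def by (rule meas)
  note [measurable] = Pb hP \<psi>
  have "distr (density lborel J) borel g = density lborel (indicator (h ` P))"
  proof (rule measure_eqI)
    fix E assume "E \<in> sets (distr (density lborel J) borel g)"
    then have E[measurable]: "E \<in> sets borel" by simp
    let ?S = "P \<inter> g -` E"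
    have "?S \<in> sets lborel" using measurable_sets[OF g E] Pb by (simp add: sets.Int)
    then have S: "?S \<in> sets borel" by simp
    have S_eq: "h ` ?S = h ` P \<inter> E"
      unfolding g_def by (auto simp: indicator_def)
    have J_eq: "indicator ?S x * \<bar>det (matrix (h' x))\<bar> = J x * indicator (g -` E) x" for x
      by (simp add: J_def indicator_def)
    have gE: "g -` E \<in> sets borel" using measurable_sets[OF g E] by simp
    have "emeasure (distr (density lborel J) borel g) E =
        (\<integral>\<^sup>+x. ennreal (J x) * indicator (g -` E) x \<partial>lborel)"
      using gE by (simp add: emeasure_distr emeasure_density)
    also have "\<dots> = (\<integral>\<^sup>+x. ennreal (indicator ?S x * \<bar>det (matrix (h' x))\<bar>) \<partial>lborel)"
      unfolding J_eq by (intro nn_integral_cong) (simp split: split_indicator)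
    also have "\<dots> = emeasure lebesgue (h ` ?S)"
    proof (rule emeasure_lebesgue_differentiable_image[symmetric])
      show "?S \<in> sets lebesgue" using S by simp
      show "inj_on h ?S" using inj by (rule inj_on_subset) auto
      show "(h has_derivative h' x) (at x within ?S)" if "x \<in> ?S" for x
        using der that by (auto intro: has_derivative_at_withinI)
      show "(\<lambda>x. indicator ?S x * \<bar>det (matrix (h' x))\<bar>) \<in> borel_measurable borel"
        unfolding J_eq using gE by measurable
      show "h ` ?S \<in> sets lebesgue" unfolding S_eq using hP E by simp
    qed
    also have "\<dots> = emeasure (density lborel (indicator (h ` P))) E"
      unfolding S_eq by (simp add: emeasure_density nn_integral_indicator mult.commute Int_commute
          flip: indicator_inter_arith)
    finally show "emeasure (distr (density lborel J) borel g) E =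
      emeasure (density lborel (indicator (h ` P))) E" .
  qed simp
  then have "(\<integral>\<^sup>+y. \<psi> y \<partial>density lborel (indicator (h ` P))) =
      (\<integral>\<^sup>+y. \<psi> y \<partial>distr (density lborel J) borel g)"
    by simp
  also have "\<dots> = (\<integral>\<^sup>+x. ennreal (J x) * \<psi> (g x) \<partial>lborel)"
    by (simp add: nn_integral_distr nn_integral_density)
  also have "\<dots> = (\<integral>\<^sup>+x. indicator P x * (\<psi> (h x) * ennreal \<bar>det (matrix (h' x))\<bar>) \<partial>lborel)"
    by (intro nn_integral_cong) (simp add: J_def g_def mult.commute split: split_indicator)
  finally show ?thesis
    by (simp add: nn_integral_density)
qed

lemma continuous_on_det:
  fixes A :: "'a::topological_space \<Rightarrow> real^'n^'n"
  assumes "\<And>i j. continuous_on S (\<lambda>x. A x $ i $ j)"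
  shows "continuous_on S (\<lambda>x. det (A x))"
  unfolding det_def by (intro continuous_intros assms)

lemma ecount_disjoint_Union:
  assumes "\<And>m n::nat. m \<noteq> n \<Longrightarrow> Z m \<inter> Z n = {}"
  shows "ecount (\<Union>n. Z n) = (\<Sum>n. ecount (Z n))"
  unfolding ecount_def using assms
  by (intro suminf_emeasure[symmetric]) (auto simp: disjoint_family_on_def)

text \<open>In finite dimension, continuity of the derivative in each fixed direction is continuity
  in operator norm, so the version for bounded linear functions applies.\<close>

lemma inverse_function_theorem_C1:
  fixes f :: "'a::euclidean_space \<Rightarrow> 'a"
  assumes U: "open U" and der: "\<And>x. x \<in> U \<Longrightarrow> (f has_derivative f' x) (at x)"
    and contd: "\<And>v. continuous_on U (\<lambda>x. f' x v)"
    and x0: "x0 \<in> U" and inj: "inj (f' x0)"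
  obtains U' V g where "open U'" "U' \<subseteq> U" "x0 \<in> U'" "open V" "homeomorphism U' V f g"
    "\<And>y. y \<in> V \<Longrightarrow> (g has_derivative inv (f' (g y))) (at y)"
    "\<And>y. y \<in> V \<Longrightarrow> bij (f' (g y))"
proof -
  define F where "F y = Blinfun (f' y)" for y
  have F: "blinfun_apply (F y) = f' y" if "y \<in> U" for y
    using der[OF that] unfolding F_def
    by (intro bounded_linear_Blinfun_apply has_derivative_bounded_linear)
  obtain k where k: "linear k" "k \<circ> f' x0 = id"
    using linear_injective_left_inverse[OF has_derivative_linear[OF der[OF x0]] inj] by blast
  have G: "blinfun_apply (Blinfun k) = k"
    using k(1) by (intro bounded_linear_Blinfun_apply) (simp add: linear_linear)
  have "Blinfun k o\<^sub>L F x0 = id_blinfun"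
    using k(2) by (intro blinfun_eqI) (simp add: G F[OF x0] fun_eq_iff)
  moreover have "continuous_on U F"
  proof (rule continuous_on_blinfun_componentwise)
    fix i :: 'a
    show "continuous_on U (\<lambda>y. blinfun_apply (F y) i)"
      using contd[of i] by (rule continuous_on_eq) (use F in auto)
  qed
  moreover have "(f has_derivative blinfun_apply (F y)) (at y)" if "y \<in> U" for y
    using der[OF that] F[OF that] by simp
  ultimately obtain U' V g g' where *: "open U'" "U' \<subseteq> U" "x0 \<in> U'" "open V" "homeomorphism U' V f g"
    and g': "\<And>y. y \<in> V \<Longrightarrow> (g has_derivative g' y) (at y)"
      "\<And>y. y \<in> V \<Longrightarrow> g' y = inv (blinfun_apply (F (g y)))"
      "\<And>y. y \<in> V \<Longrightarrow> bij (blinfun_apply (F (g y)))"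
    using inverse_function_theorem[OF U _ _ x0, of f F "Blinfun k"] by metis
  have "F (g y) = F (g y) \<and> blinfun_apply (F (g y)) = f' (g y)" if "y \<in> V" for y
    using F \<open>U' \<subseteq> U\<close> \<open>homeomorphism U' V f g\<close> that by (auto simp: homeomorphism_def)
  with g' show thesis
    by (intro that[OF *]) metis+
qed

text \<open>Critical points contribute to neither side: their image is null by Sard, and the
  Jacobian vanishes at them. The regular points split into countably many disjoint pieces on which
  \<open>h\<close> is injective, and the injective change of variables is summed over these.\<close>

theorem area_formula:
  fixes h :: "real^'n::{finite,wellorder} \<Rightarrow> real^'n::_"
  assumes D: "open D" and Q: "fsigma Q" "Q \<subseteq> D"
    and der: "\<And>x. x \<in> D \<Longrightarrow> (h has_derivative h' x) (at x)"
    and contd: "\<And>v. continuous_on D (\<lambda>x. h' x v)"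
    and \<psi>: "\<psi> \<in> borel_measurable borel"
  shows "(\<integral>\<^sup>+y. \<psi> y * ecount {x \<in> Q. h x = y} \<partial>lborel) =
    (\<integral>\<^sup>+x. indicator Q x * (\<psi> (h x) * ennreal \<bar>det (matrix (h' x))\<bar>) \<partial>lborel)"
proof -
  define d where "d x = det (matrix (h' x))" for x
  have contd': "continuous_on D d"
    unfolding d_def by (intro continuous_on_det) (simp add: matrix_def, intro continuous_intros contd)
  define D1 where "D1 = {x \<in> D. d x \<noteq> 0}"
  have "open (D \<inter> d -` (- {0}))"
    by (rule continuous_open_preimage[OF contd' D]) auto
  also have "D \<inter> d -` (- {0}) = D1" by (auto simp: D1_def)
  finally have D1: "open D1" .
  have "D1 \<subseteq> D" by (auto simp: D1_def)
  \<comment> \<open>A vanishing determinant means rank below the dimension, the situation of the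
    elementary form of Sard's theorem.\<close>
  have sard: "negligible (h ` (D - D1))"
  proof (rule baby_Sard)
    show "(h has_derivative h' x) (at x within D - D1)" if "x \<in> D - D1" for x
      using der that by (auto intro: has_derivative_at_withinI)
    show "rank (matrix (h' x)) < CARD('n)" if "x \<in> D - D1" for x
      using that by (auto simp: D1_def d_def det_eq_0_rank)
  qed simp
  have loc_inj: "\<exists>V. open V \<and> x \<in> V \<and> V \<subseteq> D1 \<and> inj_on h V" if x: "x \<in> D1" for x
  proof -
    have xD: "x \<in> D" using x \<open>D1 \<subseteq> D\<close> by auto
    have "linear (h' x)" by (rule has_derivative_linear[OF der[OF xD]])
    then have eq: "h' x = (*v) (matrix (h' x))" by (simp add: fun_eq_iff matrix_vector_mul)
    have "invertible (matrix (h' x))"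
      using x by (simp add: D1_def d_def invertible_det_nz)
    then have "inj ((*v) (matrix (h' x)))"
      unfolding matrix_left_invertible_injective[symmetric] invertible_def by blast
    then have "inj (h' x)" by (subst eq)
    have derD1: "(h has_derivative h' y) (at y)" if "y \<in> D1" for y
      using der \<open>D1 \<subseteq> D\<close> that by blast
    show ?thesis
    proof (rule inverse_function_theorem_C1[OF D1 derD1 continuous_on_subset[OF contd \<open>D1 \<subseteq> D\<close>] x \<open>inj (h' x)\<close>])
      fix U' V g assume U': "open U'" "U' \<subseteq> D1" "x \<in> U'" and hom: "homeomorphism U' V h g"
      have "inj_on h U'"
        by (rule inj_on_inverseI[where g = g]) (use hom in \<open>simp add: homeomorphism_def\<close>)
      with U' show "\<exists>V. open V \<and> x \<in> V \<and> V \<subseteq> D1 \<and> inj_on h V" by blast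
    qed
  qed
  let ?\<F> = "{V. open V \<and> V \<subseteq> D1 \<and> inj_on h V}"
  obtain \<F> where \<F>: "\<F> \<subseteq> ?\<F>" "countable \<F>" "\<Union>\<F> = \<Union>?\<F>"
    by (rule Lindelof[of ?\<F>]) auto
  have "\<Union>?\<F> = D1" using loc_inj by auto
  define V where "V = from_nat_into (insert {} \<F>)"
  have rV: "range V = insert {} \<F>"
    unfolding V_def using \<F>(2) by (simp add: range_from_nat_into)
  have V: "open (V n)" "V n \<subseteq> D1" "inj_on h (V n)" for n
  proof -
    have "V n \<in> insert {} \<F>" using rV by (metis rangeI)
    then have "V n \<in> ?\<F>" using \<F>(1) by auto
    then show "open (V n)" "V n \<subseteq> D1" "inj_on h (V n)" by auto
  qed
  have UV: "(\<Union>n. V n) = D1" using rV \<F>(3) \<open>\<Union>?\<F> = D1\<close> by simp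
  \<comment> \<open>Each disjointed piece is an open set minus finitely many open sets, hence
    F-sigma, so that its image under \<open>h\<close> is Borel.\<close>
  define P where "P n = Q \<inter> disjointed V n" for n
  have P: "fsigma (P n)" "P n \<subseteq> V n" for n
  proof -
    have "disjointed V n = V n \<inter> (- (\<Union>i\<in>{0..<n}. V i))"
      by (auto simp: disjointed_def)
    moreover have "fsigma (V n \<inter> (- (\<Union>i\<in>{0..<n}. V i)))"
      using V(1) by (intro fsigma_Int fsigma_open fsigma_closed) auto
    ultimately show "fsigma (P n)"
      unfolding P_def using Q(1) by (intro fsigma_Int) auto
    show "P n \<subseteq> V n" unfolding P_def using disjointed_subset[of V n] by auto
  qed
  have PU: "(\<Union>n. P n) = Q \<inter> D1" unfolding P_def using UN_disjointed_eq[of V] UV by auto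
  have Pdisj: "P m \<inter> P n = {}" if "m \<noteq> n" for m n
    using disjoint_family_disjointed[of V] that by (auto simp: P_def disjoint_family_on_def)
  have PO: "P n \<subseteq> D" for n using P(2) V(2) \<open>D1 \<subseteq> D\<close> by blast
  have injP: "inj_on h (P n)" for n using V(3) P(2) by (rule inj_on_subset)
  have contP: "continuous_on (P n) h" for n
    using der PO by (intro continuous_at_imp_continuous_on) (auto intro: has_derivative_continuous)
  have [measurable]: "P n \<in> sets borel" for n by (intro fsigma_borel P)
  have [measurable]: "h ` P n \<in> sets borel" for n
    by (intro fsigma_borel fsigma_continuous_image P contP)
  have Qb: "Q \<in> sets borel" by (intro fsigma_borel Q)
  note [measurable] = \<psi>
  have indP: "(\<lambda>x. indicator (P n) x * \<bar>d x\<bar>) \<in> borel_measurable borel" for n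
  proof -
    have "continuous_on (P n) (\<lambda>x. \<bar>d x\<bar>)"
      by (intro continuous_intros continuous_on_subset[OF contd' PO])
    then show ?thesis
      using borel_measurable_continuous_on_indicator[of "P n" "\<lambda>x. \<bar>d x\<bar>"] by simp
  qed
  \<comment> \<open>A regular value has all its preimages in \<open>Q\<close> in the pieces
    \<open>P n\<close>, at most one in each of them by injectivity.\<close>
  have cnt: "ecount {x \<in> Q. h x = y} = (\<Sum>n. indicator (h ` P n) y)" if y: "y \<notin> h ` (D - D1)" for y
  proof -
    have "{x \<in> Q. h x = y} = (\<Union>n. {x \<in> P n. h x = y})"
      using y PU Q(2) by (auto; blast)
    moreover have "ecount (\<Union>n. {x \<in> P n. h x = y}) = (\<Sum>n. ecount {x \<in> P n. h x = y})"
      using Pdisj by (intro ecount_disjoint_Union) auto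
    moreover have "ecount {x \<in> P n. h x = y} = indicator (h ` P n) y" for n
    proof (cases "y \<in> h ` P n")
      case True
      then obtain x where "x \<in> P n" "h x = y" by auto
      then have "{x \<in> P n. h x = y} = {x}" using injP[of n] by (auto dest: inj_onD)
      then show ?thesis using True by (simp add: ecount_eq_card)
    next
      case False
      then have E: "{x \<in> P n. h x = y} = {}" by auto
      show ?thesis unfolding E using False by simp
    qed
    ultimately show ?thesis by simp
  qed
  have null: "AE y in lborel. y \<notin> h ` (D - D1)"
  proof -
    have "AE y in lebesgue. y \<notin> h ` (D - D1)"
      using sard by (intro AE_not_in) (simp add: negligible_iff_null_sets)
    then show ?thesis by (simp add: AE_completion_iff)
  qed
  have "(\<integral>\<^sup>+y. \<psi> y * ecount {x \<in> Q. h x = y} \<partial>lborel) =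
      (\<integral>\<^sup>+y. (\<Sum>n. indicator (h ` P n) y * \<psi> y) \<partial>lborel)"
    using null by (intro nn_integral_cong_AE, eventually_elim) (simp add: cnt mult.commute)
  also have "\<dots> = (\<Sum>n. \<integral>\<^sup>+y. indicator (h ` P n) y * \<psi> y \<partial>lborel)"
    by (intro nn_integral_suminf) measurable
  also have "\<dots> = (\<Sum>n. \<integral>\<^sup>+x. indicator (P n) x * (\<psi> (h x) * ennreal \<bar>d x\<bar>) \<partial>lborel)"
    unfolding d_def using der PO indP injP P(1) \<psi>
    by (intro suminf_cong nn_integral_differentiable_image) (auto simp: d_def)
  also have "\<dots> = (\<integral>\<^sup>+x. (\<Sum>n. indicator (P n) x * (\<psi> (h x) * ennreal \<bar>d x\<bar>)) \<partial>lborel)"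
  proof (rule nn_integral_suminf[symmetric])
    fix n
    \<comment> \<open>Only the cut-off of \<open>h\<close> to \<open>P n\<close> is known to be
      Borel on the whole space. Moving the indicator inside \<open>\<psi>\<close> is harmless, since
      the Jacobian factor is cut off as well.\<close>
    have [measurable]: "(\<lambda>x. indicator (P n) x *\<^sub>R h x) \<in> borel_measurable borel"
      using contP by (intro borel_measurable_continuous_on_indicator) auto
    have "(\<lambda>x. \<psi> (indicator (P n) x *\<^sub>R h x) * ennreal (indicator (P n) x * \<bar>d x\<bar>)) \<in> borel_measurable lborel"
      using indP[of n] by measurable
    also have "(\<lambda>x. \<psi> (indicator (P n) x *\<^sub>R h x) * ennreal (indicator (P n) x * \<bar>d x\<bar>)) =
        (\<lambda>x. indicator (P n) x * (\<psi> (h x) * ennreal \<bar>d x\<bar>))"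
      by (auto simp: fun_eq_iff split: split_indicator)
    finally show "(\<lambda>x. indicator (P n) x * (\<psi> (h x) * ennreal \<bar>d x\<bar>)) \<in> borel_measurable lborel" .
  qed
  also have "\<dots> = (\<integral>\<^sup>+x. indicator Q x * (\<psi> (h x) * ennreal \<bar>d x\<bar>) \<partial>lborel)"
  proof (rule nn_integral_cong)
    fix x :: "real^'n::{finite,wellorder}"
    have "(\<Sum>n. indicator (P n) x :: ennreal) = indicator (\<Union>n. P n) x"
      using Pdisj by (intro suminf_indicator) (auto simp: disjoint_family_on_def)
    then have "(\<Sum>n. indicator (P n) x * (\<psi> (h x) * ennreal \<bar>d x\<bar>)) =
        indicator (Q \<inter> D1) x * (\<psi> (h x) * ennreal \<bar>d x\<bar>)"
      by (simp add: PU)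
    \<comment> \<open>On the rest of \<open>Q\<close> the determinant is 0.\<close>
    also have "\<dots> = indicator Q x * (\<psi> (h x) * ennreal \<bar>d x\<bar>)"
      using Q(2) by (auto simp: D1_def indicator_def)
    finally show "(\<Sum>n. indicator (P n) x * (\<psi> (h x) * ennreal \<bar>d x\<bar>)) =
      indicator Q x * (\<psi> (h x) * ennreal \<bar>d x\<bar>)" .
  qed
  finally show ?thesis by (simp add: d_def)
qed

section \<open>Continuously differentiable functions\<close>

definition C1_on :: "'a::euclidean_space set \<Rightarrow> ('a \<Rightarrow> real) \<Rightarrow> bool" where
  "C1_on T f \<longleftrightarrow> (\<exists>f'. (\<forall>x\<in>T. (f has_derivative f' x) (at x)) \<and> (\<forall>v. continuous_on T (\<lambda>x. f' x v)))"

lemma C1_onI: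
  "(\<And>x. x \<in> T \<Longrightarrow> (f has_derivative f' x) (at x)) \<Longrightarrow> (\<And>v. continuous_on T (\<lambda>x. f' x v)) \<Longrightarrow> C1_on T f"
  unfolding C1_on_def by blast

lemma C1_onE:
  assumes "C1_on T f"
  obtains f' where "\<And>x. x \<in> T \<Longrightarrow> (f has_derivative f' x) (at x)" "\<And>v. continuous_on T (\<lambda>x. f' x v)"
  using assms unfolding C1_on_def by blast

lemma C1_on_has_derivative:
  assumes "C1_on T f" "x \<in> T"
  shows "(f has_derivative frechet_derivative f (at x)) (at x)"
  using assms by (meson C1_onE differentiableI frechet_derivative_works)

lemma C1_on_continuous_derivative:
  assumes "C1_on T f"
  shows "continuous_on T (\<lambda>x. frechet_derivative f (at x) v)"
proof -
  obtain f' where f': "\<And>x. x \<in> T \<Longrightarrow> (f has_derivative f' x) (at x)" "\<And>v. continuous_on T (\<lambda>x. f' x v)"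
    by (rule C1_onE[OF assms]) blast
  show ?thesis
    using f'(2)[of v] by (rule continuous_on_eq) (metis f'(1) frechet_derivative_at)
qed

lemma C1_on_continuous: "C1_on T f \<Longrightarrow> continuous_on T f"
  by (intro continuous_at_imp_continuous_on ballI has_derivative_continuous[OF C1_on_has_derivative])

lemma C1_on_subset: "C1_on T f \<Longrightarrow> S \<subseteq> T \<Longrightarrow> C1_on S f"
  unfolding C1_on_def by (meson continuous_on_subset subsetD)

lemma C1_on_cong:
  assumes "C1_on T f" "open T" "\<And>x. x \<in> T \<Longrightarrow> g x = f x"
  shows "C1_on T g"
proof -
  obtain f' where f': "\<And>x. x \<in> T \<Longrightarrow> (f has_derivative f' x) (at x)" "\<And>v. continuous_on T (\<lambda>x. f' x v)"
    by (rule C1_onE[OF assms(1)]) blast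
  show ?thesis
  proof (rule C1_onI[OF _ f'(2)])
    fix x assume "x \<in> T"
    show "(g has_derivative f' x) (at x)"
      by (rule has_derivative_transform_within_open[OF f'(1)[OF \<open>x \<in> T\<close>] \<open>open T\<close> \<open>x \<in> T\<close>])
        (simp add: assms(3))
  qed
qed

lemma C1_on_C_k_on: "C_k_on (Suc 0) f T \<Longrightarrow> C1_on T f"
  by (auto intro!: C1_onI simp: frechet_derivative_works)

lemma C1_on_const: "C1_on T (\<lambda>_. c)"
  by (rule C1_onI[of _ _ "\<lambda>_ _. 0"]) auto

lemma C1_on_linear: "bounded_linear f \<Longrightarrow> C1_on T f"
  by (rule C1_onI[of _ _ "\<lambda>_. f"]) (auto intro: bounded_linear_imp_has_derivative)

lemma C1_on_add:
  assumes "C1_on T f" "C1_on T g" shows "C1_on T (\<lambda>x. f x + g x)"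
proof -
  obtain f' where f': "\<And>x. x \<in> T \<Longrightarrow> (f has_derivative f' x) (at x)" "\<And>v. continuous_on T (\<lambda>x. f' x v)"
    by (rule C1_onE[OF assms(1)]) blast
  obtain g' where g': "\<And>x. x \<in> T \<Longrightarrow> (g has_derivative g' x) (at x)" "\<And>v. continuous_on T (\<lambda>x. g' x v)"
    by (rule C1_onE[OF assms(2)]) blast
  show ?thesis
    by (rule C1_onI[of _ _ "\<lambda>x v. f' x v + g' x v"])
      (auto intro!: has_derivative_add continuous_on_add f' g')
qed

lemma C1_on_mult:
  assumes "C1_on T f" "C1_on T g" shows "C1_on T (\<lambda>x. f x * g x)"
proof -
  obtain f' where f': "\<And>x. x \<in> T \<Longrightarrow> (f has_derivative f' x) (at x)" "\<And>v. continuous_on T (\<lambda>x. f' x v)"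
    by (rule C1_onE[OF assms(1)]) blast
  obtain g' where g': "\<And>x. x \<in> T \<Longrightarrow> (g has_derivative g' x) (at x)" "\<And>v. continuous_on T (\<lambda>x. g' x v)"
    by (rule C1_onE[OF assms(2)]) blast
  show ?thesis
  proof (rule C1_onI)
    show "((\<lambda>x. f x * g x) has_derivative (\<lambda>v. f x * g' x v + f' x v * g x)) (at x)" if "x \<in> T" for x
      by (intro has_derivative_mult f' g' that)
    show "continuous_on T (\<lambda>x. f x * g' x v + f' x v * g x)" for v
      using assms[THEN C1_on_continuous] by (intro continuous_intros f' g')
  qed
qed

lemma C1_on_cmult: "C1_on T f \<Longrightarrow> C1_on T (\<lambda>x. c * f x)"
  by (intro C1_on_mult C1_on_const)

lemma C1_on_minus: "C1_on T f \<Longrightarrow> C1_on T (\<lambda>x. - f x)"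
  using C1_on_cmult[of T f "-1"] by simp

lemma C1_on_sum: "(\<And>i. i \<in> I \<Longrightarrow> C1_on T (f i)) \<Longrightarrow> C1_on T (\<lambda>x. \<Sum>i\<in>I. f i x)"
  by (induction I rule: infinite_finite_induct) (auto intro: C1_on_add C1_on_const)

lemma C1_on_prod: "(\<And>i. i \<in> I \<Longrightarrow> C1_on T (f i)) \<Longrightarrow> C1_on T (\<lambda>x. \<Prod>i\<in>I. f i x)"
  by (induction I rule: infinite_finite_induct) (auto intro: C1_on_mult C1_on_const)

lemma C1_on_inverse:
  assumes "C1_on T f" "\<And>x. x \<in> T \<Longrightarrow> f x \<noteq> 0" shows "C1_on T (\<lambda>x. inverse (f x))"
proof -
  obtain f' where f': "\<And>x. x \<in> T \<Longrightarrow> (f has_derivative f' x) (at x)" "\<And>v. continuous_on T (\<lambda>x. f' x v)"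
    by (rule C1_onE[OF assms(1)]) blast
  show ?thesis
  proof (rule C1_onI)
    show "((\<lambda>x. inverse (f x)) has_derivative (\<lambda>v. - (inverse (f x) * f' x v * inverse (f x)))) (at x)"
      if "x \<in> T" for x
      by (intro Deriv.has_derivative_inverse f' assms(2) that)
    show "continuous_on T (\<lambda>x. - (inverse (f x) * f' x v * inverse (f x)))" for v
      using assms(2) assms(1)[THEN C1_on_continuous] by (intro continuous_intros f') auto
  qed
qed

lemma C1_on_divide:
  "C1_on T f \<Longrightarrow> C1_on T g \<Longrightarrow> (\<And>x. x \<in> T \<Longrightarrow> g x \<noteq> 0) \<Longrightarrow> C1_on T (\<lambda>x. f x / g x)"
  unfolding divide_inverse by (intro C1_on_mult C1_on_inverse)

lemma C1_on_exp:
  assumes "C1_on T f" shows "C1_on T (\<lambda>x. exp (f x))"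
proof -
  obtain f' where f': "\<And>x. x \<in> T \<Longrightarrow> (f has_derivative f' x) (at x)" "\<And>v. continuous_on T (\<lambda>x. f' x v)"
    by (rule C1_onE[OF assms(1)]) blast
  show ?thesis
  proof (rule C1_onI)
    show "((\<lambda>x. exp (f x)) has_derivative (\<lambda>v. exp (f x) * f' x v)) (at x)" if "x \<in> T" for x
      using has_derivative_exp[OF f'(1)[OF that]] by (simp add: mult.commute)
    show "continuous_on T (\<lambda>x. exp (f x) * f' x v)" for v
      using assms[THEN C1_on_continuous] by (intro continuous_intros f')
  qed
qed

lemma C1_on_det:
  fixes A :: "'a::euclidean_space \<Rightarrow> real^'n^'n"
  assumes "\<And>i j. C1_on T (\<lambda>x. A x $ i $ j)"
  shows "C1_on T (\<lambda>x. det (A x))"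
  unfolding det_def by (intro C1_on_sum C1_on_mult C1_on_const C1_on_prod assms)

lemma C1_on_compose:
  fixes g :: "'b::euclidean_space \<Rightarrow> real" and X :: "'a::euclidean_space \<Rightarrow> 'b"
  assumes g: "C1_on T g" and X: "\<And>b. b \<in> Basis \<Longrightarrow> C1_on D (\<lambda>z. X z \<bullet> b)"
    and XT: "\<And>z. z \<in> D \<Longrightarrow> X z \<in> T"
  shows "C1_on D (\<lambda>z. g (X z))"
proof -
  let ?Db = "\<lambda>z b. frechet_derivative (\<lambda>z. X z \<bullet> b) (at z)"
  let ?DX = "\<lambda>z v. \<Sum>b\<in>Basis. ?Db z b v *\<^sub>R b"
  let ?Dg = "\<lambda>x. frechet_derivative g (at x)"
  have DX: "(X has_derivative ?DX z) (at z)" if "z \<in> D" for z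
    unfolding has_derivative_componentwise_within[of X _ z UNIV]
  proof
    fix b :: 'b assume b: "b \<in> Basis"
    have "(\<lambda>v. ?DX z v \<bullet> b) = ?Db z b"
      using b by (simp add: fun_eq_iff)
    then show "((\<lambda>z. X z \<bullet> b) has_derivative (\<lambda>v. ?DX z v \<bullet> b)) (at z)"
      using C1_on_has_derivative[OF X[OF b] that] by simp
  qed
  have contX: "continuous_on D X"
    using DX by (intro continuous_at_imp_continuous_on) (auto intro: has_derivative_continuous)
  show ?thesis
  proof (rule C1_onI)
    fix z assume z: "z \<in> D"
    have lin: "linear (?Dg (X z))"
      using C1_on_has_derivative[OF g XT[OF z]] by (rule has_derivative_linear)
    have "((\<lambda>z. g (X z)) has_derivative (\<lambda>v. ?Dg (X z) (?DX z v))) (at z)"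
      using has_derivative_compose[OF DX[OF z] C1_on_has_derivative[OF g XT[OF z]]] .
    also have "(\<lambda>v. ?Dg (X z) (?DX z v)) = (\<lambda>v. \<Sum>b\<in>Basis. ?Db z b v * ?Dg (X z) b)"
      using lin by (simp add: linear_sum linear_scale)
    finally show "((\<lambda>z. g (X z)) has_derivative (\<lambda>v. \<Sum>b\<in>Basis. ?Db z b v * ?Dg (X z) b)) (at z)" .
  next
    fix v
    show "continuous_on D (\<lambda>z. \<Sum>b\<in>Basis. ?Db z b v * ?Dg (X z) b)"
      using XT by (intro continuous_intros C1_on_continuous_derivative X
        continuous_on_compose2[OF C1_on_continuous_derivative[OF g] contX]) auto
  qed
qed

text \<open>Cramer's rule writes the entries of the inverse as quotients of determinants, which are
  polynomials in the entries of \<open>M\<close>; the neighbourhood is where the denominator does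
  not vanish.\<close>

lemma C1_on_matrix_inverse:
  fixes M :: "'a::euclidean_space \<Rightarrow> real^'n^'n"
  assumes D: "open D" and M: "\<And>i j. C1_on D (\<lambda>z. M z $ i $ j)" and z0: "z0 \<in> D" "det (M z0) \<noteq> 0"
  obtains D' P where "open D'" "z0 \<in> D'" "D' \<subseteq> D" "\<And>i j. C1_on D' (\<lambda>z. P z $ i $ j)"
    "\<And>z. z \<in> D' \<Longrightarrow> M z ** P z = mat 1" "\<And>z. z \<in> D' \<Longrightarrow> P z ** M z = (mat 1 :: real^'n^'n)"
proof -
  define D' where "D' = D \<inter> (\<lambda>z. det (M z)) -` (- {0})"
  have detM: "C1_on D (\<lambda>z. det (M z))" by (intro C1_on_det M)
  have D': "open D'" "z0 \<in> D'" "D' \<subseteq> D"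
    unfolding D'_def using z0 by (auto intro!: continuous_open_preimage[OF C1_on_continuous[OF detM] D])
  \<comment> \<open>The Cramer numerator for entry (k, l): column \<open>k\<close> of
    \<open>M z\<close> is replaced by the unit vector with index \<open>l\<close>.\<close>
  define N where "N k l z = (\<chi> i j. if j = k then (if i = l then 1 else 0) else M z $ i $ j)" for k l z
  define P where "P z = (\<chi> k l. det (N k l z) / det (M z))" for z
  have "C1_on D' (\<lambda>z. P z $ k $ l)" for k l
  proof -
    have "C1_on D' (\<lambda>z. N k l z $ i $ j)" for i j
      using C1_on_subset[OF M D'(3), of i j] by (cases "j = k") (auto simp: N_def C1_on_const)
    then show ?thesis
      unfolding P_def by (simp, intro C1_on_divide C1_on_det C1_on_subset[OF M D'(3)]) (auto simp: D'_def)
  qed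
  moreover have MP: "M z ** P z = mat 1" if "z \<in> D'" for z
  proof -
    have nz: "det (M z) \<noteq> 0" using that by (simp add: D'_def)
    have "M z *v (\<chi> k. P z $ k $ l) = axis l 1" for l
      unfolding cramer[OF nz] P_def N_def
      by (simp add: axis_def) (intro ext arg_cong2[where f = "(/)"] arg_cong[where f = det], auto simp: vec_eq_iff axis_def)
    then have "(M z *v (\<chi> k. P z $ k $ l)) $ i = axis l 1 $ i" for i l by simp
    then show ?thesis
      by (simp add: vec_eq_iff matrix_matrix_mult_def matrix_vector_mult_def mat_def axis_def)
  qed
  ultimately show thesis
    using that[OF D', of P] matrix_left_right_inverse by blast
qed

section \<open>Partial derivatives and the area formula in coordinates\<close>

definition partial :: "'n \<Rightarrow> (real^'n \<Rightarrow> real) \<Rightarrow> real^'n \<Rightarrow> real" where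
  "partial l f z = frechet_derivative f (at z) (axis l 1)"

lemma partial_eq: "(f has_derivative f') (at z) \<Longrightarrow> partial l f z = f' (axis l 1)"
  unfolding partial_def by (metis frechet_derivative_at)

lemma continuous_on_partial: "C1_on D f \<Longrightarrow> continuous_on D (partial l f)"
  unfolding partial_def by (rule C1_on_continuous_derivative)

lemma partial_cong:
  assumes "open D" "z \<in> D" "\<And>x. x \<in> D \<Longrightarrow> f x = g x" "C1_on D f"
  shows "partial l f z = partial l g z"
proof -
  have "(f has_derivative frechet_derivative f (at z)) (at z)"
    using C1_on_has_derivative[OF assms(4,2)] .
  moreover from this have "(g has_derivative frechet_derivative f (at z)) (at z)"
    by (rule has_derivative_transform_within_open[OF _ assms(1,2)]) (simp add: assms(3))
  ultimately show ?thesis using partial_eq by metis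
qed

lemma partial_add:
  "C1_on D f \<Longrightarrow> C1_on D g \<Longrightarrow> z \<in> D \<Longrightarrow> partial l (\<lambda>x. f x + g x) z = partial l f z + partial l g z"
  unfolding partial_def[of l f] partial_def[of l g]
  by (intro partial_eq) (intro has_derivative_add C1_on_has_derivative)

lemma partial_mult:
  "C1_on D f \<Longrightarrow> C1_on D g \<Longrightarrow> z \<in> D \<Longrightarrow>
    partial l (\<lambda>x. f x * g x) z = f z * partial l g z + partial l f z * g z"
  unfolding partial_def[of l f] partial_def[of l g]
  by (intro partial_eq) (intro has_derivative_mult C1_on_has_derivative)

lemma partial_const: "partial l (\<lambda>_. c) z = 0"
  by (rule partial_eq[where f' = "\<lambda>_. 0"]) simp

lemma partial_cmult: "C1_on D f \<Longrightarrow> z \<in> D \<Longrightarrow> partial l (\<lambda>x. c * f x) z = c * partial l f z"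
  using partial_mult[of D "\<lambda>_. c" f z l] by (simp add: C1_on_const partial_const)

lemma partial_minus: "C1_on D f \<Longrightarrow> z \<in> D \<Longrightarrow> partial l (\<lambda>x. - f x) z = - partial l f z"
  using partial_cmult[of D f z l "-1"] by simp

lemma partial_sum:
  "(\<And>i. i \<in> I \<Longrightarrow> C1_on D (f i)) \<Longrightarrow> z \<in> D \<Longrightarrow>
    partial l (\<lambda>x. \<Sum>i\<in>I. f i x) z = (\<Sum>i\<in>I. partial l (f i) z)"
proof (induction I rule: infinite_finite_induct)
  case (insert i I)
  then show ?case
    by (simp add: partial_add[of D] C1_on_sum)
qed (simp_all add: partial_const)

lemma partial_component: "partial l (\<lambda>z. z $ i) z = (if i = l then 1 else 0)"
  by (subst partial_eq[where f' = "\<lambda>z. z $ i"])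
    (auto simp: axis_def intro!: bounded_linear_imp_has_derivative bounded_linear_vec_nth)

corollary area_formula_C1:
  fixes h :: "real^'n::{finite,wellorder} \<Rightarrow> real^'n::_"
  assumes D: "open D" and Q: "fsigma Q" "Q \<subseteq> D" and h: "\<And>j. C1_on D (\<lambda>z. h z $ j)"
    and \<psi>: "\<psi> \<in> borel_measurable borel"
  shows "(\<integral>\<^sup>+y. \<psi> y * ecount {x \<in> Q. h x = y} \<partial>lborel) =
    (\<integral>\<^sup>+x. indicator Q x * (\<psi> (h x) * ennreal \<bar>det (\<chi> j l. partial l (\<lambda>z. h z $ j) x)\<bar>) \<partial>lborel)"
proof -
  define h' where "h' x v = (\<chi> j. frechet_derivative (\<lambda>z. h z $ j) (at x) v)" for x v
  have "(h has_derivative h' x) (at x)" if "x \<in> D" for x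
    unfolding has_derivative_componentwise_within[of h _ x UNIV]
  proof
    fix b :: "real^'n::{finite,wellorder}" assume "b \<in> Basis"
    then obtain j where b: "b = axis j 1" by (auto simp: Basis_vec_def)
    show "((\<lambda>x. h x \<bullet> b) has_derivative (\<lambda>v. h' x v \<bullet> b)) (at x)"
      using C1_on_has_derivative[OF h that] by (simp add: b inner_axis h'_def)
  qed
  moreover have "continuous_on D (\<lambda>x. h' x v)" for v
    unfolding h'_def by (intro continuous_on_vec_lambda C1_on_continuous_derivative h)
  moreover have "matrix (h' x) = (\<chi> j l. partial l (\<lambda>z. h z $ j) x)" for x
    by (simp add: matrix_def h'_def partial_def)
  ultimately show ?thesis
    using area_formula[OF D Q, of h h' \<psi>] \<psi> by simp
qed

lemma continuous_on_local_C1: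
  assumes "\<And>x. x \<in> S \<Longrightarrow> \<exists>T F. open T \<and> x \<in> T \<and> C1_on T F \<and> (\<forall>y\<in>S \<inter> T. F y = f y)"
  shows "continuous_on S f"
  unfolding continuous_on_eq_continuous_within
proof
  fix x assume x: "x \<in> S"
  obtain T F where T: "open T" "x \<in> T" "C1_on T F" "\<forall>y\<in>S \<inter> T. F y = f y"
    using assms[OF x] by auto
  have "continuous_on (S \<inter> T) F"
    by (rule continuous_on_subset[OF C1_on_continuous[OF T(3)]]) simp
  then have "continuous_on (S \<inter> T) f"
    by (rule continuous_on_eq) (use T(4) in auto)
  then have "continuous (at x within S \<inter> T) f"
    using x T(2) by (simp add: continuous_on_eq_continuous_within)
  then show "continuous (at x within S) f"
    using at_within_nhd[of x T "S \<inter> T" S] T(1,2) by auto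
qed

section \<open>Lebesgue and Gaussian measures on coefficient spaces\<close>

abbreviation lborel_PiM :: "'i set \<Rightarrow> ('i \<Rightarrow> real) measure" where
  "lborel_PiM I \<equiv> PiM I (\<lambda>_. lborel)"

lemma product_sigma_finite_lborel: "product_sigma_finite (\<lambda>_. lborel :: real measure)"
  by unfold_locales

lemma sigma_finite_lborel_PiM: "finite I \<Longrightarrow> sigma_finite_measure (lborel_PiM I)"
  using product_sigma_finite.sigma_finite[OF product_sigma_finite_lborel] .

lemma distr_lborel_PiM_shift:
  fixes v :: "'i \<Rightarrow> real"
  assumes I: "finite I"
  shows "distr (lborel_PiM I) (lborel_PiM I) (\<lambda>x. \<lambda>i\<in>I. x i + v i) = lborel_PiM I"
proof (rule product_sigma_finite.PiM_eqI[OF product_sigma_finite_lborel I])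
  interpret product_sigma_finite "\<lambda>_::'i. lborel :: real measure"
    by (rule product_sigma_finite_lborel)
  have [measurable]: "(\<lambda>x. \<lambda>i\<in>I. x i + v i) \<in> measurable (lborel_PiM I) (lborel_PiM I)"
    by measurable
  fix A :: "'i \<Rightarrow> real set" assume A: "\<And>i. i \<in> I \<Longrightarrow> A i \<in> sets lborel"
  have A': "(\<lambda>x. x + v i) -` A i \<in> sets lborel" if "i \<in> I" for i
    using measurable_sets[of "\<lambda>x. x + v i" borel borel "A i"] A[OF that] by simp
  have pre: "(\<lambda>x. \<lambda>i\<in>I. x i + v i) -` Pi\<^sub>E I A \<inter> space (lborel_PiM I) =
      Pi\<^sub>E I (\<lambda>i. (\<lambda>x. x + v i) -` A i)"
    by (auto simp: space_PiM PiE_iff)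
  have "emeasure (distr (lborel_PiM I) (lborel_PiM I) (\<lambda>x. \<lambda>i\<in>I. x i + v i)) (Pi\<^sub>E I A) =
      emeasure (lborel_PiM I) (Pi\<^sub>E I (\<lambda>i. (\<lambda>x. x + v i) -` A i))"
    using A I by (subst emeasure_distr) (auto simp: pre intro!: sets_PiM_I_finite)
  also have "\<dots> = (\<Prod>i\<in>I. emeasure lborel ((\<lambda>x. x + v i) -` A i))"
    using A' I by (intro emeasure_PiM) auto
  also have "\<dots> = (\<Prod>i\<in>I. emeasure lborel (A i))"
  proof (rule prod.cong)
    fix i assume "i \<in> I"
    have "emeasure lborel (A i) = emeasure (distr lborel borel ((+) (v i))) (A i)"
      by (simp add: lborel_distr_plus)
    also have "\<dots> = emeasure lborel ((\<lambda>x. x + v i) -` A i)"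
      using A[OF \<open>i \<in> I\<close>] by (subst emeasure_distr) (auto simp: add.commute[of "v i"] vimage_def)
    finally show "emeasure lborel ((\<lambda>x. x + v i) -` A i) = emeasure lborel (A i)" by simp
  qed simp
  finally show "emeasure (distr (lborel_PiM I) (lborel_PiM I) (\<lambda>x. \<lambda>i\<in>I. x i + v i)) (Pi\<^sub>E I A) =
      (\<Prod>i\<in>I. emeasure lborel (A i))" .
qed simp

lemma nn_integral_lborel_PiM_shift:
  fixes v :: "'i \<Rightarrow> real"
  assumes "finite I" and [measurable]: "f \<in> borel_measurable (lborel_PiM I)"
  shows "(\<integral>\<^sup>+x. f (\<lambda>i\<in>I. x i + v i) \<partial>lborel_PiM I) = (\<integral>\<^sup>+x. f x \<partial>lborel_PiM I)"
proof -
  have "(\<integral>\<^sup>+x. f x \<partial>lborel_PiM I) =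
      (\<integral>\<^sup>+x. f x \<partial>distr (lborel_PiM I) (lborel_PiM I) (\<lambda>x. \<lambda>i\<in>I. x i + v i))"
    by (simp add: distr_lborel_PiM_shift[OF assms(1)])
  also have "\<dots> = (\<integral>\<^sup>+x. f (\<lambda>i\<in>I. x i + v i) \<partial>lborel_PiM I)"
    by (subst nn_integral_distr) measurable
  finally show ?thesis by simp
qed

section \<open>Integrability of power weights\<close>

lemma nn_integral_powr_real_finite:
  fixes s :: real
  assumes s: "s > 1"
  shows "(\<integral>\<^sup>+x. ennreal ((1 + \<bar>x\<bar>) powr - s) \<partial>lborel) < \<infinity>"
proof -
  let ?f = "\<lambda>x::real. (1 + \<bar>x\<bar>) powr - s"
  let ?F = "\<lambda>x::real. (1 + x) powr (1 - s) / (1 - s)"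
  have "(\<integral>\<^sup>+x. ennreal (?f x) * indicator {0..} x \<partial>lborel) = 0 - ?F 0"
  proof (rule nn_integral_FTC_atLeast)
    show "?f \<in> borel_measurable borel" by measurable
    show "DERIV ?F x :> ?f x" if "0 \<le> x" for x
    proof -
      have "((\<lambda>x. (1 + x) powr (1 - s)) has_real_derivative (1 - s) * (1 + x) powr (1 - s - 1) * (0 + 1)) (at x)"
        using that by (intro DERIV_chain2[OF has_real_derivative_powr] derivative_intros) auto
      then have "DERIV ?F x :> (1 - s) * (1 + x) powr (1 - s - 1) * (0 + 1) / (1 - s)"
        by (rule DERIV_cdivide)
      then show ?thesis using that s by simp
    qed
    have "((\<lambda>x::real. (1 + x) powr (1 - s)) \<longlongrightarrow> 0) at_top"
      using s by (intro tendsto_neg_powr filterlim_tendsto_add_at_top[OF tendsto_const])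
        (auto intro: filterlim_ident)
    then have "(?F \<longlongrightarrow> 0 / (1 - s)) at_top"
      using s by (intro tendsto_intros) auto
    then show "(?F \<longlongrightarrow> 0) at_top" by simp
  qed simp
  then have fin: "(\<integral>\<^sup>+x. ennreal (?f x) * indicator {0..} x \<partial>lborel) < \<infinity>"
    by (simp add: less_top[symmetric])
  have "(\<integral>\<^sup>+x. ennreal (?f x) * indicator {0..} x \<partial>lborel) =
      ennreal \<bar>-1\<bar> * (\<integral>\<^sup>+x. ennreal (?f (0 + (-1) * x)) * indicator {0..} (0 + (-1) * x) \<partial>lborel)"
    by (rule nn_integral_real_affine)
      (auto intro!: borel_measurable_times borel_measurable_indicator)
  then have fin2: "(\<integral>\<^sup>+x. ennreal (?f x) * indicator {0..} (- x) \<partial>lborel) < \<infinity>"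
    using fin by simp
  have "(\<integral>\<^sup>+x. ennreal (?f x) \<partial>lborel) \<le>
      (\<integral>\<^sup>+x. ennreal (?f x) * indicator {0..} x + ennreal (?f x) * indicator {0..} (- x) \<partial>lborel)"
    by (intro nn_integral_mono) (auto split: split_indicator)
  also have "\<dots> = (\<integral>\<^sup>+x. ennreal (?f x) * indicator {0..} x \<partial>lborel) +
      (\<integral>\<^sup>+x. ennreal (?f x) * indicator {0..} (- x) \<partial>lborel)"
    by (intro nn_integral_add) measurable
  also have "\<dots> < \<infinity>" using fin fin2 by simp
  finally show ?thesis .
qed

text \<open>The summand 1 keeps negative powers bounded near the origin. The sum of absolute values
  is used as the norm because it compares easily with products over the coordinates and with sums of
  shifts.\<close>

definition wt :: "'i set \<Rightarrow> ('i \<Rightarrow> real) \<Rightarrow> real" where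
  "wt I c = 1 + (\<Sum>i\<in>I. \<bar>c i\<bar>)"

lemma wt_ge_1: "1 \<le> wt I c"
  unfolding wt_def by (simp add: sum_nonneg)

lemma wt_pos: "0 < wt I c"
  using wt_ge_1[of I c] by linarith

lemma measurable_wt [measurable]: "wt I \<in> borel_measurable (lborel_PiM I)"
  unfolding wt_def by measurable

lemma wt_add_le:
  "wt I (\<lambda>i\<in>I. c i + d i) \<le> wt I c + (\<Sum>i\<in>I. \<bar>d i\<bar>)"
  unfolding wt_def sum.distrib[symmetric] add.assoc
  by (simp add: sum.distrib[symmetric] sum_mono)

lemma wt_le_prod: "finite I \<Longrightarrow> wt I c \<le> (\<Prod>i\<in>I. 1 + \<bar>c i\<bar>)"
proof (induction I rule: finite_induct)
  case (insert i I)
  have "(1::real) \<le> (\<Prod>i\<in>I. 1 + \<bar>c i\<bar>)" by (intro prod_ge_1) simp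
  then have "\<bar>c i\<bar> \<le> \<bar>c i\<bar> * (\<Prod>i\<in>I. 1 + \<bar>c i\<bar>)"
    by (simp add: mult_le_cancel_left1)
  then show ?case using insert by (simp add: wt_def algebra_simps)
qed (simp add: wt_def)

text \<open>The weight dominates \<open>1 + \<bar>c i\<bar>\<close> for every \<open>i\<close>.
  Distributing the exponent evenly bounds the integrand by a product of one-dimensional powers with
  exponent \<open>\<beta> / card I\<close>, which exceeds 1.\<close>

lemma nn_integral_wt_finite:
  assumes I: "finite I" and \<beta>: "real (card I) < \<beta>"
  shows "(\<integral>\<^sup>+c. ennreal (wt I c powr - \<beta>) \<partial>lborel_PiM I) < \<infinity>"
proof (cases "I = {}")
  case True
  show ?thesis using True by (simp add: PiM_empty nn_integral_count_space_finite)
next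
  case False
  interpret product_sigma_finite "\<lambda>_::'a. lborel :: real measure"
    by (rule product_sigma_finite_lborel)
  define s where "s = \<beta> / card I"
  have card: "0 < card I" using False I by (simp add: card_gt_0_iff)
  have s: "s > 1" using \<beta> card by (simp add: s_def)
  have le: "wt I c powr - \<beta> \<le> (\<Prod>i\<in>I. (1 + \<bar>c i\<bar>) powr - s)" for c
  proof -
    have "(\<Prod>i\<in>I. wt I c powr - s) \<le> (\<Prod>i\<in>I. (1 + \<bar>c i\<bar>) powr - s)"
    proof (rule prod_mono)
      fix i assume "i \<in> I"
      then have "1 + \<bar>c i\<bar> \<le> wt I c"
        unfolding wt_def using I member_le_sum[of i I "\<lambda>i. \<bar>c i\<bar>"] by auto
      then show "0 \<le> wt I c powr - s \<and> wt I c powr - s \<le> (1 + \<bar>c i\<bar>) powr - s"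
        using s by (auto intro!: powr_mono2')
    qed
    also have "(\<Prod>i\<in>I. wt I c powr - s) = wt I c powr - \<beta>"
      using card wt_pos[of I c] by (simp add: s_def powr_power)
    finally show ?thesis .
  qed
  have "(\<integral>\<^sup>+c. ennreal (wt I c powr - \<beta>) \<partial>lborel_PiM I) \<le>
      (\<integral>\<^sup>+c. (\<Prod>i\<in>I. ennreal ((1 + \<bar>c i\<bar>) powr - s)) \<partial>lborel_PiM I)"
    using le by (intro nn_integral_mono) (simp add: prod_ennreal ennreal_leI)
  also have "\<dots> = (\<Prod>i\<in>I. \<integral>\<^sup>+x. ennreal ((1 + \<bar>x\<bar>) powr - s) \<partial>lborel)"
    using I by (intro product_nn_integral_prod) measurable
  also have "\<dots> < \<infinity>"
    using nn_integral_powr_real_finite[OF s] by (simp add: power_less_top_ennreal)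
  finally show ?thesis .
qed

section \<open>Standard Gaussian coefficients\<close>

definition std_normal :: "real measure" where
  "std_normal = density lborel (\<lambda>x. ennreal (std_normal_density x))"

lemma prob_space_std_normal: "prob_space std_normal"
  unfolding std_normal_def by (rule prob_space_normal_density) simp

lemma sets_std_normal [simp, measurable_cong]: "sets std_normal = sets borel"
  by (simp add: std_normal_def)

lemma space_std_normal [simp]: "space std_normal = UNIV"
  by (simp add: std_normal_def)

definition gauss_density :: "'i set \<Rightarrow> ('i \<Rightarrow> real) \<Rightarrow> real" where
  "gauss_density I x = (\<Prod>i\<in>I. std_normal_density (x i))"

lemma gauss_density_nonneg: "0 \<le> gauss_density I x"
  unfolding gauss_density_def by (intro prod_nonneg) (simp add: normal_density_nonneg)

lemma measurable_gauss_density [measurable]: "gauss_density I \<in> borel_measurable (lborel_PiM I)"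
  unfolding gauss_density_def by measurable

lemma PiM_std_normal:
  assumes I: "finite I"
  shows "PiM I (\<lambda>_. std_normal) = density (lborel_PiM I) (\<lambda>x. ennreal (gauss_density I x))"
proof -
  interpret N: product_sigma_finite "\<lambda>_::'a. std_normal"
    by (intro product_sigma_finite.intro prob_space_imp_sigma_finite prob_space_std_normal)
  interpret product_sigma_finite "\<lambda>_::'a. lborel :: real measure"
    by (rule product_sigma_finite_lborel)
  have "density (lborel_PiM I) (\<lambda>x. ennreal (gauss_density I x)) = PiM I (\<lambda>_. std_normal)"
  proof (rule N.PiM_eqI[OF I])
    show "sets (density (lborel_PiM I) (\<lambda>x. ennreal (gauss_density I x))) = sets (PiM I (\<lambda>_. std_normal))"
      by (simp cong: sets_PiM_cong)
    fix A :: "'a \<Rightarrow> real set" assume "\<And>i. i \<in> I \<Longrightarrow> A i \<in> sets std_normal"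
    then have A: "\<And>i. i \<in> I \<Longrightarrow> A i \<in> sets borel" by simp
    have "Pi\<^sub>E I A \<in> sets (lborel_PiM I)"
      using A I by (intro sets_PiM_I_finite) auto
    then have "emeasure (density (lborel_PiM I) (\<lambda>x. ennreal (gauss_density I x))) (Pi\<^sub>E I A) =
        (\<integral>\<^sup>+x. ennreal (gauss_density I x) * indicator (Pi\<^sub>E I A) x \<partial>lborel_PiM I)"
      by (subst emeasure_density) auto
    also have "\<dots> = (\<integral>\<^sup>+x. (\<Prod>i\<in>I. ennreal (std_normal_density (x i)) * indicator (A i) (x i)) \<partial>lborel_PiM I)"
    proof (rule nn_integral_cong)
      fix x :: "'a \<Rightarrow> real" assume x: "x \<in> space (lborel_PiM I)"
      have "indicator (Pi\<^sub>E I A) x = (\<Prod>i\<in>I. indicator (A i) (x i) :: ennreal)"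
      proof (cases "x \<in> Pi\<^sub>E I A")
        case True
        then show ?thesis by (auto simp: PiE_iff)
      next
        case False
        then obtain i where "i \<in> I" "x i \<notin> A i"
          using x by (auto simp: PiE_iff space_PiM)
        then show ?thesis using False I by (auto simp: prod_zero_iff intro!: bexI[of _ i])
      qed
      then show "ennreal (gauss_density I x) * indicator (Pi\<^sub>E I A) x =
          (\<Prod>i\<in>I. ennreal (std_normal_density (x i)) * indicator (A i) (x i))"
        by (simp add: gauss_density_def prod.distrib prod_ennreal normal_density_nonneg)
    qed
    also have "\<dots> = (\<Prod>i\<in>I. \<integral>\<^sup>+x. ennreal (std_normal_density x) * indicator (A i) x \<partial>lborel)"
      using A I by (intro product_nn_integral_prod borel_measurable_times borel_measurable_indicator) auto
    also have "\<dots> = (\<Prod>i\<in>I. emeasure std_normal (A i))"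
      using A by (intro prod.cong refl) (simp add: std_normal_def emeasure_density)
    finally show "emeasure (density (lborel_PiM I) (\<lambda>x. ennreal (gauss_density I x))) (Pi\<^sub>E I A) =
      (\<Prod>i\<in>I. emeasure std_normal (A i))" .
  qed
  then show ?thesis by simp
qed

text \<open>With y = 1 + |x|, the power of y is bounded by a multiple of the exponential of y,
  because y / n is at most exp (y / n); the Gaussian exponent is bounded by 3 / 2 - y.\<close>

lemma std_normal_density_le_powr:
  obtains C where "\<And>x. std_normal_density x \<le> C * (1 + \<bar>x\<bar>) powr - \<beta>" "0 \<le> C"
proof -
  define n where "n = Suc (nat \<lceil>\<beta>\<rceil>)"
  have n: "\<beta> \<le> real n" "0 < n" unfolding n_def by linarith+
  let ?C = "exp (3 / 2) * real n ^ n"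
  have "std_normal_density x \<le> ?C * (1 + \<bar>x\<bar>) powr - \<beta>" for x
  proof -
    let ?y = "1 + \<bar>x\<bar>"
    have "(?y / n) ^ n \<le> exp (?y / n) ^ n"
    proof (rule power_mono)
      show "?y / real n \<le> exp (?y / real n)"
        using exp_ge_add_one_self[of "?y / real n"] by linarith
    qed simp
    also have "\<dots> = exp ?y" using n(2) by (simp add: exp_of_nat_mult[symmetric])
    finally have "?y ^ n \<le> real n ^ n * exp ?y"
      using n(2) by (simp add: power_divide field_simps)
    moreover have "?y powr \<beta> \<le> ?y ^ n"
      using n(1) powr_mono[of \<beta> "real n" ?y] by (simp add: powr_realpow)
    ultimately have y: "?y powr \<beta> \<le> real n ^ n * exp ?y" by linarith
    \<comment> \<open>This is nonnegativity of the square of \<open>\<bar>x\<bar> - 1\<close>, the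
      source of the constant 3 / 2.\<close>
    have "- x\<^sup>2 / 2 \<le> 3 / 2 - ?y"
      using zero_le_power2[of "\<bar>x\<bar> - 1"] by (simp add: power2_eq_square algebra_simps)
    then have "exp (- x\<^sup>2 / 2) * ?y powr \<beta> \<le> exp (3 / 2 - ?y) * (real n ^ n * exp ?y)"
      using y by (intro mult_mono) auto
    also have "exp (3 / 2 - y) * (real n ^ n * exp y) = ?C" for y by (simp add: exp_diff)
    finally have *: "exp (- x\<^sup>2 / 2) \<le> ?C * ?y powr - \<beta>"
      by (simp add: powr_minus_divide field_simps)
    have "1 \<le> sqrt (2 * pi)"
      using pi_gt3 by simp
    then have "std_normal_density x \<le> exp (- x\<^sup>2 / 2)"
      unfolding std_normal_density_def by (intro mult_left_le_one_le) auto
    with * show ?thesis by linarith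
  qed
  then show thesis using that[of ?C] by simp
qed

lemma gauss_density_le_wt:
  assumes I: "finite I" and \<beta>: "0 \<le> \<beta>"
  obtains C where "\<And>x. gauss_density I x \<le> C * wt I x powr - \<beta>" "0 \<le> C"
proof -
  obtain C where C: "\<And>x. std_normal_density x \<le> C * (1 + \<bar>x\<bar>) powr - \<beta>" "0 \<le> C"
    by (rule std_normal_density_le_powr) blast
  have "gauss_density I x \<le> C ^ card I * wt I x powr - \<beta>" for x :: "'a \<Rightarrow> real"
  proof -
    have "gauss_density I x \<le> (\<Prod>i\<in>I. C * (1 + \<bar>x i\<bar>) powr - \<beta>)"
      unfolding gauss_density_def by (intro prod_mono) (simp add: C normal_density_nonneg)
    also have "\<dots> = C ^ card I * (\<Prod>i\<in>I. 1 + \<bar>x i\<bar>) powr - \<beta>"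
      by (simp add: prod.distrib prod_powr_distrib)
    also have "\<dots> \<le> C ^ card I * wt I x powr - \<beta>"
      using C(2) \<beta> wt_le_prod[OF I, of x] wt_pos[of I x]
      by (intro mult_left_mono powr_mono2') auto
    finally show ?thesis .
  qed
  then show thesis using that[of "C ^ card I"] C(2) by simp
qed

section \<open>The Kac-Rice integral in a chart\<close>

lemma borel_measurable_vecI:
  fixes f :: "'w \<Rightarrow> real^'n"
  assumes "\<And>j. (\<lambda>x. f x $ j) \<in> borel_measurable M"
  shows "f \<in> borel_measurable M"
  unfolding borel_measurable_euclidean_space[of f M]
  using assms by (auto simp: Basis_vec_def inner_axis)

lemma borel_measurable_vec_nth [measurable]: "(\<lambda>x :: real^'n. x $ j) \<in> borel_measurable borel"
  by (intro borel_measurable_continuous_onI continuous_intros)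

lemma borel_measurable_det:
  fixes A :: "'w \<Rightarrow> real^'n^'n"
  assumes "\<And>i j. (\<lambda>x. A x $ i $ j) \<in> borel_measurable M"
  shows "(\<lambda>x. det (A x)) \<in> borel_measurable M"
  unfolding det_def
  by (intro borel_measurable_sum borel_measurable_times borel_measurable_const borel_measurable_prod assms)

text \<open>Leibniz expansion. The bounds are separate for each row because the rows of the Jacobian
  grow with different coefficients: those of the Gaussian field, those of W, or none.\<close>

lemma abs_det_le:
  fixes A :: "real^'n^'n"
  assumes "\<And>i j. \<bar>A $ i $ j\<bar> \<le> r i"
  shows "\<bar>det A\<bar> \<le> real (card {p :: 'n \<Rightarrow> 'n. p permutes UNIV}) * (\<Prod>i\<in>UNIV. r i)"
proof -
  have "\<bar>det A\<bar> \<le> (\<Sum>p\<in>{p. p permutes UNIV}. \<bar>of_int (sign p) * (\<Prod>i\<in>UNIV. A $ i $ p i)\<bar>)"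
    unfolding det_def by (rule sum_abs)
  also have "\<dots> \<le> (\<Sum>p\<in>{p :: 'n \<Rightarrow> 'n. p permutes UNIV}. \<Prod>i\<in>UNIV. r i)"
  proof (rule sum_mono)
    fix p :: "'n \<Rightarrow> 'n"
    have "\<bar>of_int (sign p) * (\<Prod>i\<in>UNIV. A $ i $ p i)\<bar> = (\<Prod>i\<in>UNIV. \<bar>A $ i $ p i\<bar>)"
      by (simp add: abs_mult abs_prod sign_def)
    also have "\<dots> \<le> (\<Prod>i\<in>UNIV. r i)"
      using assms by (intro prod_mono) auto
    finally show "\<bar>of_int (sign p) * (\<Prod>i\<in>UNIV. A $ i $ p i)\<bar> \<le> (\<Prod>i\<in>UNIV. r i)" .
  qed
  finally show ?thesis by simp
qed

text \<open>Averaging the left-hand side over the shifts \<open>sh \<tau>\<close>, with weight \<open>\<kappa> \<tau>\<close>, turns the number of zeros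
  into the number of preimages of \<open>\<tau>\<close> under \<open>h p\<close>, to which the area formula applies.\<close>

lemma nn_integral_eq_shift_area:
  fixes \<mu> :: "'p measure" and h :: "'p \<Rightarrow> real^'n::{finite,wellorder} \<Rightarrow> real^'n::_"
  assumes sf: "sigma_finite_measure \<mu>"
    and sh: "(\<lambda>x. sh (fst x) (snd x)) \<in> measurable (lborel \<Otimes>\<^sub>M \<mu>) \<mu>"
    and inv: "\<And>\<tau> F. F \<in> borel_measurable \<mu> \<Longrightarrow> (\<integral>\<^sup>+p. F (sh \<tau> p) \<partial>\<mu>) = (\<integral>\<^sup>+p. F p \<partial>\<mu>)"
    and \<rho>: "\<rho> \<in> borel_measurable \<mu>" and N: "N \<in> borel_measurable \<mu>"
    and \<kappa>: "(\<lambda>x. \<kappa> (fst x) (snd x)) \<in> borel_measurable (lborel \<Otimes>\<^sub>M \<mu>)"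
    and \<kappa>1: "\<And>p. p \<in> space \<mu> \<Longrightarrow> (\<integral>\<^sup>+\<tau>. \<kappa> \<tau> p \<partial>lborel) = 1"
    and D: "open D" and Q: "fsigma Q" "Q \<subseteq> D"
    and h: "\<And>p j. p \<in> space \<mu> \<Longrightarrow> C1_on D (\<lambda>z. h p z $ j)"
    and hm: "(\<lambda>x. h (snd x) (fst x)) \<in> borel_measurable (lborel \<Otimes>\<^sub>M \<mu>)"
    and J: "\<And>p z. p \<in> space \<mu> \<Longrightarrow> z \<in> Q \<Longrightarrow> J p z = \<bar>det (\<chi> j l. partial l (\<lambda>z. h p z $ j) z)\<bar>"
    and Jm: "(\<lambda>x. J (snd x) (fst x)) \<in> borel_measurable (lborel \<Otimes>\<^sub>M \<mu>)"
    and cnt: "\<And>\<tau> p. p \<in> space \<mu> \<Longrightarrow> \<kappa> \<tau> (sh \<tau> p) \<noteq> 0 \<Longrightarrow> N (sh \<tau> p) = ecount {z \<in> Q. h p z = \<tau>}"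
  shows "(\<integral>\<^sup>+p. N p * \<rho> p \<partial>\<mu>) =
    (\<integral>\<^sup>+z. indicator Q z * (\<integral>\<^sup>+p. \<rho> (sh (h p z) p) * \<kappa> (h p z) (sh (h p z) p) * ennreal (J p z) \<partial>\<mu>) \<partial>lborel)"
proof -
  interpret \<mu>: sigma_finite_measure \<mu> by fact
  interpret P: pair_sigma_finite "lborel :: (real^'n::_) measure" \<mu> ..
  note [measurable] = \<rho> N \<kappa> sh hm Jm fsigma_borel[OF Q(1)]
  have sh1[measurable]: "(\<lambda>\<tau>. sh \<tau> p) \<in> measurable lborel \<mu>" if "p \<in> space \<mu>" for p
    using measurable_compose[OF measurable_Pair2'[OF that] sh] by simp
  have sh2[measurable]: "sh \<tau> \<in> measurable \<mu> \<mu>" for \<tau>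
    using measurable_compose[OF measurable_Pair1'[of \<tau> lborel \<mu>] sh] by simp
  have \<kappa>2[measurable]: "\<kappa> \<tau> \<in> borel_measurable \<mu>" for \<tau>
    using measurable_compose[OF measurable_Pair1'[of \<tau> lborel \<mu>] \<kappa>] by simp
  have \<kappa>1'[measurable]: "(\<lambda>\<tau>. \<kappa> \<tau> p) \<in> borel_measurable lborel" if "p \<in> space \<mu>" for p
    using measurable_compose[OF measurable_Pair2'[OF that] \<kappa>] by simp
  have shp: "(\<lambda>x. (fst x, sh (fst x) (snd x))) \<in> measurable (lborel \<Otimes>\<^sub>M \<mu>) (lborel \<Otimes>\<^sub>M \<mu>)"
    by measurable
  have \<kappa>sh[measurable]: "(\<lambda>x. \<kappa> (fst x) (sh (fst x) (snd x))) \<in> borel_measurable (lborel \<Otimes>\<^sub>M \<mu>)"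
    using measurable_compose[OF shp \<kappa>] by simp
  have \<rho>sh[measurable]: "(\<lambda>x. \<rho> (sh (fst x) (snd x))) \<in> borel_measurable (lborel \<Otimes>\<^sub>M \<mu>)"
    by measurable
  have hp: "(\<lambda>x. (h (snd x) (fst x), snd x)) \<in> measurable (lborel \<Otimes>\<^sub>M \<mu>) (lborel \<Otimes>\<^sub>M \<mu>)"
    using hm by measurable
  have [measurable]: "(\<lambda>x. \<kappa> (h (snd x) (fst x)) (sh (h (snd x) (fst x)) (snd x))) \<in> borel_measurable (lborel \<Otimes>\<^sub>M \<mu>)"
    using measurable_compose[OF hp \<kappa>sh] by simp
  have [measurable]: "(\<lambda>x. \<rho> (sh (h (snd x) (fst x)) (snd x))) \<in> borel_measurable (lborel \<Otimes>\<^sub>M \<mu>)"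
    using measurable_compose[OF hp \<rho>sh] by simp
  \<comment> \<open>The kernel has total mass 1 over the levels, so it may be inserted.\<close>
  have "(\<integral>\<^sup>+p. N p * \<rho> p \<partial>\<mu>) = (\<integral>\<^sup>+p. \<integral>\<^sup>+\<tau>. N p * \<rho> p * \<kappa> \<tau> p \<partial>lborel \<partial>\<mu>)"
    by (intro nn_integral_cong) (simp add: nn_integral_cmult \<kappa>1)
  also have "\<dots> = (\<integral>\<^sup>+\<tau>. \<integral>\<^sup>+p. N p * \<rho> p * \<kappa> \<tau> p \<partial>\<mu> \<partial>lborel)"
    by (rule P.Fubini') (simp add: case_prod_unfold)
  \<comment> \<open>Invariance is applied for each fixed \<open>\<tau>\<close>. After exchanging the
    integrals once more, \<open>p\<close> is fixed and \<open>\<tau>\<close> varies, and on the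
    support of the kernel the count is that of the preimages of \<open>\<tau>\<close> under the
    single map \<open>h p\<close>.\<close>
  also have "\<dots> = (\<integral>\<^sup>+\<tau>. \<integral>\<^sup>+p. N (sh \<tau> p) * \<rho> (sh \<tau> p) * \<kappa> \<tau> (sh \<tau> p) \<partial>\<mu> \<partial>lborel)"
    by (intro nn_integral_cong inv[symmetric]) measurable
  also have "\<dots> = (\<integral>\<^sup>+p. \<integral>\<^sup>+\<tau>. N (sh \<tau> p) * \<rho> (sh \<tau> p) * \<kappa> \<tau> (sh \<tau> p) \<partial>lborel \<partial>\<mu>)"
    by (rule P.Fubini'[symmetric]) (simp add: case_prod_unfold)
  also have "\<dots> = (\<integral>\<^sup>+p. \<integral>\<^sup>+z. indicator Q z * (\<rho> (sh (h p z) p) * \<kappa> (h p z) (sh (h p z) p) * ennreal (J p z)) \<partial>lborel \<partial>\<mu>)"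
  proof (rule nn_integral_cong)
    fix p assume p: "p \<in> space \<mu>"
    have "(\<integral>\<^sup>+\<tau>. N (sh \<tau> p) * \<rho> (sh \<tau> p) * \<kappa> \<tau> (sh \<tau> p) \<partial>lborel) =
        (\<integral>\<^sup>+\<tau>. (\<rho> (sh \<tau> p) * \<kappa> \<tau> (sh \<tau> p)) * ecount {z \<in> Q. h p z = \<tau>} \<partial>lborel)"
    proof (rule nn_integral_cong)
      fix \<tau>
      show "N (sh \<tau> p) * \<rho> (sh \<tau> p) * \<kappa> \<tau> (sh \<tau> p) =
          (\<rho> (sh \<tau> p) * \<kappa> \<tau> (sh \<tau> p)) * ecount {z \<in> Q. h p z = \<tau>}"
        \<comment> \<open>Outside the support of the kernel nothing is known about the count, but
          both sides contain the factor 0.\<close>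
        using cnt[OF p, of \<tau>] by (cases "\<kappa> \<tau> (sh \<tau> p) = 0") (auto simp: mult_ac)
    qed
    also have "\<dots> = (\<integral>\<^sup>+z. indicator Q z * (\<rho> (sh (h p z) p) * \<kappa> (h p z) (sh (h p z) p) *
        ennreal \<bar>det (\<chi> j l. partial l (\<lambda>z. h p z $ j) z)\<bar>) \<partial>lborel)"
    proof (rule area_formula_C1[OF D Q h[OF p]])
      have "(\<lambda>\<tau>. \<rho> (sh \<tau> p) * \<kappa> \<tau> (sh \<tau> p)) \<in> borel_measurable lborel"
        using measurable_compose[OF measurable_Pair2'[OF p] \<kappa>sh]
          measurable_compose[OF sh1[OF p] \<rho>] by simp
      then show "(\<lambda>\<tau>. \<rho> (sh \<tau> p) * \<kappa> \<tau> (sh \<tau> p)) \<in> borel_measurable borel" by simp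
    qed
    also have "\<dots> = (\<integral>\<^sup>+z. indicator Q z * (\<rho> (sh (h p z) p) * \<kappa> (h p z) (sh (h p z) p) * ennreal (J p z)) \<partial>lborel)"
      using J[OF p] by (intro nn_integral_cong) (auto split: split_indicator)
    finally show "(\<integral>\<^sup>+\<tau>. N (sh \<tau> p) * \<rho> (sh \<tau> p) * \<kappa> \<tau> (sh \<tau> p) \<partial>lborel) = \<dots>" .
  qed
  also have "\<dots> = (\<integral>\<^sup>+z. \<integral>\<^sup>+p. indicator Q z * (\<rho> (sh (h p z) p) * \<kappa> (h p z) (sh (h p z) p) * ennreal (J p z)) \<partial>\<mu> \<partial>lborel)"
    by (rule P.Fubini') (simp add: case_prod_unfold)
  also have "\<dots> = (\<integral>\<^sup>+z. indicator Q z * (\<integral>\<^sup>+p. \<rho> (sh (h p z) p) * \<kappa> (h p z) (sh (h p z) p) * ennreal (J p z) \<partial>\<mu>) \<partial>lborel)"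
    by (intro nn_integral_cong) (simp split: split_indicator)
  finally show ?thesis .
qed

lemma nn_integral_pair_shift:
  assumes I: "finite I" and K: "finite K"
    and F[measurable]: "F \<in> borel_measurable (lborel_PiM I \<Otimes>\<^sub>M lborel_PiM K)"
  shows "(\<integral>\<^sup>+p. F (\<lambda>i\<in>I. fst p i + v i, \<lambda>k\<in>K. snd p k + v' k) \<partial>(lborel_PiM I \<Otimes>\<^sub>M lborel_PiM K)) =
    (\<integral>\<^sup>+p. F p \<partial>(lborel_PiM I \<Otimes>\<^sub>M lborel_PiM K))"
proof -
  interpret K: sigma_finite_measure "lborel_PiM K" by (rule sigma_finite_lborel_PiM[OF K])
  have "(\<integral>\<^sup>+p. F (\<lambda>i\<in>I. fst p i + v i, \<lambda>k\<in>K. snd p k + v' k) \<partial>(lborel_PiM I \<Otimes>\<^sub>M lborel_PiM K)) =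
      (\<integral>\<^sup>+x. \<integral>\<^sup>+y. F (\<lambda>i\<in>I. x i + v i, \<lambda>k\<in>K. y k + v' k) \<partial>lborel_PiM K \<partial>lborel_PiM I)"
    by (subst K.nn_integral_fst[symmetric]) auto
  also have "\<dots> = (\<integral>\<^sup>+x. \<integral>\<^sup>+y. F (\<lambda>i\<in>I. x i + v i, y) \<partial>lborel_PiM K \<partial>lborel_PiM I)"
  proof (rule nn_integral_cong)
    fix x assume "x \<in> space (lborel_PiM I)"
    have "(\<lambda>i\<in>I. x i + v i) \<in> space (lborel_PiM I)" by (simp add: space_PiM)
    then have "(\<lambda>y. F (\<lambda>i\<in>I. x i + v i, y)) \<in> borel_measurable (lborel_PiM K)" by measurable
    from nn_integral_lborel_PiM_shift[OF K this, of v']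
    show "(\<integral>\<^sup>+y. F (\<lambda>i\<in>I. x i + v i, \<lambda>k\<in>K. y k + v' k) \<partial>lborel_PiM K) =
        (\<integral>\<^sup>+y. F (\<lambda>i\<in>I. x i + v i, y) \<partial>lborel_PiM K)" .
  qed
  also have "\<dots> = (\<integral>\<^sup>+x. \<integral>\<^sup>+y. F (x, y) \<partial>lborel_PiM K \<partial>lborel_PiM I)"
    by (rule nn_integral_lborel_PiM_shift[OF I, where f = "\<lambda>x. \<integral>\<^sup>+y. F (x, y) \<partial>lborel_PiM K"]) measurable
  also have "\<dots> = (\<integral>\<^sup>+p. F p \<partial>(lborel_PiM I \<Otimes>\<^sub>M lborel_PiM K))"
    by (rule K.nn_integral_fst) measurable
  finally show ?thesis .
qed

text \<open>A chart of the hypersurface is padded by a coordinate \<open>i0\<close> on which the fields do not depend, so that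
  the number of unknowns equals that of the equations in \<open>real ^ 'n\<close>: the additional equation
  \<open>z $ i0 = s\<close> has the same number of solutions for every \<open>s\<close> between \<open>s0\<close> and \<open>s1\<close>. The equation with index
  \<open>i1\<close> belongs to the Gaussian field at level \<open>- u\<close>, the remaining ones to \<open>W\<close>, where the matrix of the
  perturbation directions \<open>f\<close> has been normalised to the identity. The translation of the Gaussian
  coefficients by \<open>u * q k z\<close> compensates the level.\<close>

locale chart_fields =
  fixes D Q :: "(real^'n::{finite,wellorder}) set" and i0 i1 :: "'n::{finite,wellorder}"
    and I :: "'i set" and K :: "'k set"
    and V :: "'i \<Rightarrow> 'n::{finite,wellorder} \<Rightarrow> real^'n::{finite,wellorder} \<Rightarrow> real" and f :: "'n::{finite,wellorder} \<Rightarrow> 'i \<Rightarrow> real"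
    and g q :: "'k \<Rightarrow> real^'n::{finite,wellorder} \<Rightarrow> real" and w :: "real^'n::{finite,wellorder} \<Rightarrow> real" and k1 :: 'k
    and \<sigma>2 B s0 s1 \<beta> C :: real and \<rho> :: "('i \<Rightarrow> real) \<Rightarrow> ennreal"
    and N :: "real \<Rightarrow> ('i \<Rightarrow> real) \<times> ('k \<Rightarrow> real) \<Rightarrow> ennreal"
  assumes D: "open D" "bounded D" and Q: "fsigma Q" "Q \<subseteq> D"
    and i01: "i0 \<noteq> i1" and I: "finite I" and K: "finite K" "k1 \<in> K"
    and V: "\<And>i j. i \<in> I \<Longrightarrow> C1_on D (V i j)" "\<And>i j z. z \<notin> D \<Longrightarrow> V i j z = 0"
    and g: "\<And>k. k \<in> K \<Longrightarrow> C1_on D (g k)" "\<And>k z. z \<notin> D \<Longrightarrow> g k z = 0"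
    and w: "C1_on D w" "\<And>z. z \<notin> D \<Longrightarrow> w z = 0"
    and g1: "\<And>z. z \<in> D \<Longrightarrow> g k1 z = 1"
    and f: "\<And>j j' z. z \<in> D \<Longrightarrow> j \<in> UNIV - {i0, i1} \<Longrightarrow> j' \<in> UNIV - {i0, i1} \<Longrightarrow>
        (\<Sum>i\<in>I. f j i * V i j' z) = (if j = j' then 1 else 0)"
    and q: "\<And>z. z \<in> D \<Longrightarrow> (\<Sum>k\<in>K. q k z * g k z) = w z"
      "\<And>l z. z \<in> D \<Longrightarrow> (\<Sum>k\<in>K. q k z * partial l (g k) z) = partial l w z"
      "\<And>z. z \<in> D \<Longrightarrow> (\<Sum>k\<in>K. (q k z)\<^sup>2) = 1 / \<sigma>2"
      "\<And>x z. z \<in> D \<Longrightarrow> (\<Sum>k\<in>K. x k * g k z) = 0 \<Longrightarrow> (\<Sum>k\<in>K. x k * q k z) = 0"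
    and bounds: "0 \<le> B" "\<And>i j l z. i \<in> I \<Longrightarrow> z \<in> D \<Longrightarrow> \<bar>partial l (V i j) z\<bar> \<le> B"
      "\<And>k l z. k \<in> K \<Longrightarrow> z \<in> D \<Longrightarrow> \<bar>partial l (g k) z\<bar> \<le> B"
    and s: "s0 < s1"
    and \<rho>: "\<rho> \<in> borel_measurable (lborel_PiM I)"
      "\<And>c. c \<in> space (lborel_PiM I) \<Longrightarrow> \<rho> c \<le> ennreal (C * wt I c powr - \<beta>)"
      "0 \<le> C" "real (card I) < \<beta>"
    and N: "\<And>u. N u \<in> borel_measurable (lborel_PiM I \<Otimes>\<^sub>M lborel_PiM K)"
      "\<And>u p s. p \<in> space (lborel_PiM I \<Otimes>\<^sub>M lborel_PiM K) \<Longrightarrow> s0 \<le> s \<Longrightarrow> s \<le> s1 \<Longrightarrow>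
        N u p = ecount {z \<in> Q. z $ i0 = s \<and> (\<Sum>k\<in>K. snd p k * g k z) + u * w z = 0 \<and>
          (\<forall>j\<in>UNIV - {i0, i1}. (\<Sum>i\<in>I. fst p i * V i j z) = 0)}"
begin

abbreviation "js \<equiv> UNIV - {i0, i1}"

abbreviation "\<mu> \<equiv> lborel_PiM I \<Otimes>\<^sub>M lborel_PiM K"

text \<open>The signs are chosen so that \<open>h u p z\<close> is the shift that must be added to
  the coefficients to make the fields vanish at \<open>z\<close>.\<close>

definition "h u p z = (\<chi> j. if j = i0 then z $ i0
    else if j = i1 then - ((\<Sum>k\<in>K. snd p k * g k z) + u * w z)
    else - (\<Sum>i\<in>I. fst p i * V i j z))"

text \<open>By the duality of \<open>f\<close> and \<open>V\<close>, adding
  \<open>\<tau> $ j\<close> times the direction \<open>f j\<close> raises equation \<open>j\<close>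
  of W by \<open>\<tau> $ j\<close> and leaves the others alone; since \<open>g k1\<close> is 1,
  raising coefficient \<open>k1\<close> raises the Gaussian equation by the same amount. Both hold
  at every point of \<open>D\<close> simultaneously. The padding coordinate of \<open>\<tau>\<close>
  moves no coefficient.\<close>

definition "sh \<tau> p = (\<lambda>i\<in>I. fst p i + (\<Sum>j\<in>js. \<tau> $ j * f j i), \<lambda>k\<in>K. snd p k + (if k = k1 then \<tau> $ i1 else 0))"

definition "dens p = \<rho> (fst p) * ennreal (gauss_density K (snd p))"

text \<open>On the support of the kernel a shift then changes the weight of the coefficients of W by
  at most one half of the shifted weight. The summand 1 avoids a vanishing denominator when there
  are no directions.\<close>

definition "eps = 1 / (2 * ((\<Sum>j\<in>js. \<Sum>i\<in>I. \<bar>f j i\<bar>) + 1))"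

definition "rad p = eps * wt I (fst p)"

text \<open>The width of the kernel is proportional to the size of the coefficients of \<open>W\<close>: its normalisation
  then cancels the growth of the Jacobian, and the decay \<open>\<beta> > card I\<close> of the density suffices for
  integrability.\<close>

definition "kap \<tau> p = (if s0 \<le> \<tau> $ i0 \<and> \<tau> $ i0 \<le> s1 \<and> \<bar>\<tau> $ i1\<bar> \<le> 1 / 2 \<and> (\<forall>j\<in>js. \<bar>\<tau> $ j\<bar> \<le> rad p)
    then ennreal (1 / ((s1 - s0) * (2 * rad p) ^ card js)) else 0)"

text \<open>The indicators make the entries Borel on the whole space, as Fubini requires; on
  \<open>D\<close> this is the matrix of partial derivatives of \<open>h\<close>.\<close>

definition "dh u p z = (\<chi> j l. if j = i0 then (if i0 = l then 1 else 0)
    else if j = i1 then - ((\<Sum>k\<in>K. snd p k * (indicator D z * partial l (g k) z)) + u * (indicator D z * partial l w z))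
    else - (\<Sum>i\<in>I. fst p i * (indicator D z * partial l (V i j) z)))"

definition "Jac u p z = \<bar>det (dh u p z)\<bar>"

lemma eps_pos: "0 < eps" and eps_sum: "eps * (\<Sum>j\<in>js. \<Sum>i\<in>I. \<bar>f j i\<bar>) \<le> 1 / 2"
proof -
  have "0 \<le> (\<Sum>j\<in>js. \<Sum>i\<in>I. \<bar>f j i\<bar>)" by (intro sum_nonneg) simp
  then show "0 < eps" "eps * (\<Sum>j\<in>js. \<Sum>i\<in>I. \<bar>f j i\<bar>) \<le> 1 / 2"
    by (simp_all add: eps_def field_simps)
qed

lemma rad_pos: "0 < rad p"
  unfolding rad_def by (intro mult_pos_pos eps_pos wt_pos)

lemma prod_split: "(\<Prod>j\<in>UNIV. F j) = F i0 * F i1 * (\<Prod>j\<in>js. F j)" for F :: "'n::{finite,wellorder} \<Rightarrow> real"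
proof -
  have "(UNIV :: 'n::{finite,wellorder} set) = insert i0 (insert i1 js)" by auto
  then have "(\<Prod>j\<in>UNIV. F j) = (\<Prod>j\<in>insert i0 (insert i1 js). F j)" by simp
  also have "\<dots> = F i0 * F i1 * (\<Prod>j\<in>js. F j)" using i01 by simp
  finally show ?thesis .
qed

lemma sf: "sigma_finite_measure \<mu>"
proof -
  interpret pair_sigma_finite "lborel_PiM I" "lborel_PiM K"
    by (intro pair_sigma_finite.intro sigma_finite_lborel_PiM I K)
  show ?thesis by (rule P.sigma_finite_measure_axioms)
qed

lemma borel_C1_ext:
  assumes "C1_on D F" "\<And>z. z \<notin> D \<Longrightarrow> F z = 0"
  shows "F \<in> borel_measurable borel"
proof -
  have "(\<lambda>z. indicator D z *\<^sub>R F z) \<in> borel_measurable borel"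
    using D(1) by (intro borel_measurable_continuous_on_indicator C1_on_continuous assms(1)) auto
  also have "(\<lambda>z. indicator D z *\<^sub>R F z) = F"
    using assms(2) by (auto simp: fun_eq_iff indicator_def)
  finally show ?thesis .
qed

lemma borel_partial_ext:
  assumes "C1_on D F"
  shows "(\<lambda>z. indicator D z * partial l F z) \<in> borel_measurable borel"
  using D(1) borel_measurable_continuous_on_indicator[of D "partial l F"] continuous_on_partial[OF assms]
  by auto

lemma V_meas [measurable]: "i \<in> I \<Longrightarrow> V i j \<in> borel_measurable borel"
  by (intro borel_C1_ext V)

lemma g_meas [measurable]: "k \<in> K \<Longrightarrow> g k \<in> borel_measurable borel"
  by (intro borel_C1_ext g)

lemma w_meas [measurable]: "w \<in> borel_measurable borel"
  by (intro borel_C1_ext w)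

lemma h_meas: "(\<lambda>x. h u (snd x) (fst x)) \<in> borel_measurable (lborel \<Otimes>\<^sub>M \<mu>)"
proof (rule borel_measurable_vecI)
  fix j
  have 1: "(\<lambda>x. \<Sum>k\<in>K. snd (snd x) k * g k (fst x)) \<in> borel_measurable (lborel \<Otimes>\<^sub>M \<mu>)"
    by (intro borel_measurable_sum borel_measurable_times) measurable
  have 2: "(\<lambda>x. \<Sum>i\<in>I. fst (snd x) i * V i j (fst x)) \<in> borel_measurable (lborel \<Otimes>\<^sub>M \<mu>)"
    by (intro borel_measurable_sum borel_measurable_times) measurable
  show "(\<lambda>x. h u (snd x) (fst x) $ j) \<in> borel_measurable (lborel \<Otimes>\<^sub>M \<mu>)"
    unfolding h_def using 1 2 by (cases "j = i0"; cases "j = i1") (simp_all, measurable)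
qed

lemma Jac_meas: "(\<lambda>x. Jac u (snd x) (fst x)) \<in> borel_measurable (lborel \<Otimes>\<^sub>M \<mu>)"
  unfolding Jac_def
proof (intro borel_measurable_abs borel_measurable_det)
  fix j l
  have fst: "(\<lambda>x. F (fst x)) \<in> borel_measurable (lborel \<Otimes>\<^sub>M \<mu>)" if "F \<in> borel_measurable borel"
    for F :: "real^'n::{finite,wellorder} \<Rightarrow> real"
    using measurable_compose[OF measurable_fst, of F lborel borel \<mu>] that by simp
  have 1: "(\<lambda>x. \<Sum>k\<in>K. snd (snd x) k * (indicator D (fst x) * partial l (g k) (fst x))) \<in> borel_measurable (lborel \<Otimes>\<^sub>M \<mu>)"
    by (intro borel_measurable_sum borel_measurable_times[OF _ fst[OF borel_partial_ext[OF g(1)]]]) measurable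
  have 2: "(\<lambda>x. \<Sum>i\<in>I. fst (snd x) i * (indicator D (fst x) * partial l (V i j) (fst x))) \<in> borel_measurable (lborel \<Otimes>\<^sub>M \<mu>)"
    by (intro borel_measurable_sum borel_measurable_times[OF _ fst[OF borel_partial_ext[OF V(1)]]]) measurable
  have 3: "(\<lambda>x. u * (indicator D (fst x) * partial l w (fst x))) \<in> borel_measurable (lborel \<Otimes>\<^sub>M \<mu>)"
    by (rule borel_measurable_times[OF borel_measurable_const fst[OF borel_partial_ext[OF w(1)]]])
  have eq: "(\<lambda>x. dh u (snd x) (fst x) $ j $ l) = (if j = i0 then (\<lambda>x. if i0 = l then 1 else 0)
      else if j = i1 then (\<lambda>x. - ((\<Sum>k\<in>K. snd (snd x) k * (indicator D (fst x) * partial l (g k) (fst x))) +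
        u * (indicator D (fst x) * partial l w (fst x))))
      else (\<lambda>x. - (\<Sum>i\<in>I. fst (snd x) i * (indicator D (fst x) * partial l (V i j) (fst x)))))"
    by (auto simp: dh_def fun_eq_iff)
  show "(\<lambda>x. dh u (snd x) (fst x) $ j $ l) \<in> borel_measurable (lborel \<Otimes>\<^sub>M \<mu>)"
    unfolding eq using 1 2 3
    by (simp only: split: if_split)
      (intro conjI impI borel_measurable_const borel_measurable_uminus borel_measurable_add)
qed

lemma h_C1: "C1_on D (\<lambda>z. h u p z $ j)"
proof -
  have eq: "(\<lambda>z. h u p z $ j) = (if j = i0 then (\<lambda>z. z $ i0)
      else if j = i1 then (\<lambda>z. - ((\<Sum>k\<in>K. snd p k * g k z) + u * w z))
      else (\<lambda>z. - (\<Sum>i\<in>I. fst p i * V i j z)))"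
    by (auto simp: h_def fun_eq_iff)
  have "C1_on D (\<lambda>z. z $ i0)" by (intro C1_on_linear bounded_linear_vec_nth)
  moreover have "C1_on D (\<lambda>z. - ((\<Sum>k\<in>K. snd p k * g k z) + u * w z))"
    by (rule C1_on_minus[OF C1_on_add[OF C1_on_sum[OF C1_on_cmult[OF g(1)]] C1_on_cmult[OF w(1)]]])
  moreover have "C1_on D (\<lambda>z. - (\<Sum>i\<in>I. fst p i * V i j z))"
    by (rule C1_on_minus[OF C1_on_sum[OF C1_on_cmult[OF V(1)]]])
  ultimately show ?thesis unfolding eq by (simp only: split: if_split) blast
qed

lemma dh_eq:
  assumes "z \<in> D"
  shows "dh u p z = (\<chi> j l. partial l (\<lambda>z. h u p z $ j) z)"
proof -
  have "partial l (\<lambda>z. h u p z $ j) z = dh u p z $ j $ l" for j l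
  proof -
    consider "j = i0" | "j = i1" | "j \<noteq> i0" "j \<noteq> i1" by blast
    then show ?thesis
    proof cases
      case 1
      then show ?thesis by (simp add: h_def dh_def partial_component)
    next
      case 2
      have S: "C1_on D (\<lambda>z. \<Sum>k\<in>K. snd p k * g k z)" and W: "C1_on D (\<lambda>z. u * w z)"
        by (rule C1_on_sum[OF C1_on_cmult[OF g(1)]], assumption) (rule C1_on_cmult[OF w(1)])
      have "partial l (\<lambda>z. - ((\<Sum>k\<in>K. snd p k * g k z) + u * w z)) z =
          - partial l (\<lambda>z. (\<Sum>k\<in>K. snd p k * g k z) + u * w z) z"
        by (rule partial_minus[OF C1_on_add[OF S W] assms])
      also have "\<dots> = - (partial l (\<lambda>z. \<Sum>k\<in>K. snd p k * g k z) z + partial l (\<lambda>z. u * w z) z)"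
        by (simp only: partial_add[OF S W assms])
      also have "\<dots> = - ((\<Sum>k\<in>K. partial l (\<lambda>z. snd p k * g k z) z) + u * partial l w z)"
        by (simp only: partial_cmult[OF w(1) assms] partial_sum[OF C1_on_cmult[OF g(1)] assms])
      also have "\<dots> = - ((\<Sum>k\<in>K. snd p k * partial l (g k) z) + u * partial l w z)"
        by (simp add: partial_cmult[OF g(1) assms])
      finally have "partial l (\<lambda>z. - ((\<Sum>k\<in>K. snd p k * g k z) + u * w z)) z =
          - ((\<Sum>k\<in>K. snd p k * partial l (g k) z) + u * partial l w z)" .
      then show ?thesis using 2 i01 assms by (simp add: h_def dh_def)
    next
      case 3
      have S: "C1_on D (\<lambda>z. \<Sum>i\<in>I. fst p i * V i j z)"
        by (intro C1_on_sum C1_on_cmult V)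
      have "partial l (\<lambda>z. - (\<Sum>i\<in>I. fst p i * V i j z)) z = - partial l (\<lambda>z. \<Sum>i\<in>I. fst p i * V i j z) z"
        by (rule partial_minus[OF S assms])
      also have "\<dots> = - (\<Sum>i\<in>I. partial l (\<lambda>z. fst p i * V i j z) z)"
        by (simp only: partial_sum[OF C1_on_cmult[OF V(1)] assms])
      also have "\<dots> = - (\<Sum>i\<in>I. fst p i * partial l (V i j) z)"
        by (simp add: partial_cmult[OF V(1) assms])
      finally have "partial l (\<lambda>z. - (\<Sum>i\<in>I. fst p i * V i j z)) z = - (\<Sum>i\<in>I. fst p i * partial l (V i j) z)" .
      then show ?thesis using 3 assms by (simp add: h_def dh_def)
    qed
  qed
  then show ?thesis by (simp add: vec_eq_iff)
qed

lemma sh_meas: "(\<lambda>x. sh (fst x) (snd x)) \<in> measurable (lborel \<Otimes>\<^sub>M \<mu>) \<mu>"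
  unfolding sh_def
proof (intro measurable_Pair measurable_restrict)
  fix i assume "i \<in> I"
  then show "(\<lambda>x. fst (snd x) i + (\<Sum>j\<in>js. fst x $ j * f j i)) \<in> measurable (lborel \<Otimes>\<^sub>M \<mu>) lborel"
    by measurable
next
  fix k assume "k \<in> K"
  then show "(\<lambda>x. snd (snd x) k + (if k = k1 then fst x $ i1 else 0)) \<in> measurable (lborel \<Otimes>\<^sub>M \<mu>) lborel"
    by measurable
qed

lemma sh_inv: "F \<in> borel_measurable \<mu> \<Longrightarrow> (\<integral>\<^sup>+p. F (sh \<tau> p) \<partial>\<mu>) = (\<integral>\<^sup>+p. F p \<partial>\<mu>)"
  unfolding sh_def
  using nn_integral_pair_shift[OF I K(1), of F "\<lambda>i. \<Sum>j\<in>js. \<tau> $ j * f j i" "\<lambda>k. if k = k1 then \<tau> $ i1 else 0"] .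

lemma sh_space: "p \<in> space \<mu> \<Longrightarrow> sh \<tau> p \<in> space \<mu>"
  by (auto simp: sh_def space_pair_measure space_PiM)

lemma dens_meas [measurable]: "dens \<in> borel_measurable \<mu>"
  unfolding dens_def using \<rho>(1) by measurable

lemma rad_meas [measurable]: "rad \<in> borel_measurable \<mu>"
  unfolding rad_def by measurable

lemma kap_meas: "(\<lambda>x. kap (fst x) (snd x)) \<in> borel_measurable (lborel \<Otimes>\<^sub>M \<mu>)"
  unfolding kap_def by measurable

text \<open>For fixed \<open>p\<close> the kernel is the indicator of a box divided by its volume.
  The side at \<open>i1\<close> has length 1, which accounts for the missing factor in the
  denominator.\<close>

lemma kap_1: "(\<integral>\<^sup>+\<tau>. kap \<tau> p \<partial>lborel) = 1"
proof -
  define l where "l = (\<chi> j. if j = i0 then s0 else if j = i1 then - (1 / 2) else - rad p)"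
  define r where "r = (\<chi> j. if j = i0 then s1 else if j = i1 then 1 / 2 else rad p)"
  define c where "c = (s1 - s0) * (2 * rad p) ^ card js"
  have c: "0 < c" unfolding c_def using s rad_pos[of p] by simp
  have mem: "\<tau> \<in> cbox l r \<longleftrightarrow> s0 \<le> \<tau> $ i0 \<and> \<tau> $ i0 \<le> s1 \<and> \<bar>\<tau> $ i1\<bar> \<le> 1 / 2 \<and> (\<forall>j\<in>js. \<bar>\<tau> $ j\<bar> \<le> rad p)" for \<tau>
  proof -
    have ab: "- a \<le> x \<and> x \<le> a \<longleftrightarrow> \<bar>x\<bar> \<le> a" for a x :: real by auto
    have "\<tau> \<in> cbox l r \<longleftrightarrow> (\<forall>j\<in>insert i0 (insert i1 js). l $ j \<le> \<tau> $ j \<and> \<tau> $ j \<le> r $ j)"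
      by (auto simp: mem_box_cart)
    also have "\<dots> \<longleftrightarrow> (s0 \<le> \<tau> $ i0 \<and> \<tau> $ i0 \<le> s1) \<and> (- (1 / 2) \<le> \<tau> $ i1 \<and> \<tau> $ i1 \<le> 1 / 2) \<and> (\<forall>j\<in>js. - rad p \<le> \<tau> $ j \<and> \<tau> $ j \<le> rad p)"
      using i01 by (simp add: l_def r_def)
    finally show ?thesis by (simp only: ab conj_assoc)
  qed
  have "l \<in> cbox l r"
    using s rad_pos[of p] by (auto simp: mem_box_cart l_def r_def intro: order_trans[of _ 0])
  then have "measure lborel (cbox l r) = (\<Prod>j\<in>UNIV. r $ j - l $ j)"
    using content_cbox_cart[of l r] by auto
  also have "\<dots> = c"
    using i01 by (simp add: prod_split l_def r_def c_def)
  finally have "emeasure lborel (cbox l r) = ennreal c"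
    by (metis emeasure_eq_ennreal_measure emeasure_lborel_cbox_finite infinity_ennreal_def less_irrefl)
  then have "(\<integral>\<^sup>+\<tau>. ennreal (1 / c) * indicator (cbox l r) \<tau> \<partial>lborel) = 1"
    using c by (simp add: nn_integral_cmult ennreal_mult[symmetric])
  moreover have "kap \<tau> p = ennreal (1 / c) * indicator (cbox l r) \<tau>" for \<tau>
    unfolding kap_def c_def[symmetric] by (simp add: indicator_def mem)
  ultimately show ?thesis by simp
qed

lemma sum_shift_f:
  assumes "z \<in> D" "j \<in> js"
  shows "(\<Sum>i\<in>I. (c i + (\<Sum>j\<in>js. \<tau> $ j * f j i)) * V i j z) = (\<Sum>i\<in>I. c i * V i j z) + \<tau> $ j"
proof -
  have "(\<Sum>i\<in>I. (\<Sum>j'\<in>js. \<tau> $ j' * f j' i) * V i j z) = (\<Sum>j'\<in>js. \<tau> $ j' * (\<Sum>i\<in>I. f j' i * V i j z))"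
    unfolding sum_distrib_left sum_distrib_right by (subst sum.swap) (simp add: mult.assoc)
  also have "\<dots> = (\<Sum>j'\<in>js. if j' = j then \<tau> $ j' else 0)"
    using f[OF assms(1) _ assms(2)] by (intro sum.cong) auto
  also have "\<dots> = \<tau> $ j" using assms(2) by simp
  finally show ?thesis by (simp add: distrib_right sum.distrib)
qed

lemma sum_shift_g:
  assumes "z \<in> D"
  shows "(\<Sum>k\<in>K. (x k + (if k = k1 then t else 0)) * g k z) = (\<Sum>k\<in>K. x k * g k z) + t"
proof -
  have "(\<Sum>k\<in>K. (if k = k1 then t else 0) * g k z) = (\<Sum>k\<in>K. if k = k1 then t * g k z else 0)"
    by (intro sum.cong) auto
  also have "\<dots> = t" using K g1[OF assms] by simp
  finally show ?thesis by (simp add: distrib_right sum.distrib)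
qed

text \<open>A nonzero kernel value forces the padding coordinate of \<open>\<tau>\<close> into the
  interval from \<open>s0\<close> to \<open>s1\<close>, where the padding equation has exactly as
  many solutions as there are zeros. The remaining equations become \<open>h u p z = \<tau>\<close>
  by the choice of the shift.\<close>

lemma count_eq:
  assumes p: "p \<in> space \<mu>" and kap: "kap \<tau> (sh \<tau> p) \<noteq> 0"
  shows "N u (sh \<tau> p) = ecount {z \<in> Q. h u p z = \<tau>}"
proof -
  have "s0 \<le> \<tau> $ i0" "\<tau> $ i0 \<le> s1" using kap by (auto simp: kap_def split: if_splits)
  note N(2)[OF sh_space[OF p, of \<tau>] this, of u]
  also have "{z \<in> Q. z $ i0 = \<tau> $ i0 \<and> (\<Sum>k\<in>K. snd (sh \<tau> p) k * g k z) + u * w z = 0 \<and>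
      (\<forall>j\<in>js. (\<Sum>i\<in>I. fst (sh \<tau> p) i * V i j z) = 0)} = {z \<in> Q. h u p z = \<tau>}"
  proof (intro Collect_cong conj_cong refl)
    fix z assume "z \<in> Q"
    then have z: "z \<in> D" using Q by auto
    have "h u p z = \<tau> \<longleftrightarrow> (\<forall>j\<in>insert i0 (insert i1 js). h u p z $ j = \<tau> $ j)"
      by (auto simp: vec_eq_iff)
    also have "\<dots> \<longleftrightarrow> z $ i0 = \<tau> $ i0 \<and> (\<Sum>k\<in>K. snd p k * g k z) + u * w z + \<tau> $ i1 = 0 \<and>
        (\<forall>j\<in>js. (\<Sum>i\<in>I. fst p i * V i j z) + \<tau> $ j = 0)"
    proof -
      have e0: "h u p z $ i0 = z $ i0" by (simp add: h_def)
      have e1: "h u p z $ i1 = \<tau> $ i1 \<longleftrightarrow> (\<Sum>k\<in>K. snd p k * g k z) + u * w z + \<tau> $ i1 = 0"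
        using i01 by (auto simp: h_def)
      have e2: "(\<forall>j\<in>js. h u p z $ j = \<tau> $ j) \<longleftrightarrow> (\<forall>j\<in>js. (\<Sum>i\<in>I. fst p i * V i j z) + \<tau> $ j = 0)"
        by (intro ball_cong refl) (auto simp: h_def)
      have "(\<forall>j\<in>insert i0 (insert i1 js). P j) \<longleftrightarrow> P i0 \<and> P i1 \<and> (\<forall>j\<in>js. P j)" for P by blast
      then show ?thesis unfolding e1[symmetric] e2[symmetric] by (simp only: e0)
    qed
    also have "\<dots> \<longleftrightarrow> z $ i0 = \<tau> $ i0 \<and> (\<Sum>k\<in>K. snd (sh \<tau> p) k * g k z) + u * w z = 0 \<and>
      (\<forall>j\<in>js. (\<Sum>i\<in>I. fst (sh \<tau> p) i * V i j z) = 0)"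
      using sum_shift_g[OF z, of "snd p" "\<tau> $ i1"] sum_shift_f[OF z, of _ "fst p" \<tau>]
      by (simp add: sh_def algebra_simps)
    finally show "(z $ i0 = \<tau> $ i0 \<and> (\<Sum>k\<in>K. snd (sh \<tau> p) k * g k z) + u * w z = 0 \<and>
      (\<forall>j\<in>js. (\<Sum>i\<in>I. fst (sh \<tau> p) i * V i j z) = 0)) \<longleftrightarrow> h u p z = \<tau>" by blast
  qed
  finally show ?thesis .
qed

text \<open>This is the Kac-Rice integral: for \<open>z\<close> in \<open>Q\<close>, the
  coefficients \<open>sh (h u p z) p\<close> are those of fields vanishing at \<open>z\<close>, with
  the Gaussian one taken at level \<open>- u\<close>. The inner integral is thus the weighted
  Jacobian over fields with a zero at \<open>z\<close>, without any explicit conditional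
  law.\<close>

lemma integral_formula:
  "(\<integral>\<^sup>+p. N u p * dens p \<partial>\<mu>) =
    (\<integral>\<^sup>+z. indicator Q z * (\<integral>\<^sup>+p. dens (sh (h u p z) p) * kap (h u p z) (sh (h u p z) p) * ennreal (Jac u p z) \<partial>\<mu>) \<partial>lborel)"
  using sf sh_meas sh_inv dens_meas N(1) kap_meas kap_1 D(1) Q h_C1 h_meas _ Jac_meas count_eq
proof (rule nn_integral_eq_shift_area)
  show "Jac u p z = \<bar>det (\<chi> j l. partial l (\<lambda>z. h u p z $ j) z)\<bar>" if "z \<in> Q" for p z
    using dh_eq[of z u p] that Q by (auto simp: Jac_def)
qed

end

text \<open>Expanding the squares, the cross terms add up to zero by orthogonality and only the
  squared length of the shift remains.\<close>

lemma gauss_density_tilt: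
  assumes "finite K" "(\<Sum>k\<in>K. x k * a k) = 0"
  shows "gauss_density K (\<lambda>k. x k - u * a k) = gauss_density K x * exp (- (u\<^sup>2 * (\<Sum>k\<in>K. (a k)\<^sup>2)) / 2)"
proof -
  have "std_normal_density (x k - u * a k) =
      std_normal_density (x k) * exp (u * (x k * a k) - u\<^sup>2 * (a k)\<^sup>2 / 2)" for k
  proof -
    have "- (x k - u * a k)\<^sup>2 / 2 = - (x k)\<^sup>2 / 2 + (u * (x k * a k) - u\<^sup>2 * (a k)\<^sup>2 / 2)"
      by (simp add: power2_eq_square field_simps)
    then have "exp (- (x k - u * a k)\<^sup>2 / 2) = exp (- (x k)\<^sup>2 / 2) * exp (u * (x k * a k) - u\<^sup>2 * (a k)\<^sup>2 / 2)"
      by (simp only: exp_add)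
    then show ?thesis by (simp add: std_normal_density_def)
  qed
  then have "gauss_density K (\<lambda>k. x k - u * a k) =
      gauss_density K x * exp (\<Sum>k\<in>K. u * (x k * a k) - u\<^sup>2 * (a k)\<^sup>2 / 2)"
    using assms(1) by (simp add: gauss_density_def prod.distrib exp_sum)
  also have "(\<Sum>k\<in>K. u * (x k * a k) - u\<^sup>2 * (a k)\<^sup>2 / 2) = - (u\<^sup>2 * (\<Sum>k\<in>K. (a k)\<^sup>2)) / 2"
    using assms(2) by (simp add: sum_subtractf sum_distrib_left[symmetric] sum_divide_distrib[symmetric])
  finally show ?thesis .
qed

lemma gauss_density_cong: "(\<And>k. k \<in> K \<Longrightarrow> x k = y k) \<Longrightarrow> gauss_density K x = gauss_density K y"
  unfolding gauss_density_def by (intro prod.cong) auto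

lemma wt_cong: "(\<And>k. k \<in> K \<Longrightarrow> x k = y k) \<Longrightarrow> wt K x = wt K y"
  unfolding wt_def by simp

context chart_fields
begin

lemma integrand_meas:
  "(\<lambda>x. dens (sh (h u (snd x) (fst x)) (snd x)) * kap (h u (snd x) (fst x)) (sh (h u (snd x) (fst x)) (snd x)) *
    ennreal (Jac u (snd x) (fst x))) \<in> borel_measurable (lborel \<Otimes>\<^sub>M \<mu>)"
proof -
  note [measurable] = h_meas[of u] Jac_meas[of u] kap_meas sh_meas
  have hp: "(\<lambda>x. (h u (snd x) (fst x), snd x)) \<in> measurable (lborel \<Otimes>\<^sub>M \<mu>) (lborel \<Otimes>\<^sub>M \<mu>)"
    by measurable
  have shp: "(\<lambda>x. (fst x, sh (fst x) (snd x))) \<in> measurable (lborel \<Otimes>\<^sub>M \<mu>) (lborel \<Otimes>\<^sub>M \<mu>)"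
    by measurable
  have 1: "(\<lambda>x. kap (fst x) (sh (fst x) (snd x))) \<in> borel_measurable (lborel \<Otimes>\<^sub>M \<mu>)"
    using measurable_compose[OF shp kap_meas] by simp
  have 2: "(\<lambda>x. dens (sh (fst x) (snd x))) \<in> borel_measurable (lborel \<Otimes>\<^sub>M \<mu>)"
    by measurable
  show ?thesis
    using measurable_compose[OF hp 1] measurable_compose[OF hp 2] by simp
qed

lemma integrand_meas_z:
  "(\<lambda>p. dens (sh (h u p z) p) * kap (h u p z) (sh (h u p z) p) * ennreal (Jac u p z)) \<in> borel_measurable \<mu>"
  using measurable_compose[OF measurable_Pair1'[of z lborel \<mu>] integrand_meas[of u]] by simp

lemma inner_meas:
  "(\<lambda>z. \<integral>\<^sup>+p. dens (sh (h u p z) p) * kap (h u p z) (sh (h u p z) p) * ennreal (Jac u p z) \<partial>\<mu>) \<in> borel_measurable lborel"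
proof -
  interpret \<mu>: sigma_finite_measure \<mu> by (rule sf)
  show ?thesis
    by (rule \<mu>.borel_measurable_nn_integral) (use integrand_meas[of u] in \<open>simp add: case_prod_unfold\<close>)
qed

text \<open>After division by the coefficient function \<open>k1\<close> the level appears as
  \<open>u * w\<close>. The translation by \<open>- u * q\<close> removes it from the values,
  because \<open>q\<close> pairs with \<open>g\<close> to \<open>w\<close>, and from the Jacobian,
  because \<open>q\<close> pairs with the derivatives of \<open>g\<close> to those of
  \<open>w\<close>. The kernel sees only the coefficients of W, so the Gaussian density alone
  changes.\<close>

lemma inner_tilt:
  assumes z: "z \<in> D"
  shows "(\<integral>\<^sup>+p. dens (sh (h u p z) p) * kap (h u p z) (sh (h u p z) p) * ennreal (Jac u p z) \<partial>\<mu>) =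
    ennreal (exp (- (u\<^sup>2 / \<sigma>2) / 2)) *
      (\<integral>\<^sup>+p. dens (sh (h 0 p z) p) * kap (h 0 p z) (sh (h 0 p z) p) * ennreal (Jac 0 p z) \<partial>\<mu>)"
proof -
  let ?G = "\<lambda>u p. dens (sh (h u p z) p) * kap (h u p z) (sh (h u p z) p) * ennreal (Jac u p z)"
  define T where "T p = (\<lambda>i\<in>I. fst p i + 0, \<lambda>k\<in>K. snd p k + - (u * q k z))" for p :: "('i \<Rightarrow> real) \<times> ('k \<Rightarrow> real)"
  have "(\<integral>\<^sup>+p. ?G u p \<partial>\<mu>) = (\<integral>\<^sup>+p. ?G u (T p) \<partial>\<mu>)"
    unfolding T_def
    by (rule nn_integral_pair_shift[OF I K(1) integrand_meas_z, where v = "\<lambda>_. 0" and v' = "\<lambda>k. - (u * q k z)", symmetric])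
  also have "\<dots> = (\<integral>\<^sup>+p. ennreal (exp (- (u\<^sup>2 / \<sigma>2) / 2)) * ?G 0 p \<partial>\<mu>)"
  proof (rule nn_integral_cong)
    fix p :: "('i \<Rightarrow> real) \<times> ('k \<Rightarrow> real)"
    have sndT: "(\<Sum>k\<in>K. snd (T p) k * F k) = (\<Sum>k\<in>K. snd p k * F k) - u * (\<Sum>k\<in>K. q k z * F k)" for F
      by (simp add: T_def sum_distrib_left sum_subtractf[symmetric] algebra_simps)
    have fstT: "fst (T p) i = fst p i" if "i \<in> I" for i using that by (simp add: T_def)
    have hT: "h u (T p) z = h 0 p z"
      unfolding h_def using q(1)[OF z] by (simp add: sndT fstT vec_eq_iff)
    have dhT: "dh u (T p) z = dh 0 p z"
      unfolding dh_def using q(2)[OF z] z by (simp add: sndT fstT vec_eq_iff)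
    define \<tau> where "\<tau> = h 0 p z"
    have fst_sh: "fst (sh \<tau> (T p)) = fst (sh \<tau> p)"
      by (auto simp: sh_def fstT)
    have kapT: "kap \<tau> (sh \<tau> (T p)) = kap \<tau> (sh \<tau> p)"
      by (simp add: kap_def rad_def fst_sh)
    \<comment> \<open>The coefficients at which the density is evaluated belong to a Gaussian field
      vanishing at \<open>z\<close>; they are therefore orthogonal to \<open>q\<close>, as the
      tilting of the density requires.\<close>
    have "(\<Sum>k\<in>K. snd (sh \<tau> p) k * g k z) = (\<Sum>k\<in>K. snd p k * g k z) + \<tau> $ i1"
      using sum_shift_g[OF z, of "snd p" "\<tau> $ i1"] by (simp add: sh_def)
    also have "\<dots> = 0" using i01 by (simp add: \<tau>_def h_def)
    finally have orth: "(\<Sum>k\<in>K. snd (sh \<tau> p) k * q k z) = 0" by (rule q(4)[OF z])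
    have "gauss_density K (snd (sh \<tau> (T p))) = gauss_density K (\<lambda>k. snd (sh \<tau> p) k - u * q k z)"
      by (rule gauss_density_cong) (simp add: sh_def T_def)
    also have "\<dots> = gauss_density K (snd (sh \<tau> p)) * exp (- (u\<^sup>2 / \<sigma>2) / 2)"
      using gauss_density_tilt[OF K(1) orth, of u] q(3)[OF z] by simp
    finally have "dens (sh \<tau> (T p)) = ennreal (exp (- (u\<^sup>2 / \<sigma>2) / 2)) * dens (sh \<tau> p)"
      by (simp add: dens_def fst_sh ennreal_mult' gauss_density_nonneg mult_ac)
    then show "?G u (T p) = ennreal (exp (- (u\<^sup>2 / \<sigma>2) / 2)) * ?G 0 p"
      unfolding hT Jac_def dhT \<tau>_def[symmetric] kapT by (simp add: mult_ac)
  qed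
  also have "\<dots> = ennreal (exp (- (u\<^sup>2 / \<sigma>2) / 2)) * (\<integral>\<^sup>+p. ?G 0 p \<partial>\<mu>)"
    by (rule nn_integral_cmult[OF integrand_meas_z])
  finally show ?thesis .
qed

lemma level_ratio:
  "(\<integral>\<^sup>+p. N u p * dens p \<partial>\<mu>) = ennreal (exp (- (u\<^sup>2 / \<sigma>2) / 2)) * (\<integral>\<^sup>+p. N 0 p * dens p \<partial>\<mu>)"
proof -
  have [measurable]: "Q \<in> sets borel" by (rule fsigma_borel[OF Q(1)])
  note [measurable] = inner_meas
  let ?\<Phi> = "\<lambda>u z. \<integral>\<^sup>+p. dens (sh (h u p z) p) * kap (h u p z) (sh (h u p z) p) * ennreal (Jac u p z) \<partial>\<mu>"
  let ?e = "ennreal (exp (- (u\<^sup>2 / \<sigma>2) / 2))"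
  have "(\<integral>\<^sup>+p. N u p * dens p \<partial>\<mu>) = (\<integral>\<^sup>+z. ?e * (indicator Q z * ?\<Phi> 0 z) \<partial>lborel)"
    unfolding integral_formula
  proof (rule nn_integral_cong)
    fix z
    show "indicator Q z * ?\<Phi> u z = ?e * (indicator Q z * ?\<Phi> 0 z)"
      using inner_tilt[of z u] Q(2) by (cases "z \<in> Q") (auto simp: mult_ac)
  qed
  also have "\<dots> = ?e * (\<integral>\<^sup>+z. indicator Q z * ?\<Phi> 0 z \<partial>lborel)"
    by (rule nn_integral_cmult) measurable
  also have "\<dots> = ?e * (\<integral>\<^sup>+p. N 0 p * dens p \<partial>\<mu>)"
    unfolding integral_formula ..
  finally show ?thesis .
qed

text \<open>The padding row is bounded by 1, the Gaussian row is linear in the Gaussian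
  coefficients, and each of the other rows is linear in those of W.\<close>

lemma Jac_le:
  assumes z: "z \<in> D"
  shows "Jac 0 p z \<le> real (card {p :: 'n::{finite,wellorder} \<Rightarrow> 'n. p permutes UNIV}) *
    (B * wt K (snd p) * (B * wt I (fst p)) ^ card js)"
proof -
  have sum_le: "\<bar>\<Sum>i\<in>S. x i * d i\<bar> \<le> B * wt S x" if "\<And>i. i \<in> S \<Longrightarrow> \<bar>d i\<bar> \<le> B" for S :: "'z set" and x d
  proof -
    have "\<bar>\<Sum>i\<in>S. x i * d i\<bar> \<le> (\<Sum>i\<in>S. \<bar>x i\<bar> * B)"
      using that by (intro order.trans[OF sum_abs] sum_mono) (auto simp: abs_mult intro!: mult_left_mono)
    also have "\<dots> \<le> B * wt S x"
    proof -
      have "(\<Sum>i\<in>S. \<bar>x i\<bar> * B) = B * (\<Sum>i\<in>S. \<bar>x i\<bar>)"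
        by (simp add: sum_distrib_left mult.commute)
      then show ?thesis using bounds(1) by (simp add: wt_def distrib_left)
    qed
    finally show ?thesis .
  qed
  define r where "r j = (if j = i0 then 1 else if j = i1 then B * wt K (snd p) else B * wt I (fst p))" for j
  have "\<bar>dh 0 p z $ j $ l\<bar> \<le> r j" for j l
  proof -
    have "\<bar>\<Sum>k\<in>K. snd p k * partial l (g k) z\<bar> \<le> B * wt K (snd p)"
      "\<bar>\<Sum>i\<in>I. fst p i * partial l (V i j) z\<bar> \<le> B * wt I (fst p)"
      using bounds(2,3) z by (intro sum_le; simp)+
    then show ?thesis using z by (simp add: dh_def r_def)
  qed
  then have "Jac 0 p z \<le> real (card {p :: 'n::{finite,wellorder} \<Rightarrow> 'n. p permutes UNIV}) * (\<Prod>j\<in>UNIV. r j)"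
    unfolding Jac_def by (rule abs_det_le)
  also have "(\<Prod>j\<in>UNIV. r j) = B * wt K (snd p) * (B * wt I (fst p)) ^ card js"
    using i01 by (simp add: prod_split r_def)
  finally show ?thesis .
qed

text \<open>On the support of the kernel, shifted and unshifted weights are comparable. The
  normalisation of the kernel supplies the weight of W to the power \<open>- card js\<close>, which
  cancels the growth of the W rows of the Jacobian exactly. What is left is the full decay of the
  density of W and a Gaussian decay that has absorbed the Gaussian row.\<close>

lemma integrand_bound:
  obtains M where "0 \<le> M" "\<And>p z. p \<in> space \<mu> \<Longrightarrow> z \<in> D \<Longrightarrow>
    dens (sh (h 0 p z) p) * kap (h 0 p z) (sh (h 0 p z) p) * ennreal (Jac 0 p z) \<le>
    ennreal (M * (wt I (fst p) powr - \<beta> * wt K (snd p) powr - (real (card K) + 1)))"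
proof -
  \<comment> \<open>The Gaussian row of the Jacobian costs one power, so the exponent
    \<open>card K + 2\<close> leaves \<open>card K + 1\<close>, which is integrable.\<close>
  obtain C2 where C2: "\<And>x. gauss_density K x \<le> C2 * wt K x powr - (real (card K) + 2)" "0 \<le> C2"
    by (rule gauss_density_le_wt[OF K(1), of "real (card K) + 2"]) auto
  define m where "m = card js"
  define P where "P = real (card {p :: 'n::{finite,wellorder} \<Rightarrow> 'n. p permutes UNIV})"
  define n where "n = real (card K) + 2"
  \<comment> \<open>Both weights satisfy "unshifted at most 3 / 2 times shifted": for W by the
    choice of \<open>eps\<close>, for the Gaussian coefficients because one of them moves by at most
    1 / 2 and the shifted weight is at least 1.\<close>
  define t :: real where "t = 2 / 3"
  have t: "0 < t" by (simp add: t_def)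
  have \<beta>0: "0 \<le> \<beta>" using \<rho>(4) by linarith
  define M where "M = (C * t powr - \<beta>) * (C2 * t powr - n) * (1 / ((s1 - s0) * (2 * eps * t) ^ m)) * (P * B * B ^ m)"
  have M0: "0 \<le> M" unfolding M_def P_def using \<rho>(3) C2(2) s eps_pos bounds(1) t by simp
  have "dens (sh (h 0 p z) p) * kap (h 0 p z) (sh (h 0 p z) p) * ennreal (Jac 0 p z) \<le>
      ennreal (M * (wt I (fst p) powr - \<beta> * wt K (snd p) powr - (real (card K) + 1)))"
    if p: "p \<in> space \<mu>" and z: "z \<in> D" for p z
  proof (cases "kap (h 0 p z) (sh (h 0 p z) p) = 0")
    case False
    define \<tau> where "\<tau> = h 0 p z"
    define p' where "p' = sh \<tau> p"
    define a where "a = wt I (fst p)"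
    define a' where "a' = wt I (fst p')"
    define b where "b = wt K (snd p)"
    define b' where "b' = wt K (snd p')"
    note ab = wt_ge_1[of I "fst p", folded a_def] wt_ge_1[of I "fst p'", folded a'_def]
      wt_ge_1[of K "snd p", folded b_def] wt_ge_1[of K "snd p'", folded b'_def]
    have kap: "kap \<tau> p' \<noteq> 0" using False by (simp add: \<tau>_def p'_def)
    then have \<tau>1: "\<bar>\<tau> $ i1\<bar> \<le> 1 / 2" and \<tau>j: "\<And>j. j \<in> js \<Longrightarrow> \<bar>\<tau> $ j\<bar> \<le> eps * a'"
      and kap_eq: "kap \<tau> p' = ennreal (1 / ((s1 - s0) * (2 * (eps * a')) ^ m))"
      by (auto simp: kap_def rad_def a'_def m_def split: if_splits)
    have "a = wt I (\<lambda>i\<in>I. fst p' i + - (\<Sum>j\<in>js. \<tau> $ j * f j i))"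
      unfolding a_def p'_def by (rule wt_cong) (simp add: sh_def)
    also have "\<dots> \<le> a' + (\<Sum>i\<in>I. \<bar>\<Sum>j\<in>js. \<tau> $ j * f j i\<bar>)"
      using wt_add_le[of I "fst p'" "\<lambda>i. - (\<Sum>j\<in>js. \<tau> $ j * f j i)"] by (simp add: a'_def)
    also have "(\<Sum>i\<in>I. \<bar>\<Sum>j\<in>js. \<tau> $ j * f j i\<bar>) \<le> (\<Sum>i\<in>I. \<Sum>j\<in>js. eps * a' * \<bar>f j i\<bar>)"
      using \<tau>j by (intro sum_mono order.trans[OF sum_abs]) (auto simp: abs_mult intro!: mult_right_mono)
    also have "\<dots> = a' * (eps * (\<Sum>j\<in>js. \<Sum>i\<in>I. \<bar>f j i\<bar>))"
      by (subst sum.swap) (simp add: sum_distrib_left mult_ac)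
    also have "\<dots> \<le> a' * (1 / 2)"
      using ab eps_sum by (intro mult_left_mono) auto
    finally have a: "t * a \<le> a'" by (simp add: t_def)
    have "b = wt K (\<lambda>k\<in>K. snd p' k + - (if k = k1 then \<tau> $ i1 else 0))"
      unfolding b_def p'_def by (rule wt_cong) (simp add: sh_def)
    also have "\<dots> \<le> b' + (\<Sum>k\<in>K. \<bar>- (if k = k1 then \<tau> $ i1 else 0)\<bar>)"
      unfolding b'_def by (rule wt_add_le)
    also have "(\<Sum>k\<in>K. \<bar>- (if k = k1 then \<tau> $ i1 else 0)\<bar>) = (\<Sum>k\<in>K. if k = k1 then \<bar>\<tau> $ i1\<bar> else 0)"
      by (intro sum.cong) auto
    also have "\<dots> \<le> 1 / 2" using K \<tau>1 by simp
    finally have b: "t * b \<le> b'" using ab by (simp add: t_def)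
    have p'_sp: "p' \<in> space \<mu>" unfolding p'_def by (rule sh_space[OF p])
    have "dens p' \<le> ennreal (C * a' powr - \<beta>) * ennreal (C2 * b' powr - n)"
      unfolding dens_def a'_def b'_def n_def using p'_sp C2(1)
      by (intro mult_mono \<rho>(2) ennreal_leI) (auto simp: space_pair_measure)
    also have "\<dots> = ennreal ((C * a' powr - \<beta>) * (C2 * b' powr - n))"
      using \<rho>(3) C2(2) by (simp add: ennreal_mult)
    also have "\<dots> \<le> ennreal ((C * (t * a) powr - \<beta>) * (C2 * (t * b) powr - n))"
    proof (intro ennreal_leI mult_mono mult_left_mono powr_mono2')
      show "0 < t * a" "0 < t * b" using t ab by (auto intro!: mult_pos_pos)
    qed (use a b \<rho>(3) C2(2) \<beta>0 in \<open>auto simp: n_def\<close>)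
    also have "\<dots> = ennreal ((C * t powr - \<beta>) * (C2 * t powr - n) * (a powr - \<beta> * b powr - n))"
      using t ab by (simp add: powr_mult mult_ac)
    finally have dens_le: "dens p' \<le> \<dots>" .
    have "kap \<tau> p' \<le> ennreal (1 / ((s1 - s0) * (2 * (eps * (t * a))) ^ m))"
      unfolding kap_eq using s eps_pos t a ab
      by (intro ennreal_leI divide_left_mono mult_left_mono power_mono mult_pos_pos zero_less_power)
        (auto intro!: mult_pos_pos)
    also have "\<dots> = ennreal (1 / ((s1 - s0) * (2 * eps * t) ^ m) * (1 / a ^ m))"
      by (simp add: power_mult_distrib mult_ac)
    finally have kap_le: "kap \<tau> p' \<le> \<dots>" .
    have "ennreal (Jac 0 p z) \<le> ennreal (P * B * B ^ m * (b * a ^ m))"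
      using Jac_le[OF z, of p] by (intro ennreal_leI) (simp add: P_def a_def b_def m_def power_mult_distrib mult_ac)
    then have "dens p' * kap \<tau> p' * ennreal (Jac 0 p z) \<le>
        ennreal ((C * t powr - \<beta>) * (C2 * t powr - n) * (a powr - \<beta> * b powr - n)) *
        ennreal (1 / ((s1 - s0) * (2 * eps * t) ^ m) * (1 / a ^ m)) * ennreal (P * B * B ^ m * (b * a ^ m))"
      using dens_le kap_le by (intro mult_mono) auto
    also have "\<dots> = ennreal ((C * t powr - \<beta>) * (C2 * t powr - n) * (a powr - \<beta> * b powr - n) *
        (1 / ((s1 - s0) * (2 * eps * t) ^ m) * (1 / a ^ m)) * (P * B * B ^ m * (b * a ^ m)))"
      using \<rho>(3) C2(2) s eps_pos t ab bounds(1)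
      by (subst ennreal_mult[symmetric] | simp add: P_def)+
    also have "(C * t powr - \<beta>) * (C2 * t powr - n) * (a powr - \<beta> * b powr - n) *
        (1 / ((s1 - s0) * (2 * eps * t) ^ m) * (1 / a ^ m)) * (P * B * B ^ m * (b * a ^ m)) =
        M * (a powr - \<beta> * (b powr - n * b))"
    proof -
      have "1 / a ^ m * a ^ m = 1" using ab by simp
      then have "X * (Y * (1 / a ^ m)) * (Z * (b * a ^ m)) = X * Y * Z * b" for X Y Z
        by (metis (no_types, opaque_lifting) mult.assoc mult.commute mult.right_neutral)
      then show ?thesis by (simp only: M_def) (simp only: mult_ac)
    qed
    also have "b powr - n * b = b powr - (real (card K) + 1)"
    proof -
      have "b powr - n * b = b powr - n * b powr 1" using ab by simp
      also have "\<dots> = b powr (- n + 1)" by (rule powr_add[symmetric])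
      also have "- n + 1 = - (real (card K) + 1)" by (simp add: n_def)
      finally show ?thesis .
    qed
    finally show ?thesis by (simp add: \<tau>_def p'_def a_def b_def)
  qed simp
  with M0 show thesis by (rule that)
qed

text \<open>The bound on the integrand is integrable in the coefficients and uniform in
  \<open>z\<close>, and the bounded set \<open>D\<close> has finite volume.\<close>

lemma level_finite: "(\<integral>\<^sup>+p. N 0 p * dens p \<partial>\<mu>) < \<infinity>"
proof -
  obtain M where M: "0 \<le> M" "\<And>p z. p \<in> space \<mu> \<Longrightarrow> z \<in> D \<Longrightarrow>
    dens (sh (h 0 p z) p) * kap (h 0 p z) (sh (h 0 p z) p) * ennreal (Jac 0 p z) \<le>
    ennreal (M * (wt I (fst p) powr - \<beta> * wt K (snd p) powr - (real (card K) + 1)))"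
    by (rule integrand_bound) auto
  let ?w = "\<lambda>p. ennreal (wt I (fst p) powr - \<beta>) * ennreal (wt K (snd p) powr - (real (card K) + 1))"
  interpret K: sigma_finite_measure "lborel_PiM K" by (rule sigma_finite_lborel_PiM[OF K(1)])
  have "(\<integral>\<^sup>+p. ?w p \<partial>\<mu>) =
      (\<integral>\<^sup>+c. \<integral>\<^sup>+x. ennreal (wt I c powr - \<beta>) * ennreal (wt K x powr - (real (card K) + 1)) \<partial>lborel_PiM K \<partial>lborel_PiM I)"
    by (subst K.nn_integral_fst[symmetric]) auto
  also have "\<dots> = (\<integral>\<^sup>+c. ennreal (wt I c powr - \<beta>) \<partial>lborel_PiM I) *
      (\<integral>\<^sup>+x. ennreal (wt K x powr - (real (card K) + 1)) \<partial>lborel_PiM K)"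
    by (simp add: nn_integral_cmult nn_integral_multc)
  also have "\<dots> < \<infinity>"
    using nn_integral_wt_finite[OF I \<rho>(4)] nn_integral_wt_finite[OF K(1), of "real (card K) + 1"]
    by (simp add: ennreal_mult_less_top)
  finally have fin: "(\<integral>\<^sup>+p. ?w p \<partial>\<mu>) < \<infinity>" .
  have [measurable]: "Q \<in> sets borel" by (rule fsigma_borel[OF Q(1)])
  have "(\<integral>\<^sup>+p. N 0 p * dens p \<partial>\<mu>) \<le> (\<integral>\<^sup>+z. indicator Q z * (ennreal M * (\<integral>\<^sup>+p. ?w p \<partial>\<mu>)) \<partial>lborel)"
    unfolding integral_formula
  proof (rule nn_integral_mono)
    fix z :: "real^'n::{finite,wellorder}"
    have "(\<integral>\<^sup>+p. dens (sh (h 0 p z) p) * kap (h 0 p z) (sh (h 0 p z) p) * ennreal (Jac 0 p z) \<partial>\<mu>) \<le>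
        ennreal M * (\<integral>\<^sup>+p. ?w p \<partial>\<mu>)" if "z \<in> D"
    proof -
      have "(\<integral>\<^sup>+p. dens (sh (h 0 p z) p) * kap (h 0 p z) (sh (h 0 p z) p) * ennreal (Jac 0 p z) \<partial>\<mu>) \<le>
          (\<integral>\<^sup>+p. ennreal M * ?w p \<partial>\<mu>)"
        using M(2)[OF _ that] M(1) by (intro nn_integral_mono) (simp add: ennreal_mult)
      then show ?thesis by (simp add: nn_integral_cmult)
    qed
    then show "indicator Q z * (\<integral>\<^sup>+p. dens (sh (h 0 p z) p) * kap (h 0 p z) (sh (h 0 p z) p) * ennreal (Jac 0 p z) \<partial>\<mu>) \<le>
        indicator Q z * (ennreal M * (\<integral>\<^sup>+p. ?w p \<partial>\<mu>))"
      using Q(2) by (auto simp: indicator_def)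
  qed
  also have "\<dots> = emeasure lborel Q * (ennreal M * (\<integral>\<^sup>+p. ?w p \<partial>\<mu>))"
    by (subst nn_integral_multc) auto
  also have "\<dots> < \<infinity>"
  proof -
    have "emeasure lborel Q < \<infinity>"
      using bounded_subset[OF D(2) Q(2)] by (rule emeasure_bounded_finite)
    then show ?thesis using fin by (simp add: ennreal_mult_less_top)
  qed
  finally show ?thesis .
qed

end

section \<open>Charts of level sets\<close>

text \<open>A point of the level set is described by all its coordinates except \<open>i0\<close>,
  which the level equation determines; the vacant slot is filled by the free parameter
  \<open>s\<close>, and \<open>\<pi>\<close> relabels the indices.\<close>

definition slice :: "('m \<Rightarrow> 'n::finite) \<Rightarrow> 'm \<Rightarrow> real \<Rightarrow> real^'m \<Rightarrow> real^'n" where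
  "slice \<pi> i0 s x = (\<chi> l. if l = \<pi> i0 then s else x $ inv \<pi> l)"

text \<open>Implicit function theorem by straightening: replacing coordinate \<open>i0\<close> by
  the value of \<Theta> is a local diffeomorphism, and its inverse is evaluated on vectors whose
  entry \<open>i0\<close> is the constant \<open>c\<close>. The resulting \<open>X\<close> has as
  many variables as the ambient space but does not depend on the one with index
  \<open>\<pi> i0\<close>.\<close>

lemma level_set_chart:
  fixes \<Theta> :: "real^'m \<Rightarrow> real" and \<pi> :: "'m \<Rightarrow> 'n::finite"
  assumes \<pi>: "bij \<pi>" and \<Theta>: "C1_on UNIV \<Theta>" and x0: "partial i0 \<Theta> x0 \<noteq> 0" "\<Theta> x0 = c"
  obtains W X T where "open W" "open T" "x0 \<in> T"
    "\<And>j. C1_on W (\<lambda>z :: real^'n. X z $ j)"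
    "\<And>z. z \<in> W \<Longrightarrow> X z \<in> T \<and> \<Theta> (X z) = c"
    "\<And>z l. z \<in> W \<Longrightarrow> l \<noteq> i0 \<Longrightarrow> X z $ l = z $ \<pi> l"
    "\<And>x s. x \<in> T \<Longrightarrow> \<Theta> x = c \<Longrightarrow> slice \<pi> i0 s x \<in> W \<and> X (slice \<pi> i0 s x) = x"
proof -
  let ?d = "\<lambda>x. frechet_derivative \<Theta> (at x)"
  define \<Psi> where "\<Psi> x = (\<chi> l. if l = i0 then \<Theta> x else x $ l)" for x
  define \<Psi>' where "\<Psi>' x v = (\<chi> l. if l = i0 then ?d x v else v $ l)" for x v
  have der\<Theta>: "(\<Theta> has_derivative ?d x) (at x)" for x
    by (rule C1_on_has_derivative[OF \<Theta>]) simp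
  have lin: "linear (?d x)" for x by (rule has_derivative_linear[OF der\<Theta>])
  have d_expand: "?d x v = (\<Sum>l\<in>UNIV. v $ l * partial l \<Theta> x)" for x v
  proof -
    have "v = (\<Sum>l\<in>UNIV. v $ l *\<^sub>R axis l 1)"
      using basis_expansion[of v] by (simp add: scalar_mult_eq_scaleR)
    then have "?d x v = ?d x (\<Sum>l\<in>UNIV. v $ l *\<^sub>R axis l 1)" by simp
    also have "\<dots> = (\<Sum>l\<in>UNIV. v $ l * partial l \<Theta> x)"
      unfolding partial_def by (simp only: linear_sum[OF lin] linear_scale[OF lin] real_scaleR_def)
    finally show ?thesis .
  qed
  define U where "U = {x. partial i0 \<Theta> x \<noteq> 0}"
  have contp: "continuous_on UNIV (partial l \<Theta>)" for l by (rule continuous_on_partial[OF \<Theta>])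
  have "open (partial i0 \<Theta> -` (- {0}))"
    by (rule open_vimage[OF _ contp]) auto
  then have U: "open U" by (simp add: U_def vimage_def)
  have der: "(\<Psi> has_derivative \<Psi>' x) (at x)" for x
    unfolding has_derivative_componentwise_within[of \<Psi> _ x UNIV]
  proof
    fix b :: "real^'m" assume "b \<in> Basis"
    then obtain l where b: "b = axis l 1" by (auto simp: Basis_vec_def)
    show "((\<lambda>x. \<Psi> x \<bullet> b) has_derivative (\<lambda>v. \<Psi>' x v \<bullet> b)) (at x)"
      using der\<Theta>[of x]
      by (cases "l = i0") (auto simp: b inner_axis \<Psi>_def \<Psi>'_def intro!: bounded_linear_imp_has_derivative bounded_linear_vec_nth)
  qed
  have contd: "continuous_on U (\<lambda>x. \<Psi>' x v)" for v
  proof -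
    have "continuous_on U (\<lambda>x. if l = i0 then ?d x v else v $ l)" for l
      using continuous_on_subset[OF C1_on_continuous_derivative[OF \<Theta>], of U v] by (cases "l = i0") auto
    then show ?thesis unfolding \<Psi>'_def by (intro continuous_on_vec_lambda)
  qed
  have split_sum: "(\<Sum>l\<in>UNIV. F l) = F i0 + (\<Sum>l\<in>UNIV - {i0}. F l)" for F :: "'m \<Rightarrow> real"
    by (rule sum.remove) auto
  \<comment> \<open>The derivative of \<open>\<Psi>\<close> copies all components except
    \<open>i0\<close>, so only that one has to be solved for. This gives injectivity at
    \<open>x0\<close> and, further below, an explicit derivative of component \<open>i0\<close> of
    the inverse, whose continuity can be read off.\<close>
  have solve: "v $ i0 = (\<Psi>' x v $ i0 - (\<Sum>l\<in>UNIV - {i0}. \<Psi>' x v $ l * partial l \<Theta> x)) / partial i0 \<Theta> x"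
    if "x \<in> U" for x v
  proof -
    have "\<Psi>' x v $ i0 = v $ i0 * partial i0 \<Theta> x + (\<Sum>l\<in>UNIV - {i0}. v $ l * partial l \<Theta> x)"
      by (simp add: \<Psi>'_def d_expand split_sum)
    moreover have "(\<Sum>l\<in>UNIV - {i0}. \<Psi>' x v $ l * partial l \<Theta> x) = (\<Sum>l\<in>UNIV - {i0}. v $ l * partial l \<Theta> x)"
      by (intro sum.cong) (auto simp: \<Psi>'_def)
    ultimately show ?thesis using that by (simp add: U_def)
  qed
  have x0U: "x0 \<in> U" using x0 by (simp add: U_def)
  have inj: "inj (\<Psi>' x0)"
  proof (rule injI)
    fix v v' assume eq: "\<Psi>' x0 v = \<Psi>' x0 v'"
    have "v $ l = v' $ l" for l
    proof (cases "l = i0")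
      case True
      then show ?thesis using solve[OF x0U, of v] solve[OF x0U, of v'] eq by simp
    next
      case False
      have "\<Psi>' x0 v $ l = \<Psi>' x0 v' $ l" using eq by simp
      with False show ?thesis by (simp add: \<Psi>'_def)
    qed
    then show "v = v'" by (simp add: vec_eq_iff)
  qed
  obtain T V g where TV: "open T" "T \<subseteq> U" "x0 \<in> T" "open V" and hom: "homeomorphism T V \<Psi> g"
    and dg: "\<And>y. y \<in> V \<Longrightarrow> (g has_derivative inv (\<Psi>' (g y))) (at y)"
    and bij: "\<And>y. y \<in> V \<Longrightarrow> bij (\<Psi>' (g y))"
    by (rule inverse_function_theorem_C1[OF U der contd x0U inj]) (rule that)
  have gT: "g y \<in> T" "\<Psi> (g y) = y" if "y \<in> V" for y
    using hom that by (auto simp: homeomorphism_def)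
  have \<Psi>V: "\<Psi> x \<in> V" "g (\<Psi> x) = x" if "x \<in> T" for x
    using hom that by (auto simp: homeomorphism_def)
  have g_i0: "C1_on V (\<lambda>y. g y $ i0)"
  proof (rule C1_onI)
    let ?e = "\<lambda>y v. (v $ i0 - (\<Sum>l\<in>UNIV - {i0}. v $ l * partial l \<Theta> (g y))) / partial i0 \<Theta> (g y)"
    fix y assume y: "y \<in> V"
    have "inv (\<Psi>' (g y)) v $ i0 = ?e y v" for v
      using solve[of "g y" "inv (\<Psi>' (g y)) v"] gT[OF y] TV(2) bij_is_surj[OF bij[OF y]]
      by (auto simp: surj_f_inv_f)
    moreover have "((\<lambda>y. g y $ i0) has_derivative (\<lambda>v. inv (\<Psi>' (g y)) v $ i0)) (at y)"
      by (rule bounded_linear.has_derivative[OF bounded_linear_vec_nth dg[OF y]])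
    ultimately show "((\<lambda>y. g y $ i0) has_derivative ?e y) (at y)" by simp
  next
    fix v :: "real^'m"
    have contg: "continuous_on V g" using hom by (auto simp: homeomorphism_def)
    have "continuous_on V (\<lambda>y. partial l \<Theta> (g y))" for l
      by (rule continuous_on_compose2[OF contp contg]) simp
    then show "continuous_on V (\<lambda>y. (v $ i0 - (\<Sum>l\<in>UNIV - {i0}. v $ l * partial l \<Theta> (g y))) / partial i0 \<Theta> (g y))"
      using gT TV(2) by (intro continuous_intros) (auto simp: U_def)
  qed
  \<comment> \<open>Entry \<open>i0\<close> is set to the level \<open>c\<close>, so coordinate
    \<open>\<pi> i0\<close> of \<open>z\<close> is forgotten; this makes it the padding
    coordinate.\<close>
  define Y where "Y z = (\<chi> l. if l = i0 then c else z $ \<pi> l)" for z :: "real^'n"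
  have Yc: "C1_on W (\<lambda>z. Y z \<bullet> b)" if Basis: "b \<in> Basis" for W b
  proof -
    obtain l where b: "b = axis l 1" using Basis by (auto simp: Basis_vec_def)
    show ?thesis
      by (cases "l = i0") (auto simp: b inner_axis Y_def C1_on_const intro!: C1_on_linear bounded_linear_vec_nth)
  qed
  have contY: "continuous_on UNIV Y"
  proof -
    have "continuous_on UNIV (\<lambda>z :: real^'n. if l = i0 then c else z $ \<pi> l)" for l
      by (cases "l = i0") (auto intro!: continuous_intros)
    then show ?thesis unfolding Y_def by (intro continuous_on_vec_lambda)
  qed
  define W where "W = Y -` V"
  have W: "open W" unfolding W_def by (rule open_vimage[OF TV(4) contY])
  define X where "X z = g (Y z)" for z
  have X: "X z \<in> T \<and> \<Theta> (X z) = c" "l \<noteq> i0 \<Longrightarrow> X z $ l = z $ \<pi> l" if "z \<in> W" for z l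
  proof -
    have "Y z \<in> V" using that by (simp add: W_def)
    note * = gT[OF this]
    have "\<Psi> (X z) $ i0 = Y z $ i0" "\<Psi> (X z) $ l = Y z $ l" using *(2) by (simp_all add: X_def)
    moreover have "X z \<in> T" using *(1) by (simp add: X_def)
    ultimately show "X z \<in> T \<and> \<Theta> (X z) = c" "l \<noteq> i0 \<Longrightarrow> X z $ l = z $ \<pi> l"
      by (simp_all add: \<Psi>_def Y_def)
  qed
  have "C1_on W (\<lambda>z. X z $ j)" for j
  proof (cases "j = i0")
    case True
    show ?thesis unfolding True X_def
      by (rule C1_on_compose[OF g_i0 Yc]) (auto simp: W_def)
  next
    case False
    have "C1_on W (\<lambda>z. z $ \<pi> j)" by (intro C1_on_linear bounded_linear_vec_nth)
    then show ?thesis using W X(2)[OF _ False] by (rule C1_on_cong)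
  qed
  moreover have "slice \<pi> i0 s x \<in> W \<and> X (slice \<pi> i0 s x) = x" if "x \<in> T" "\<Theta> x = c" for x s
  proof -
    have "Y (slice \<pi> i0 s x) = \<Psi> x"
      using \<pi> that(2) by (auto simp: Y_def slice_def \<Psi>_def vec_eq_iff bij_is_inj inv_f_f inj_eq)
    then show ?thesis using \<Psi>V[OF that(1)] by (simp add: W_def X_def)
  qed
  ultimately show thesis
    using that[OF W TV(1,3)] X by blast
qed

lemma fsigma_continuous_preimage:
  fixes X :: "'a::euclidean_space \<Rightarrow> 'b::euclidean_space"
  assumes "open D" "continuous_on D X" "fsigma Q"
  shows "fsigma {z \<in> D. X z \<in> Q}"
proof -
  obtain C :: "nat \<Rightarrow> 'a set" where C: "\<And>n. compact (C n)" "D = (\<Union>n. C n)"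
    using fsigma_compact_cover[OF fsigma_open[OF assms(1)]] by auto
  obtain L :: "nat \<Rightarrow> 'b set" where L: "\<And>n. compact (L n)" "Q = (\<Union>n. L n)"
    using fsigma_compact_cover[OF assms(3)] by auto
  let ?F = "\<lambda>n. C (fst (prod_decode n)) \<inter> X -` L (snd (prod_decode n))"
  have "closed (C m \<inter> X -` L n)" for m n
    using C L assms(2) by (intro continuous_closed_preimage compact_imp_closed) (auto intro: continuous_on_subset)
  then have "fsigma (\<Union>n. ?F n)" by (intro fsigma.intros)
  moreover have "(\<Union>n. ?F n) = {z \<in> D. X z \<in> Q}"
  proof
    show "{z \<in> D. X z \<in> Q} \<subseteq> (\<Union>n. ?F n)"
    proof
      fix z assume "z \<in> {z \<in> D. X z \<in> Q}"
      then obtain m n where "z \<in> C m" "X z \<in> L n" using C(2) L(2) by auto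
      then have "z \<in> ?F (prod_encode (m, n))" by simp
      then show "z \<in> (\<Union>n. ?F n)" by blast
    qed
  qed (auto simp: C(2) L(2))
  ultimately show ?thesis by simp
qed

lemma ecount_image: "inj_on f Z \<Longrightarrow> ecount (f ` Z) = ecount Z"
  by (cases "finite Z") (simp_all add: ecount_def card_image finite_image_iff)

section \<open>Fields on a compact level set\<close>

text \<open>\<open>G\<close> are the coefficient functions of the Gaussian field, whose variance \<open>\<sigma>2\<close> is constant on \<open>S\<close>, and
  \<open>b\<close> those of the field \<open>W\<close>, whose components are indexed by \<open>J\<close>.\<close>

locale level_fields =
  fixes S :: "(real^'m) set" and K :: "'k set" and I :: "'i set" and J :: "nat set"
    and G :: "'k \<Rightarrow> real^'m \<Rightarrow> real" and b :: "'i \<Rightarrow> real^'m \<Rightarrow> nat \<Rightarrow> real"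
    and k1 :: 'k and \<sigma>2 \<beta> C :: real and \<rho> :: "('i \<Rightarrow> real) \<Rightarrow> ennreal"
  assumes S: "compact S" and m: "2 \<le> CARD('m)" and I: "finite I" and K: "finite K" "k1 \<in> K"
    and J: "finite J" "card J = CARD('m) - 2"
    and G: "\<And>k. k \<in> K \<Longrightarrow> C1_on UNIV (G k)" "\<And>x. G k1 x \<noteq> 0"
    and \<sigma>2: "0 < \<sigma>2" "\<And>x. x \<in> S \<Longrightarrow> (\<Sum>k\<in>K. (G k x)\<^sup>2) = \<sigma>2"
    and grad: "\<And>x. x \<in> S \<Longrightarrow> \<exists>l. partial l (\<lambda>x. \<Sum>k\<in>K. (G k x)\<^sup>2) x \<noteq> 0"
    and b: "\<And>i j x. i \<in> I \<Longrightarrow> j \<in> J \<Longrightarrow> x \<in> S \<Longrightarrow>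
        \<exists>T F. open T \<and> x \<in> T \<and> C1_on T F \<and> (\<forall>y\<in>S \<inter> T. F y = b i y j)"
    and surj: "\<And>x v. x \<in> S \<Longrightarrow> \<exists>c. \<forall>j\<in>J. (\<Sum>i\<in>I. c i * b i x j) = v j"
    and \<rho>: "\<rho> \<in> borel_measurable (lborel_PiM I)"
      "\<And>c. c \<in> space (lborel_PiM I) \<Longrightarrow> \<rho> c \<le> ennreal (C * wt I c powr - \<beta>)"
      "0 \<le> C" "real (card I) < \<beta>"
begin

definition "zeros Q u p = {x \<in> Q. (\<Sum>k\<in>K. snd p k * G k x) + u = 0 \<and> (\<forall>j\<in>J. (\<Sum>i\<in>I. fst p i * b i x j) = 0)}"

definition "wgt p = \<rho> (fst p) * ennreal (gauss_density K (snd p))"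

definition "mean_zeros Q u = (\<integral>\<^sup>+p. ecount (zeros Q u p) * wgt p \<partial>(lborel_PiM I \<Otimes>\<^sub>M lborel_PiM K))"

lemma cont_b: "i \<in> I \<Longrightarrow> j \<in> J \<Longrightarrow> continuous_on S (\<lambda>x. b i x j)"
  by (rule continuous_on_local_C1) (rule b)

lemma cont_G: "k \<in> K \<Longrightarrow> continuous_on Q (G k)"
  using C1_on_continuous[OF G(1)] continuous_on_subset by blast

lemma zeros_measurable:
  assumes Q: "fsigma Q" "Q \<subseteq> S"
    and u: "u \<in> borel_measurable M"
    and c: "\<And>i. i \<in> I \<Longrightarrow> (\<lambda>\<omega>. c \<omega> i) \<in> borel_measurable M"
    and x: "\<And>k. k \<in> K \<Longrightarrow> (\<lambda>\<omega>. x \<omega> k) \<in> borel_measurable M"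
  shows "(\<lambda>\<omega>. ecount (zeros Q (u \<omega>) (c \<omega>, x \<omega>))) \<in> borel_measurable M"
proof -
  \<comment> \<open>The equations are merged into one nonnegative function, to which the
    measurability of zero counts of scalar functions applies.\<close>
  define r where "r \<omega> y = \<bar>(\<Sum>k\<in>K. x \<omega> k * G k y) + u \<omega>\<bar> + (\<Sum>j\<in>J. \<bar>\<Sum>i\<in>I. c \<omega> i * b i y j\<bar>)" for \<omega> y
  have "zeros Q (u \<omega>) (c \<omega>, x \<omega>) = {y \<in> Q. r \<omega> y = 0}" for \<omega>
    unfolding zeros_def r_def using J(1)
    by (auto simp: add_nonneg_eq_0_iff sum_nonneg sum_nonneg_eq_0_iff)
  moreover have "(\<lambda>\<omega>. ecount {y \<in> Q. r \<omega> y = 0}) \<in> borel_measurable M"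
  proof (rule borel_measurable_ecount_zeros[OF Q(1)])
    show "continuous_on Q (r \<omega>)" for \<omega>
      unfolding r_def using Q(2) by (intro continuous_intros cont_G continuous_on_subset[OF cont_b]) auto
    show "(\<lambda>\<omega>. r \<omega> y) \<in> borel_measurable M" for y
      unfolding r_def
      by (intro borel_measurable_add borel_measurable_abs borel_measurable_sum borel_measurable_times
        borel_measurable_const u c x)
  qed
  ultimately show ?thesis by simp
qed

lemma zeros_meas:
  assumes "fsigma Q" "Q \<subseteq> S"
  shows "(\<lambda>p. ecount (zeros Q u p)) \<in> borel_measurable (lborel_PiM I \<Otimes>\<^sub>M lborel_PiM K)"
  using zeros_measurable[OF assms, of "\<lambda>_. u" "lborel_PiM I \<Otimes>\<^sub>M lborel_PiM K" fst snd] by simp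

lemma wgt_meas [measurable]: "wgt \<in> borel_measurable (lborel_PiM I \<Otimes>\<^sub>M lborel_PiM K)"
  unfolding wgt_def using \<rho>(1) by measurable

text \<open>Near each point the fields are pulled back by a padded chart and normalised by linear
  operations that do not change the common zeros, until they satisfy the hypotheses of
  \<open>chart_fields\<close>.\<close>

lemma local_ratio:
  fixes \<pi> :: "'m \<Rightarrow> 'n::{finite,wellorder}"
  assumes \<pi>: "bij \<pi>" and x0: "x0 \<in> S"
  obtains T where "open T" "x0 \<in> T"
    "\<And>Q. fsigma Q \<Longrightarrow> Q \<subseteq> S \<inter> T \<Longrightarrow>
      (\<forall>u. mean_zeros Q u = ennreal (exp (- (u\<^sup>2 / \<sigma>2) / 2)) * mean_zeros Q 0) \<and> mean_zeros Q 0 < \<infinity>"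
proof -
  define \<Theta> where "\<Theta> x = (\<Sum>k\<in>K. (G k x)\<^sup>2)" for x
  have \<Theta>: "C1_on UNIV \<Theta>"
    unfolding \<Theta>_def power2_eq_square by (intro C1_on_sum C1_on_mult G)
  obtain m0 where m0: "partial m0 \<Theta> x0 \<noteq> 0"
    using grad[OF x0] unfolding \<Theta>_def[abs_def] by blast
  have \<Theta>S: "\<Theta> x = \<sigma>2" if "x \<in> S" for x using \<sigma>2(2)[OF that] by (simp add: \<Theta>_def)
  obtain W X T where W: "open W" and T: "open T" "x0 \<in> T" and X: "\<And>j. C1_on W (\<lambda>z :: real^'n::{finite,wellorder}. X z $ j)"
    and XT: "\<And>z. z \<in> W \<Longrightarrow> X z \<in> T \<and> \<Theta> (X z) = \<sigma>2"
    and Xl: "\<And>z l. z \<in> W \<Longrightarrow> l \<noteq> m0 \<Longrightarrow> X z $ l = z $ \<pi> l"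
    and slice: "\<And>x s. x \<in> T \<Longrightarrow> \<Theta> x = \<sigma>2 \<Longrightarrow> slice \<pi> m0 s x \<in> W \<and> X (slice \<pi> m0 s x) = x"
    by (rule level_set_chart[OF \<pi> \<Theta> m0 \<Theta>S[OF x0]]) (rule that)
  \<comment> \<open>The value \<sigma>2 of the padding coordinate is arbitrary; it only has to be
    the centre of the interval from \<open>s0\<close> to \<open>s1\<close> below.\<close>
  define z0 where "z0 = slice \<pi> m0 \<sigma>2 x0"
  have z0: "z0 \<in> W" "X z0 = x0" using slice[OF T(2) \<Theta>S[OF x0]] by (auto simp: z0_def)
  define i0 where "i0 = \<pi> m0"
  have cardn: "CARD('n) = CARD('m)" using bij_betw_same_card[OF \<pi>] by simp
  obtain i1 where i01: "i0 \<noteq> i1"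
  proof -
    have "\<exists>i1. i1 \<noteq> i0"
    proof (rule ccontr)
      assume "\<nexists>i1. i1 \<noteq> i0"
      then have "(UNIV :: 'n::{finite,wellorder} set) = {i0}" by auto
      then have "CARD('n) = 1" by (metis card_1_singleton_iff One_nat_def)
      then show False using m cardn by simp
    qed
    then show thesis using that by metis
  qed
  let ?js = "UNIV - {i0, i1}"
  \<comment> \<open>Index \<open>i0\<close> is the padding and \<open>i1\<close> the Gaussian
    equation; the remaining m - 2 indices are matched with the components of W.\<close>
  have "card ?js = card J" using i01 J(2) cardn by (simp add: card_Diff_subset)
  then obtain e where e: "bij_betw e ?js J"
    using finite_same_card_bij[of ?js J] J(1) by auto
  have eJ: "e j \<in> J" if "j \<in> ?js" for j using e that by (auto simp: bij_betw_def)
  have e_eq: "e j = e j' \<longleftrightarrow> j = j'" if "j \<in> ?js" "j' \<in> ?js" for j j'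
    using e that by (auto simp: bij_betw_def inj_on_eq_iff)
  \<comment> \<open>The coefficient functions of W are given on \<open>S\<close> only; derivatives
    in the chart need extensions to open sets.\<close>
  have "\<exists>T F. \<forall>i\<in>I. \<forall>j\<in>J. open (T i j) \<and> x0 \<in> T i j \<and> C1_on (T i j) (F i j) \<and> (\<forall>y\<in>S \<inter> T i j. F i j y = b i y j)"
    using b[OF _ _ x0] by metis
  then obtain Tb F where Tb: "\<And>i j. i \<in> I \<Longrightarrow> j \<in> J \<Longrightarrow> open (Tb i j) \<and> x0 \<in> Tb i j"
    and F: "\<And>i j. i \<in> I \<Longrightarrow> j \<in> J \<Longrightarrow> C1_on (Tb i j) (F i j)"
    and Fb: "\<And>i j y. i \<in> I \<Longrightarrow> j \<in> J \<Longrightarrow> y \<in> S \<Longrightarrow> y \<in> Tb i j \<Longrightarrow> F i j y = b i y j"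
    by (metis IntI)
  define T1 where "T1 = (\<Inter>i\<in>I. \<Inter>j\<in>J. Tb i j)"
  have T1: "open T1" "x0 \<in> T1" unfolding T1_def using I J(1) Tb by (auto intro!: open_INT)
  have T1b: "T1 \<subseteq> Tb i j" if "i \<in> I" "j \<in> J" for i j using that by (auto simp: T1_def)
  have contX: "continuous_on W X"
    using continuous_on_vec_lambda[of W "\<lambda>j z. X z $ j", OF C1_on_continuous[OF X]] by simp
  define W1 where "W1 = W \<inter> X -` T1"
  have W1: "open W1" "z0 \<in> W1" "W1 \<subseteq> W"
    unfolding W1_def using z0 T1 by (auto intro!: continuous_open_preimage[OF contX W])
  have XW1: "C1_on W1 (\<lambda>z. X z \<bullet> v)" if Basis: "v \<in> Basis" for v
  proof -
    obtain l where "v = axis l 1" using Basis by (auto simp: Basis_vec_def)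
    then show ?thesis using C1_on_subset[OF X W1(3), of l] by (simp add: inner_axis)
  qed
  have FX: "C1_on W1 (\<lambda>z. F i j (X z))" if "i \<in> I" "j \<in> J" for i j
    using T1b[OF that] by (intro C1_on_compose[OF F[OF that] XW1]) (auto simp: W1_def)
  have GX: "C1_on W1 (\<lambda>z. G k (X z))" if "k \<in> K" for k
    by (intro C1_on_compose[OF G(1)[OF that] XW1]) auto
  \<comment> \<open>Surjectivity of the evaluation at \<open>x0\<close> gives coefficient vectors
    dual to the components of W, but only at this point.\<close>
  obtain f' where f': "\<And>j j'. j' \<in> J \<Longrightarrow> (\<Sum>i\<in>I. f' j i * b i x0 j') = (if j = j' then 1 else 0)"
    using surj[OF x0, of "\<lambda>j'. if _ = j' then 1 else 0"] by metis
  define f where "f j = f' (e j)" for j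
  \<comment> \<open>The matrix of the perturbations at the point \<open>X z\<close>, completed by
    the identity at \<open>i0\<close> and \<open>i1\<close>. It is the identity at
    \<open>z0\<close>, hence invertible nearby; multiplying W by its inverse makes the duality exact
    on a neighbourhood with constant directions \<open>f\<close>.\<close>
  define M :: "real^'n::{finite,wellorder} \<Rightarrow> real^'n::_^'n::_" where "M z = (\<chi> j' j. if j' \<in> ?js \<and> j \<in> ?js then \<Sum>i\<in>I. f j i * F i (e j') (X z)
      else if j' = j then 1 else 0)" for z
  have MC: "C1_on W1 (\<lambda>z. M z $ j' $ j)" for j' j
    unfolding M_def by (cases "j' \<in> ?js \<and> j \<in> ?js")
      (auto simp: C1_on_const intro!: C1_on_sum C1_on_cmult FX eJ)
  have "M z0 = mat 1"
  proof -
    have "(\<Sum>i\<in>I. f j i * F i (e j') (X z0)) = (if j' = j then 1 else 0)" if "j' \<in> ?js" "j \<in> ?js" for j' j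
    proof -
      have "(\<Sum>i\<in>I. f j i * F i (e j') (X z0)) = (\<Sum>i\<in>I. f' (e j) i * b i x0 (e j'))"
        using z0(2) x0 Tb eJ[OF that(1)] by (intro sum.cong) (auto simp: f_def Fb)
      then show ?thesis using f'[OF eJ[OF that(1)], of "e j"] e_eq[OF that] by auto
    qed
    then show ?thesis by (simp add: M_def mat_def vec_eq_iff)
  qed
  then have "det (M z0) \<noteq> 0" by (simp only: det_I)
  then obtain W2 P where W2: "open W2" "z0 \<in> W2" "W2 \<subseteq> W1" and P: "\<And>i j. C1_on W2 (\<lambda>z. P z $ i $ j)"
    and MP: "\<And>z. z \<in> W2 \<Longrightarrow> M z ** P z = mat 1" and PM: "\<And>z. z \<in> W2 \<Longrightarrow> P z ** M z = mat 1"
    by (rule C1_on_matrix_inverse[OF W1(1) MC W1(2)]) (rule that)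
  \<comment> \<open>The closed box is compact inside the region where the normalised fields are C1,
    which yields uniform bounds for the derivatives on the open box. The half-width
    \<open>r / (2 * CARD('n))\<close> keeps it in the ball through the bound of the norm by the sum
    of the coordinates.\<close>
  have "\<exists>a>0. cbox (z0 - (\<chi> l. a)) (z0 + (\<chi> l. a)) \<subseteq> W2"
  proof -
    obtain r where r: "r > 0" "ball z0 r \<subseteq> W2" using W2(1,2) open_contains_ball by blast
    define a where "a = r / (2 * CARD('n))"
    have a: "a > 0" using r by (simp add: a_def)
    have "cbox (z0 - (\<chi> l. a)) (z0 + (\<chi> l. a)) \<subseteq> ball z0 r"
    proof
      fix z assume z: "z \<in> cbox (z0 - (\<chi> l. a)) (z0 + (\<chi> l. a))"
      have "norm (z - z0) \<le> (\<Sum>l\<in>UNIV. \<bar>(z - z0) $ l\<bar>)" by (rule norm_le_l1_cart)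
      also have "\<dots> \<le> (\<Sum>l\<in>(UNIV :: 'n::{finite,wellorder} set). a)"
        using z by (intro sum_mono) (auto simp: mem_box_cart abs_le_iff algebra_simps)
      also have "\<dots> = r / 2" by (simp add: a_def)
      also have "\<dots> < r" using r by simp
      finally show "z \<in> ball z0 r" by (simp add: dist_norm norm_minus_commute)
    qed
    then show ?thesis using a r by blast
  qed
  then obtain a where a: "a > 0" "cbox (z0 - (\<chi> l. a)) (z0 + (\<chi> l. a)) \<subseteq> W2" by blast
  define D where "D = box (z0 - (\<chi> l. a)) (z0 + (\<chi> l. a))"
  define D' where "D' = cbox (z0 - (\<chi> l. a)) (z0 + (\<chi> l. a))"
  have D: "open D" "bounded D" "D \<subseteq> D'" "compact D'" "D' \<subseteq> W2" "D \<subseteq> W2" "D \<subseteq> W1" "D \<subseteq> W"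
  proof -
    show "open D" "bounded D" "compact D'" by (simp_all add: D_def D'_def open_box bounded_box)
    show "D \<subseteq> D'" unfolding D_def D'_def by (rule box_subset_cbox)
    moreover show "D' \<subseteq> W2" unfolding D'_def by (rule a(2))
    ultimately show "D \<subseteq> W2" by (rule subset_trans)
    then show "D \<subseteq> W1" using W2(3) by (rule subset_trans)
    then show "D \<subseteq> W" using W1(3) by (rule subset_trans)
  qed
  have memD: "z \<in> D \<longleftrightarrow> (\<forall>l. \<bar>z $ l - z0 $ l\<bar> < a)" for z
    by (auto simp: D_def mem_box_cart abs_less_iff algebra_simps; metis add.commute)
  \<comment> \<open>The neighbourhood is shrunk so that the slices of all its points stay in the box
    for every admissible value of the padding coordinate.\<close>
  define T' where "T' = {x \<in> T. \<forall>l\<in>UNIV - {m0}. \<bar>x $ l - x0 $ l\<bar> < a}"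
  have T': "open T'" "x0 \<in> T'"
  proof -
    have "T' = T \<inter> (\<Inter>l\<in>UNIV - {m0}. (\<lambda>x. x $ l) -` ball (x0 $ l) a)"
      by (auto simp: T'_def dist_real_def abs_minus_commute)
    also have "open \<dots>"
      by (intro open_Int T open_INT ballI open_vimage) (auto intro!: continuous_intros)
    finally show "open T'" .
    show "x0 \<in> T'" using T(2) a(1) by (simp add: T'_def)
  qed
  \<comment> \<open>Half of the half-width of the box, so that the padding coordinate stays strictly
    inside.\<close>
  define s0 where "s0 = \<sigma>2 - a / 2"
  define s1 where "s1 = \<sigma>2 + a / 2"
  have sliceD: "slice \<pi> m0 s x \<in> D" if "x \<in> T'" "s0 \<le> s" "s \<le> s1" for x s
    unfolding memD
  proof
    fix l
    show "\<bar>slice \<pi> m0 s x $ l - z0 $ l\<bar> < a"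
    proof (cases "l = \<pi> m0")
      case True
      then show ?thesis using that a(1) by (auto simp: slice_def z0_def s0_def s1_def abs_less_iff)
    next
      case False
      then have "inv \<pi> l \<noteq> m0" using \<pi> by (metis bij_inv_eq_iff)
      then show ?thesis using that(1) False by (auto simp: slice_def z0_def T'_def)
    qed
  qed
  \<comment> \<open>W is multiplied by the inverse matrix, and the Gaussian equation is divided by
    its coefficient function \<open>k1\<close>, which turns the level 1 into the function
    \<open>w\<close>. The values outside \<open>D\<close> are set to 0 to have Borel functions on
    the whole space.\<close>
  define V where "V i j z = (if z \<in> D \<and> j \<in> ?js then \<Sum>j'\<in>?js. P z $ j $ j' * F i (e j') (X z) else 0)" for i j z
  define g where "g k z = (if z \<in> D then G k (X z) / G k1 (X z) else 0)" for k z
  define w where "w z = (if z \<in> D then 1 / G k1 (X z) else 0)" for z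
  \<comment> \<open>The coefficient vector of smallest norm at which the Gaussian field has the
    value 1 at \<open>X z\<close>: the vector \<open>G\<close> divided by its squared
    length.\<close>
  define q where "q k z = G k (X z) / \<sigma>2" for k z
  let ?V = "\<lambda>i j z. \<Sum>j'\<in>?js. P z $ j $ j' * F i (e j') (X z)"
  let ?g = "\<lambda>k z. G k (X z) / G k1 (X z)"
  let ?w = "\<lambda>z. 1 / G k1 (X z)"
  have V2: "C1_on W2 (?V i j)" if "i \<in> I" for i j
    by (intro C1_on_sum C1_on_mult P C1_on_subset[OF FX W2(3)] that eJ)
  have g2: "C1_on W2 (?g k)" if "k \<in> K" for k
    by (intro C1_on_divide C1_on_subset[OF GX W2(3)] that K G(2))
  have w2: "C1_on W2 ?w"
    by (intro C1_on_divide C1_on_const C1_on_subset[OF GX W2(3)] K G(2))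
  have V1: "C1_on D (V i j)" if "i \<in> I" for i j
  proof (cases "j \<in> ?js")
    case True
    show ?thesis by (rule C1_on_cong[OF C1_on_subset[OF V2[OF that] D(6)] D(1)]) (use True in \<open>simp add: V_def\<close>)
  next
    case False
    show ?thesis by (rule C1_on_cong[OF C1_on_const D(1)]) (use False in \<open>simp add: V_def\<close>)
  qed
  have g1: "C1_on D (g k)" if "k \<in> K" for k
    by (rule C1_on_cong[OF C1_on_subset[OF g2[OF that] D(6)] D(1)]) (simp add: g_def)
  have w1: "C1_on D w"
    by (rule C1_on_cong[OF C1_on_subset[OF w2 D(6)] D(1)]) (simp add: w_def)
  have bound: "\<exists>B. \<forall>z\<in>D. \<bar>partial l \<phi> z\<bar> \<le> B" if "C1_on W2 \<psi>" "C1_on D \<phi>" "\<And>z. z \<in> D \<Longrightarrow> \<phi> z = \<psi> z" for \<phi> \<psi> l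
  proof -
    have "compact (partial l \<psi> ` D')"
      by (rule compact_continuous_image[OF continuous_on_subset[OF continuous_on_partial[OF that(1)] D(5)] D(4)])
    then obtain B where B: "\<And>z. z \<in> D' \<Longrightarrow> \<bar>partial l \<psi> z\<bar> \<le> B"
      using compact_imp_bounded bounded_iff by (metis imageI real_norm_def)
    show ?thesis
      using B D(3) partial_cong[OF D(1) _ that(3) that(2)] by (intro exI[of _ B]) auto
  qed
  have "\<exists>B. \<forall>i\<in>I. \<forall>j l. \<forall>z\<in>D. \<bar>partial l (V i j) z\<bar> \<le> B"
  proof -
    have "\<exists>B. \<forall>z\<in>D. \<bar>partial l (V i j) z\<bar> \<le> B" if "i \<in> I" for i j l
    proof (cases "j \<in> ?js")
      case True
      show ?thesis by (rule bound[OF V2[OF that] V1[OF that]]) (use True in \<open>simp add: V_def\<close>)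
    next
      case False
      show ?thesis by (rule bound[OF C1_on_const V1[OF that]]) (use False in \<open>simp add: V_def\<close>)
    qed
    note ex = this
    define Bf where "Bf i j l = (SOME B. \<forall>z\<in>D. \<bar>partial l (V i j) z\<bar> \<le> B)" for i j l
    have Bf: "\<bar>partial l (V i j) z\<bar> \<le> Bf i j l" if "i \<in> I" "z \<in> D" for i j l z
      using someI_ex[OF ex[OF that(1)], of l j] that(2) by (simp add: Bf_def)
    define A where "A = (\<lambda>(i, j, l). \<bar>Bf i j l\<bar>) ` (I \<times> UNIV \<times> UNIV)"
    have "finite A" unfolding A_def using I by auto
    moreover have "\<bar>Bf i j l\<bar> \<in> A" if "i \<in> I" for i j l
      unfolding A_def by (rule image_eqI[of _ _ "(i, j, l)"]) (use that in auto)
    ultimately have "\<bar>Bf i j l\<bar> \<le> Max A" if "i \<in> I" for i j l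
      using that by (intro Max_ge)
    then show ?thesis using Bf by (meson abs_ge_self order_trans)
  qed
  then obtain B1 where B1: "\<And>i j l z. i \<in> I \<Longrightarrow> z \<in> D \<Longrightarrow> \<bar>partial l (V i j) z\<bar> \<le> B1" by blast
  have "\<exists>B. \<forall>k\<in>K. \<forall>l. \<forall>z\<in>D. \<bar>partial l (g k) z\<bar> \<le> B"
  proof -
    have "\<exists>B. \<forall>z\<in>D. \<bar>partial l (g k) z\<bar> \<le> B" if "k \<in> K" for k l
      by (rule bound[OF g2[OF that] g1[OF that]]) (simp add: g_def)
    note ex = this
    define Bf where "Bf k l = (SOME B. \<forall>z\<in>D. \<bar>partial l (g k) z\<bar> \<le> B)" for k l
    have Bf: "\<bar>partial l (g k) z\<bar> \<le> Bf k l" if "k \<in> K" "z \<in> D" for k l z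
      using someI_ex[OF ex[OF that(1)], of l] that(2) by (simp add: Bf_def)
    define A where "A = (\<lambda>(k, l). \<bar>Bf k l\<bar>) ` (K \<times> UNIV)"
    have "finite A" unfolding A_def using K by auto
    moreover have "\<bar>Bf k l\<bar> \<in> A" if "k \<in> K" for k l
      unfolding A_def by (rule image_eqI[of _ _ "(k, l)"]) (use that in auto)
    ultimately have "\<bar>Bf k l\<bar> \<le> Max A" if "k \<in> K" for k l
      using that by (intro Max_ge)
    then show ?thesis using Bf by (meson abs_ge_self order_trans)
  qed
  then obtain B2 where B2: "\<And>k l z. k \<in> K \<Longrightarrow> z \<in> D \<Longrightarrow> \<bar>partial l (g k) z\<bar> \<le> B2" by blast
  define B where "B = \<bar>B1\<bar> + \<bar>B2\<bar>"
  have A2: "(\<Sum>k\<in>K. (G k (X z))\<^sup>2) = \<sigma>2" if "z \<in> D" for z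
    using XT[of z] D(8) that by (auto simp: \<Theta>_def)
  have core: "(\<forall>u. mean_zeros Q u = ennreal (exp (- (u\<^sup>2 / \<sigma>2) / 2)) * mean_zeros Q 0) \<and> mean_zeros Q 0 < \<infinity>"
    if Q: "fsigma Q" "Q \<subseteq> S \<inter> (T' \<inter> T1)" for Q
  proof -
    define Qz where "Qz = {z \<in> D. X z \<in> Q}"
    interpret chart_fields D Qz i0 i1 I K V f g q w k1 \<sigma>2 B s0 s1 \<beta> C \<rho> "\<lambda>u p. ecount (zeros Q u p)"
    proof
      show "open D" "bounded D" "i0 \<noteq> i1" "finite I" "finite K" "k1 \<in> K" by (fact D(1) D(2) i01 I K)+
      show "fsigma Qz" unfolding Qz_def
        by (rule fsigma_continuous_preimage[OF D(1) continuous_on_subset[OF contX D(8)] Q(1)])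
      show "Qz \<subseteq> D" by (auto simp: Qz_def)
      show "C1_on D (V i j)" if "i \<in> I" for i j by (rule V1[OF that])
      show "V i j z = 0" if "z \<notin> D" for i j z using that by (simp add: V_def)
      show "C1_on D (g k)" if "k \<in> K" for k by (rule g1[OF that])
      show "g k z = 0" if "z \<notin> D" for k z using that by (simp add: g_def)
      show "C1_on D w" by (rule w1)
      show "w z = 0" if "z \<notin> D" for z using that by (simp add: w_def)
      show "g k1 z = 1" if "z \<in> D" for z using that G(2) by (simp add: g_def)
      show "(\<Sum>i\<in>I. f j i * V i j' z) = (if j = j' then 1 else 0)"
        if z: "z \<in> D" and j: "j \<in> ?js" and j': "j' \<in> ?js" for j j' z
      proof -
        have "(\<Sum>i\<in>I. f j i * V i j' z) = (\<Sum>j''\<in>?js. P z $ j' $ j'' * (\<Sum>i\<in>I. f j i * F i (e j'') (X z)))"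
          using z j' unfolding V_def
          by (simp only: simp_thms if_True sum_distrib_left) (subst sum.swap, simp only: mult_ac)
        also have "\<dots> = (\<Sum>j''\<in>?js. P z $ j' $ j'' * M z $ j'' $ j)"
          using j by (intro sum.cong) (simp_all add: M_def)
        also have "\<dots> = (\<Sum>j''\<in>UNIV. P z $ j' $ j'' * M z $ j'' $ j)"
          using j by (intro sum.mono_neutral_left) (auto simp: M_def)
        also have "\<dots> = (P z ** M z) $ j' $ j" by (simp add: matrix_matrix_mult_def)
        also have "\<dots> = (if j = j' then 1 else 0)" using PM[of z] z D(6) by (auto simp: mat_def)
        finally show ?thesis .
      qed
      show "(\<Sum>k\<in>K. q k z * g k z) = w z" if z: "z \<in> D" for z
      proof -
        have "(\<Sum>k\<in>K. q k z * g k z) = (\<Sum>k\<in>K. (G k (X z))\<^sup>2) / (\<sigma>2 * G k1 (X z))"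
          using z by (simp add: q_def g_def sum_divide_distrib power2_eq_square)
        then show ?thesis using A2[OF z] \<sigma>2(1) z by (simp add: w_def)
      qed
      \<comment> \<open>Since \<open>g k\<close> is the product of \<open>G k\<close> along the
        chart with \<open>w\<close>, the product rule gives two parts. Weighted by \<open>q\<close>,
        those with the derivative of \<open>w\<close> add up to that derivative; the others add up
        to a multiple of the derivative of the variance along the chart.\<close>
      show "(\<Sum>k\<in>K. q k z * partial l (g k) z) = partial l w z" if z: "z \<in> D" for l z
      proof -
        have GD: "C1_on D (\<lambda>z. G k (X z))" if "k \<in> K" for k
          by (rule C1_on_subset[OF GX[OF that] D(7)])
        have "partial l (g k) z = G k (X z) * partial l w z + partial l (\<lambda>z. G k (X z)) z * w z" if "k \<in> K" for k
        proof -
          have "partial l (g k) z = partial l (\<lambda>z. G k (X z) * w z) z"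
            by (rule partial_cong[OF D(1) z _ g1[OF that]]) (simp add: g_def w_def)
          then show ?thesis using partial_mult[OF GD[OF that] w1 z] by simp
        qed
        then have "(\<Sum>k\<in>K. q k z * partial l (g k) z) =
            (\<Sum>k\<in>K. (G k (X z))\<^sup>2 / \<sigma>2 * partial l w z + G k (X z) * partial l (\<lambda>z. G k (X z)) z * w z / \<sigma>2)"
          by (intro sum.cong) (simp_all add: q_def power2_eq_square algebra_simps add_divide_distrib)
        also have "\<dots> = (\<Sum>k\<in>K. (G k (X z))\<^sup>2) / \<sigma>2 * partial l w z +
            (\<Sum>k\<in>K. G k (X z) * partial l (\<lambda>z. G k (X z)) z) * w z / \<sigma>2"
          by (simp only: sum_divide_distrib sum_distrib_right sum.distrib)
        finally have "(\<Sum>k\<in>K. q k z * partial l (g k) z) = \<dots>" .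
        \<comment> \<open>The chart stays on the level set, so the sum of squares is constant in all
          chart variables; half its derivative is this sum.\<close>
        moreover have "(\<Sum>k\<in>K. G k (X z) * partial l (\<lambda>z. G k (X z)) z) = 0"
        proof -
          have "0 = partial l (\<lambda>_. \<sigma>2) z" by (simp add: partial_const)
          also have "\<dots> = partial l (\<lambda>z. \<Sum>k\<in>K. G k (X z) * G k (X z)) z"
            by (rule partial_cong[OF D(1) z _ C1_on_const]) (use A2 in \<open>simp add: power2_eq_square\<close>)
          also have "\<dots> = (\<Sum>k\<in>K. partial l (\<lambda>z. G k (X z) * G k (X z)) z)"
            by (rule partial_sum[OF C1_on_mult[OF GD GD] z])
          also have "\<dots> = 2 * (\<Sum>k\<in>K. G k (X z) * partial l (\<lambda>z. G k (X z)) z)"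
            by (simp add: partial_mult[OF GD GD z] sum_distrib_left mult.commute)
          finally show ?thesis by simp
        qed
        ultimately show ?thesis using A2[OF z] \<sigma>2(1) by simp
      qed
      show "(\<Sum>k\<in>K. (q k z)\<^sup>2) = 1 / \<sigma>2" if z: "z \<in> D" for z
        using A2[OF z] \<sigma>2(1) by (simp add: q_def power_divide sum_divide_distrib[symmetric] power2_eq_square)
      show "(\<Sum>k\<in>K. x k * q k z) = 0" if z: "z \<in> D" and 0: "(\<Sum>k\<in>K. x k * g k z) = 0" for x z
      proof -
        have "(\<Sum>k\<in>K. x k * G k (X z)) = (\<Sum>k\<in>K. x k * g k z) * G k1 (X z)"
          using z G(2) by (simp add: g_def sum_distrib_right)
        then show ?thesis using 0 by (simp add: q_def sum_divide_distrib[symmetric])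
      qed
      show "0 \<le> B" by (simp add: B_def)
      show "\<bar>partial l (V i j) z\<bar> \<le> B" if "i \<in> I" "z \<in> D" for i j l z
        using B1[OF that, of l j] by (simp add: B_def)
      show "\<bar>partial l (g k) z\<bar> \<le> B" if "k \<in> K" "z \<in> D" for k l z
        using B2[OF that, of l] by (simp add: B_def)
      show "s0 < s1" using a(1) by (simp add: s0_def s1_def)
      show "\<rho> \<in> borel_measurable (lborel_PiM I)" "0 \<le> C" "real (card I) < \<beta>" by (fact \<rho>)+
      show "\<rho> c \<le> ennreal (C * wt I c powr - \<beta>)" if "c \<in> space (lborel_PiM I)" for c by (rule \<rho>(2)[OF that])
      show "(\<lambda>p. ecount (zeros Q u p)) \<in> borel_measurable (lborel_PiM I \<Otimes>\<^sub>M lborel_PiM K)" for u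
        by (rule zeros_meas) (use Q in auto)
      show "ecount (zeros Q u p) = ecount {z \<in> Qz. z $ i0 = s \<and> (\<Sum>k\<in>K. snd p k * g k z) + u * w z = 0 \<and>
          (\<forall>j\<in>?js. (\<Sum>i\<in>I. fst p i * V i j z) = 0)}" (is "_ = ecount ?Z") if s: "s0 \<le> s" "s \<le> s1" for u p s
      proof -
        have cond: "(\<Sum>k\<in>K. snd p k * g k z) + u * w z = 0 \<longleftrightarrow> (\<Sum>k\<in>K. snd p k * G k (X z)) + u = 0"
          "(\<forall>j\<in>?js. (\<Sum>i\<in>I. fst p i * V i j z) = 0) \<longleftrightarrow> (\<forall>j\<in>J. (\<Sum>i\<in>I. fst p i * b i (X z) j) = 0)"
          if z: "z \<in> Qz" for z
        proof -
          have zD: "z \<in> D" "X z \<in> Q" using z by (auto simp: Qz_def)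
          have "(\<Sum>k\<in>K. snd p k * g k z) + u * w z = ((\<Sum>k\<in>K. snd p k * G k (X z)) + u) / G k1 (X z)"
            using zD by (simp add: g_def w_def sum_divide_distrib add_divide_distrib)
          then show "(\<Sum>k\<in>K. snd p k * g k z) + u * w z = 0 \<longleftrightarrow> (\<Sum>k\<in>K. snd p k * G k (X z)) + u = 0"
            using G(2) by simp
          define y where "y = (\<chi> j. if j \<in> ?js then \<Sum>i\<in>I. fst p i * F i (e j) (X z) else 0)"
          have Vy: "(\<Sum>i\<in>I. fst p i * V i j z) = (P z *v y) $ j" if j: "j \<in> ?js" for j
          proof -
            have "(\<Sum>i\<in>I. fst p i * V i j z) = (\<Sum>j'\<in>?js. P z $ j $ j' * (\<Sum>i\<in>I. fst p i * F i (e j') (X z)))"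
              using zD j unfolding V_def
              by (simp only: simp_thms if_True sum_distrib_left) (subst sum.swap, simp only: mult_ac)
            also have "\<dots> = (\<Sum>j'\<in>?js. P z $ j $ j' * y $ j')"
              by (intro sum.cong) (simp_all add: y_def)
            also have "\<dots> = (\<Sum>j'\<in>UNIV. P z $ j $ j' * y $ j')"
              by (intro sum.mono_neutral_left) (auto simp: y_def)
            finally show ?thesis by (simp add: matrix_vector_mult_def)
          qed
          have yM: "y = M z *v (P z *v y)"
            using MP[of z] zD(1) D(6) by (auto simp: matrix_vector_mul_assoc)
          \<comment> \<open>The entries of \<open>y\<close> at \<open>i0\<close> and
            \<open>i1\<close> are 0 and the matrix \<open>M z\<close> does not mix these indices
            with the others; invertibility therefore turns vanishing of the normalised components
            into vanishing of the original ones.\<close>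
          have "(\<forall>j\<in>?js. (P z *v y) $ j = 0) \<longleftrightarrow> (\<forall>j\<in>?js. y $ j = 0)"
          proof
            assume v0: "\<forall>j\<in>?js. (P z *v y) $ j = 0"
            show "\<forall>j\<in>?js. y $ j = 0"
            proof
              fix j' assume j': "j' \<in> ?js"
              have "y $ j' = (\<Sum>j\<in>UNIV. M z $ j' $ j * (P z *v y) $ j)"
                by (subst yM) (simp add: matrix_vector_mult_def[of "M z"])
              also have "\<dots> = 0"
              proof (rule sum.neutral, rule ballI)
                fix j
                show "M z $ j' $ j * (P z *v y) $ j = 0"
                proof (cases "j \<in> ?js")
                  case True then show ?thesis using v0 by simp
                next
                  case False
                  then have "M z $ j' $ j = 0" using j' by (auto simp: M_def)
                  then show ?thesis by simp
                qed
              qed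
              finally show "y $ j' = 0" .
            qed
          next
            assume "\<forall>j\<in>?js. y $ j = 0"
            then have "y = 0" by (auto simp: vec_eq_iff y_def)
            then show "\<forall>j\<in>?js. (P z *v y) $ j = 0" by simp
          qed
          also have "\<dots> \<longleftrightarrow> (\<forall>j\<in>?js. (\<Sum>i\<in>I. fst p i * b i (X z) (e j)) = 0)"
          proof (intro ball_cong refl)
            fix j assume j: "j \<in> ?js"
            have "y $ j = (\<Sum>i\<in>I. fst p i * F i (e j) (X z))" using j by (simp add: y_def)
            also have "\<dots> = (\<Sum>i\<in>I. fst p i * b i (X z) (e j))"
            proof (rule sum.cong)
              have "X z \<in> S" "X z \<in> T1" using zD(2) Q(2) by auto
              then show "fst p i * F i (e j) (X z) = fst p i * b i (X z) (e j)" if "i \<in> I" for i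
                using Fb[OF that eJ[OF j]] T1b[OF that eJ[OF j]] by auto
            qed simp
            finally show "y $ j = 0 \<longleftrightarrow> (\<Sum>i\<in>I. fst p i * b i (X z) (e j)) = 0" by simp
          qed
          also have "\<dots> \<longleftrightarrow> (\<forall>j\<in>J. (\<Sum>i\<in>I. fst p i * b i (X z) j) = 0)"
            using e by (auto simp: bij_betw_def)
          finally show "(\<forall>j\<in>?js. (\<Sum>i\<in>I. fst p i * V i j z) = 0) \<longleftrightarrow> (\<forall>j\<in>J. (\<Sum>i\<in>I. fst p i * b i (X z) j) = 0)"
            using Vy by simp
        qed
        \<comment> \<open>Once the padding coordinate is fixed to \<open>s\<close>, the chart is
          injective, and the slice with parameter \<open>s\<close> is its inverse on the
          zeros.\<close>
        have "zeros Q u p = X ` ?Z"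
        proof (intro equalityI subsetI)
          fix x assume x: "x \<in> zeros Q u p"
          then have xQ: "x \<in> Q" by (simp add: zeros_def)
          let ?z = "slice \<pi> m0 s x"
          have "?z \<in> D" using sliceD[of x s] xQ Q(2) s by auto
          have "X ?z = x" using slice[of x s] xQ Q(2) \<Theta>S[of x] by (auto simp: T'_def)
          then have "?z \<in> Qz" using \<open>?z \<in> D\<close> xQ by (simp add: Qz_def)
          moreover have "?z $ i0 = s" by (simp add: slice_def i0_def)
          ultimately have "?z \<in> ?Z" using cond[of ?z] x \<open>X ?z = x\<close> by (auto simp: zeros_def)
          then show "x \<in> X ` ?Z" by (rule image_eqI[where x = ?z and f = X, rotated]) (simp add: \<open>X ?z = x\<close>)
        next
          fix x assume "x \<in> X ` ?Z"
          then obtain z where z: "z \<in> ?Z" and x: "x = X z" by (elim imageE)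
          then have "z \<in> Qz" by simp
          from z cond[OF this] this show "x \<in> zeros Q u p"
            unfolding x zeros_def by (simp add: Qz_def)
        qed
        moreover have "inj_on X ?Z"
        proof (rule inj_onI)
          fix z z' assume z: "z \<in> ?Z" "z' \<in> ?Z" and eq: "X z = X z'"
          then have W: "z \<in> W" "z' \<in> W" using D(8) by (auto simp: Qz_def)
          have "z $ l = z' $ l" for l
          proof (cases "l = i0")
            case True then show ?thesis using z by auto
          next
            case False
            then have "inv \<pi> l \<noteq> m0" "\<pi> (inv \<pi> l) = l"
              using \<pi> by (auto simp: i0_def bij_is_surj surj_f_inv_f)
            then show ?thesis using Xl[OF W(1), of "inv \<pi> l"] Xl[OF W(2), of "inv \<pi> l"] eq by simp
          qed
          then show "z = z'" by (simp add: vec_eq_iff)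
        qed
        ultimately show ?thesis by (simp add: ecount_image)
      qed
    qed
    show ?thesis
      using level_ratio level_finite unfolding mean_zeros_def wgt_def dens_def by blast
  qed
  show thesis
    using that[of "T' \<inter> T1"] T' T1 core by blast
qed

end

text \<open>The change of variables theorems of the library need a well-ordered index type; this copy of a
  finite type carries an arbitrary one.\<close>

typedef 'a wo = "UNIV :: 'a set" ..

lemma bij_Abs_wo: "bij Abs_wo"
  by (rule bij_betw_byWitness[where f' = Rep_wo]) (auto simp: Abs_wo_inverse Rep_wo_inverse)

instance wo :: (finite) finite
  by standard (metis bij_Abs_wo bij_betw_finite finite)

definition wo_rank :: "'a::finite wo \<Rightarrow> nat" where
  "wo_rank = (SOME f. inj f)"

lemma inj_wo_rank: "inj wo_rank"
proof -
  obtain f :: "'a wo \<Rightarrow> nat" where "inj f"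
    using finite_imp_inj_to_nat_seg[of "UNIV :: 'a wo set"] by auto
  then show ?thesis unfolding wo_rank_def by (rule someI[where P = inj])
qed

instantiation wo :: (finite) wellorder
begin

definition less_eq_wo :: "'a wo \<Rightarrow> 'a wo \<Rightarrow> bool" where
  "less_eq_wo x y \<longleftrightarrow> wo_rank x \<le> wo_rank y"

definition less_wo :: "'a wo \<Rightarrow> 'a wo \<Rightarrow> bool" where
  "less_wo x y \<longleftrightarrow> wo_rank x < wo_rank y"

instance
proof
  fix x y z :: "'a wo"
  show "(x < y) = (x \<le> y \<and> \<not> y \<le> x)"
    unfolding less_eq_wo_def less_wo_def by linarith
  show "x \<le> x" unfolding less_eq_wo_def by simp
  show "x \<le> z" if "x \<le> y" "y \<le> z" using that unfolding less_eq_wo_def by linarith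
  show "x \<le> y \<or> y \<le> x" unfolding less_eq_wo_def by linarith
  show "x = y" if "x \<le> y" "y \<le> x"
    using that unfolding less_eq_wo_def by (intro injD[OF inj_wo_rank]) simp
next
  fix P :: "'a wo \<Rightarrow> bool" and a
  assume step: "\<And>x. (\<And>y. y < x \<Longrightarrow> P y) \<Longrightarrow> P x"
  show "P a"
  proof (induction a rule: measure_induct_rule[of wo_rank])
    case (less a)
    show ?case by (rule step) (rule less.IH, simp add: less_wo_def)
  qed
qed

end

section \<open>Averaging over a random level\<close>

definition tilt_factor :: "real \<Rightarrow> ennreal" where
  "tilt_factor \<sigma>2 = (\<integral>\<^sup>+u. ennreal (exp (- (u\<^sup>2 / \<sigma>2) / 2)) \<partial>std_normal)"

text \<open>The integrand is below 1 except at the level 0, which is a null set. The factor is the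
  square root of \<sigma>2 / (1 + \<sigma>2), but only the strict inequality matters for the
  comparison.\<close>

lemma tilt_factor_less_1:
  assumes "0 < \<sigma>2" shows "tilt_factor \<sigma>2 < 1"
proof -
  interpret prob_space std_normal by (rule prob_space_std_normal)
  have le: "exp (- (u\<^sup>2 / \<sigma>2) / 2) \<le> 1" for u :: real using assms by simp
  have "tilt_factor \<sigma>2 \<le> (\<integral>\<^sup>+u. 1 \<partial>std_normal)"
    unfolding tilt_factor_def using le by (intro nn_integral_mono) simp
  then have fin: "tilt_factor \<sigma>2 \<noteq> \<infinity>"
    using emeasure_space_1 by (auto simp: top_unique)
  have "tilt_factor \<sigma>2 < (\<integral>\<^sup>+u. 1 \<partial>std_normal)"
    unfolding tilt_factor_def
  proof (rule nn_integral_less)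
    show "\<not> (AE u in std_normal. 1 \<le> ennreal (exp (- (u\<^sup>2 / \<sigma>2) / 2)))"
    proof
      assume "AE u in std_normal. 1 \<le> ennreal (exp (- (u\<^sup>2 / \<sigma>2) / 2))"
      then have "AE u in lborel. 0 < ennreal (std_normal_density u) \<longrightarrow> 1 \<le> ennreal (exp (- (u\<^sup>2 / \<sigma>2) / 2))"
        unfolding std_normal_def by (subst (asm) AE_density) auto
      moreover have "AE u in lborel. u \<noteq> (0::real)" by (rule AE_lborel_singleton)
      ultimately have "AE u in (lborel :: real measure). False"
      proof eventually_elim
        case (elim u)
        have "0 < std_normal_density u" by (simp add: normal_density_pos)
        then have "1 \<le> exp (- (u\<^sup>2 / \<sigma>2) / 2)" using elim(1) by (simp add: ennreal_less_zero_iff)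
        moreover have "0 < u\<^sup>2 / \<sigma>2" using elim(2) assms by simp
        ultimately show False by simp
      qed
      then show False by (simp add: eventually_False ae_filter_eq_bot_iff)
    qed
    show "(\<integral>\<^sup>+u. ennreal (exp (- (u\<^sup>2 / \<sigma>2) / 2)) \<partial>std_normal) \<noteq> \<infinity>"
      using fin by (simp add: tilt_factor_def)
    show "AE u in std_normal. ennreal (exp (- (u\<^sup>2 / \<sigma>2) / 2)) \<le> 1" using le by simp
  qed measurable
  then show ?thesis using emeasure_space_1 by simp
qed

text \<open>Finiteness of \<open>R\<close> is what makes equality force \<open>R = 0\<close>; an
  infinite \<open>R\<close> would satisfy \<open>L = R\<close> for every positive factor.\<close>

lemma contraction_comparison:
  fixes L R c :: ennreal
  assumes "L = c * R" "c < 1" "R < \<infinity>"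
  shows "L \<le> R \<and> (L = R \<longleftrightarrow> R = 0) \<and> (R = 0 \<longrightarrow> L = 0)"
proof -
  obtain r where r: "R = ennreal r" "0 \<le> r" using assms(3) by (cases R) auto
  obtain k where k: "c = ennreal k" "0 \<le> k" using assms(2) by (cases c) auto
  have "k < 1" using assms(2) k by (simp add: ennreal_less_one_iff)
  have L: "L = ennreal (k * r)" using assms(1) r k by (simp add: ennreal_mult)
  have "k * r \<le> r" using \<open>k < 1\<close> r(2) by (simp add: mult_left_le_one_le k(2))
  moreover have "k * r = r \<longleftrightarrow> r = 0" using \<open>k < 1\<close> by auto
  ultimately show ?thesis using r k by (auto simp: L ennreal_leI)
qed

lemma ecount_Un: "A \<inter> B = {} \<Longrightarrow> ecount (A \<union> B) = ecount A + ecount B"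
  unfolding ecount_def by (rule plus_emeasure[symmetric]) auto

section \<open>From charts to the whole hypersurface\<close>

context level_fields
begin

lemma mean_zeros_Un:
  assumes A: "fsigma A" "A \<subseteq> S" and B: "fsigma B" "B \<subseteq> S" and AB: "A \<inter> B = {}"
  shows "mean_zeros (A \<union> B) u = mean_zeros A u + mean_zeros B u"
proof -
  have "zeros (A \<union> B) u p = zeros A u p \<union> zeros B u p" "zeros A u p \<inter> zeros B u p = {}" for p
    using AB by (auto simp: zeros_def)
  then have "ecount (zeros (A \<union> B) u p) = ecount (zeros A u p) + ecount (zeros B u p)" for p
    by (simp add: ecount_Un)
  moreover note [measurable] = zeros_meas[OF A, of u] zeros_meas[OF B, of u]
  ultimately show ?thesis
    unfolding mean_zeros_def by (simp add: distrib_right nn_integral_add)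
qed

text \<open>Identity and finiteness pass to disjoint unions. Compactness gives a finite cover by
  neighbourhoods on which they hold, and these are cut off one after the other.\<close>

theorem mean_zeros_level:
  assumes U: "fsigma U" "U \<subseteq> S"
  shows "mean_zeros U u = ennreal (exp (- (u\<^sup>2 / \<sigma>2) / 2)) * mean_zeros U 0" "mean_zeros U 0 < \<infinity>"
proof -
  define P where "P Q \<longleftrightarrow> (\<forall>u. mean_zeros Q u = ennreal (exp (- (u\<^sup>2 / \<sigma>2) / 2)) * mean_zeros Q 0) \<and> mean_zeros Q 0 < \<infinity>" for Q
  \<comment> \<open>The relabelling \<open>Abs_wo\<close> provides the well-ordered indices that the
    charts need.\<close>
  have "\<exists>T. open T \<and> x \<in> T \<and> (\<forall>Q. fsigma Q \<longrightarrow> Q \<subseteq> S \<inter> T \<longrightarrow> P Q)" if x: "x \<in> S" for x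
    by (rule local_ratio[OF bij_Abs_wo x]) (unfold P_def, blast)
  then obtain T where T: "\<And>x. x \<in> S \<Longrightarrow> open (T x) \<and> x \<in> T x"
    and PT: "\<And>x Q. x \<in> S \<Longrightarrow> fsigma Q \<Longrightarrow> Q \<subseteq> S \<inter> T x \<Longrightarrow> P Q"
    by metis
  obtain F where F: "F \<subseteq> S" "finite F" "S \<subseteq> (\<Union>x\<in>F. T x)"
    using compactE_image[OF S, of S T] T by blast
  have "P Q" if "fsigma Q" "Q \<subseteq> S" "Q \<subseteq> (\<Union>x\<in>F. T x)" for Q
    using F(2,1) that
  proof (induction F arbitrary: Q rule: finite_induct)
    case empty
    then have "Q = {}" by simp
    then show ?case by (simp add: P_def mean_zeros_def zeros_def)
  next
    case (insert x F)
    \<comment> \<open>The neighbourhood is open and its complement closed, so both pieces remain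
      F-sigma; the second one is covered by one neighbourhood fewer.\<close>
    let ?A = "Q \<inter> T x" and ?B = "Q \<inter> - T x"
    have x: "x \<in> S" using insert.prems by simp
    have A: "fsigma ?A" "?A \<subseteq> S" and B: "fsigma ?B" "?B \<subseteq> S"
    proof -
      show "fsigma ?A" using T[OF x] by (intro fsigma_Int[OF insert.prems(2) fsigma_open]) auto
      show "fsigma ?B" using T[OF x] by (intro fsigma_Int[OF insert.prems(2) fsigma_closed]) auto
    qed (use insert.prems(3) in auto)
    have PA: "P ?A" using PT[OF x A(1)] A(2) by auto
    have PB: "P ?B" using insert.prems B by (intro insert.IH) auto
    have sum: "mean_zeros Q u = mean_zeros ?A u + mean_zeros ?B u" for u
    proof -
      have "?A \<union> ?B = Q" by auto
      then show ?thesis using mean_zeros_Un[OF A B, of u] by auto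
    qed
    show ?case unfolding P_def
    proof (intro conjI allI)
      fix u
      let ?e = "ennreal (exp (- (u\<^sup>2 / \<sigma>2) / 2))"
      have "mean_zeros ?A u = ?e * mean_zeros ?A 0" "mean_zeros ?B u = ?e * mean_zeros ?B 0"
        using PA PB unfolding P_def by blast+
      then have "mean_zeros Q u = ?e * (mean_zeros ?A 0 + mean_zeros ?B 0)"
        unfolding sum[of u] distrib_left by (simp only:)
      then show "mean_zeros Q u = ?e * mean_zeros Q 0" by (simp only: sum[of 0])
      have "mean_zeros ?A 0 < \<infinity>" "mean_zeros ?B 0 < \<infinity>"
        using PA PB unfolding P_def by blast+
      then show "mean_zeros Q 0 < \<infinity>" unfolding sum[of 0] by simp
    qed
  qed
  from this[OF U] U(2) F(3) have PU: "P U" by blast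
  show "mean_zeros U u = ennreal (exp (- (u\<^sup>2 / \<sigma>2) / 2)) * mean_zeros U 0" "mean_zeros U 0 < \<infinity>"
    using PU unfolding P_def by blast+
qed

lemma mean_zeros_eq:
  assumes U: "fsigma U" "U \<subseteq> S"
  shows "mean_zeros U u =
    (\<integral>\<^sup>+c. \<rho> c * (\<integral>\<^sup>+x. ecount (zeros U u (c, x)) \<partial>PiM K (\<lambda>_. std_normal)) \<partial>lborel_PiM I)"
proof -
  interpret K: sigma_finite_measure "lborel_PiM K" by (rule sigma_finite_lborel_PiM[OF K(1)])
  note [measurable] = zeros_meas[OF U, of u] \<rho>(1)
  have "mean_zeros U u = (\<integral>\<^sup>+c. \<integral>\<^sup>+x. ecount (zeros U u (c, x)) * wgt (c, x) \<partial>lborel_PiM K \<partial>lborel_PiM I)"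
    unfolding mean_zeros_def by (rule K.nn_integral_fst[symmetric]) measurable
  also have "\<dots> = (\<integral>\<^sup>+c. \<rho> c * (\<integral>\<^sup>+x. ecount (zeros U u (c, x)) \<partial>PiM K (\<lambda>_. std_normal)) \<partial>lborel_PiM I)"
  proof (rule nn_integral_cong)
    fix c assume "c \<in> space (lborel_PiM I)"
    then have [measurable]: "(\<lambda>x. ecount (zeros U u (c, x))) \<in> borel_measurable (lborel_PiM K)"
      using measurable_compose[OF measurable_Pair1' zeros_meas[OF U, of u]] by simp
    have "(\<integral>\<^sup>+x. ecount (zeros U u (c, x)) * wgt (c, x) \<partial>lborel_PiM K) =
        (\<integral>\<^sup>+x. \<rho> c * (ennreal (gauss_density K x) * ecount (zeros U u (c, x))) \<partial>lborel_PiM K)"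
      by (simp add: wgt_def mult_ac)
    also have "\<dots> = \<rho> c * (\<integral>\<^sup>+x. ennreal (gauss_density K x) * ecount (zeros U u (c, x)) \<partial>lborel_PiM K)"
      by (rule nn_integral_cmult) measurable
    also have "(\<integral>\<^sup>+x. ennreal (gauss_density K x) * ecount (zeros U u (c, x)) \<partial>lborel_PiM K) =
        (\<integral>\<^sup>+x. ecount (zeros U u (c, x)) \<partial>PiM K (\<lambda>_. std_normal))"
      unfolding PiM_std_normal[OF K(1)] by (rule nn_integral_density[symmetric]) measurable
    finally show "(\<integral>\<^sup>+x. ecount (zeros U u (c, x)) * wgt (c, x) \<partial>lborel_PiM K) =
      \<rho> c * (\<integral>\<^sup>+x. ecount (zeros U u (c, x)) \<partial>PiM K (\<lambda>_. std_normal))" .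
  qed
  finally show ?thesis .
qed

text \<open>The coefficient with index \<open>k0\<close> only sets the level. Integrating it last,
  by Fubini, averages the ratio between the level \<open>u\<close> and the level 0 against the
  standard normal law.\<close>

theorem random_level_mean:
  assumes U: "fsigma U" "U \<subseteq> S" and k0: "k0 \<notin> K"
  shows "(\<integral>\<^sup>+c. \<rho> c * (\<integral>\<^sup>+x. ecount (zeros U (x k0) (c, x)) \<partial>PiM (insert k0 K) (\<lambda>_. std_normal)) \<partial>lborel_PiM I) =
    tilt_factor \<sigma>2 * mean_zeros U 0"
proof -
  interpret N: prob_space std_normal by (rule prob_space_std_normal)
  interpret PN: product_sigma_finite "\<lambda>_ :: 'k. std_normal"
    by (intro product_sigma_finite.intro prob_space_imp_sigma_finite prob_space_std_normal)
  interpret PS: pair_sigma_finite std_normal "lborel_PiM I"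
    by (intro pair_sigma_finite.intro sigma_finite_lborel_PiM I prob_space_imp_sigma_finite prob_space_std_normal)
  interpret KN: sigma_finite_measure "PiM K (\<lambda>_. std_normal)" by (rule PN.sigma_finite[OF K(1)])
  let ?Z = "\<lambda>u c. \<integral>\<^sup>+x. ecount (zeros U u (c, x)) \<partial>PiM K (\<lambda>_. std_normal)"
  have Z: "(\<lambda>p. ?Z (fst p) (snd p)) \<in> borel_measurable (std_normal \<Otimes>\<^sub>M lborel_PiM I)"
  proof (rule KN.borel_measurable_nn_integral)
    have "(\<lambda>q. ecount (zeros U (fst (fst q)) (snd (fst q), snd q))) \<in>
        borel_measurable ((std_normal \<Otimes>\<^sub>M lborel_PiM I) \<Otimes>\<^sub>M PiM K (\<lambda>_. std_normal))"
      by (rule zeros_measurable[OF U]) measurable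
    then show "(\<lambda>(p, x). ecount (zeros U (fst p) (snd p, x))) \<in>
        borel_measurable ((std_normal \<Otimes>\<^sub>M lborel_PiM I) \<Otimes>\<^sub>M PiM K (\<lambda>_. std_normal))"
      by (simp add: case_prod_unfold)
  qed
  have ins: "(\<integral>\<^sup>+x. ecount (zeros U (x k0) (c, x)) \<partial>PiM (insert k0 K) (\<lambda>_. std_normal)) = (\<integral>\<^sup>+u. ?Z u c \<partial>std_normal)" for c
  proof -
    have "(\<lambda>x. ecount (zeros U (x k0) (c, x))) \<in> borel_measurable (PiM (insert k0 K) (\<lambda>_. std_normal))"
      by (rule zeros_measurable[OF U]) measurable
    from PN.product_nn_integral_insert_rev[OF K(1) k0 this]
    have "(\<integral>\<^sup>+x. ecount (zeros U (x k0) (c, x)) \<partial>PiM (insert k0 K) (\<lambda>_. std_normal)) =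
        (\<integral>\<^sup>+u. \<integral>\<^sup>+x. ecount (zeros U u (c, x(k0 := u))) \<partial>PiM K (\<lambda>_. std_normal) \<partial>std_normal)"
      by simp
    moreover have "zeros U u (c, x(k0 := u)) = zeros U u (c, x)" for u x
    proof -
      have "(\<Sum>k\<in>K. (x(k0 := u)) k * G k y) = (\<Sum>k\<in>K. x k * G k y)" for y
        using k0 by (intro sum.cong) auto
      then show ?thesis unfolding zeros_def by simp
    qed
    ultimately show ?thesis by simp
  qed
  have \<rho>': "(\<lambda>p. \<rho> (snd p)) \<in> borel_measurable (std_normal \<Otimes>\<^sub>M lborel_PiM I)"
    using \<rho>(1) by measurable
  have "(\<integral>\<^sup>+c. \<rho> c * (\<integral>\<^sup>+u. ?Z u c \<partial>std_normal) \<partial>lborel_PiM I) =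
      (\<integral>\<^sup>+c. \<integral>\<^sup>+u. \<rho> c * ?Z u c \<partial>std_normal \<partial>lborel_PiM I)"
  proof (intro nn_integral_cong nn_integral_cmult[symmetric])
    fix c assume "c \<in> space (lborel_PiM I)"
    from measurable_compose[OF measurable_Pair2'[OF this] Z]
    show "(\<lambda>u. ?Z u c) \<in> borel_measurable std_normal" by simp
  qed
  also have "\<dots> = (\<integral>\<^sup>+u. \<integral>\<^sup>+c. \<rho> c * ?Z u c \<partial>lborel_PiM I \<partial>std_normal)"
    by (rule PS.Fubini') (use Z \<rho>' in \<open>simp add: case_prod_unfold\<close>)
  also have "\<dots> = (\<integral>\<^sup>+u. mean_zeros U u \<partial>std_normal)"
    by (simp add: mean_zeros_eq[OF U])
  also have "\<dots> = (\<integral>\<^sup>+u. ennreal (exp (- (u\<^sup>2 / \<sigma>2) / 2)) * mean_zeros U 0 \<partial>std_normal)"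
    by (intro nn_integral_cong mean_zeros_level(1)[OF U])
  also have "\<dots> = tilt_factor \<sigma>2 * mean_zeros U 0"
    unfolding tilt_factor_def by (rule nn_integral_multc) measurable
  finally show ?thesis by (simp add: ins)
qed

end

section \<open>The hypersurface\<close>

locale exp_setting =
  fixes A :: "(real ^ 'm) set" and \<alpha> :: "real ^ 'm \<Rightarrow> real" and a0 :: "real ^ 'm"
    and \<alpha>0 t tmin :: real
  assumes A: "finite A" "aff_dim (convex hull A) = int CARD('m)"
    and \<alpha>: "\<And>a. a \<in> A \<Longrightarrow> 0 < \<alpha> a" and \<alpha>0: "0 < \<alpha>0"
    and tmin: "tmin \<in> range (Phi0 A \<alpha> a0 \<alpha>0)" "\<And>x. tmin \<le> Phi0 A \<alpha> a0 \<alpha>0 x" "tmin < t"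
begin

abbreviation "S \<equiv> S_hyp A \<alpha> a0 \<alpha>0 t"

definition "gexp a x = \<alpha> a / \<alpha>0 * exp ((a - a0) \<bullet> x)"

definition "\<Theta> x = (\<Sum>a\<in>A. (gexp a x)\<^sup>2)"

lemma A_nonempty: "A \<noteq> {}"
  using A(2) by auto

lemma gexp_pos: "a \<in> A \<Longrightarrow> 0 < gexp a x"
  unfolding gexp_def using \<alpha> \<alpha>0 by simp

lemma C1_gexp: "C1_on T (gexp a)"
  unfolding gexp_def[abs_def]
  by (intro C1_on_cmult C1_on_exp C1_on_linear bounded_linear_inner_right)

lemma sum_sq_pos: "0 < (\<Sum>a\<in>A. (\<alpha> a)\<^sup>2 * exp (2 * (a \<bullet> x)))"
proof (rule sum_pos[OF A(1) A_nonempty])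
  fix a assume "a \<in> A"
  then show "0 < (\<alpha> a)\<^sup>2 * exp (2 * (a \<bullet> x))" using \<alpha>[of a] by simp
qed

lemma \<Theta>_eq: "\<Theta> x = exp (2 * Phi0 A \<alpha> a0 \<alpha>0 x)"
proof -
  let ?s = "\<Sum>a\<in>A. (\<alpha> a)\<^sup>2 * exp (2 * (a \<bullet> x))"
  have s: "0 < ?s" by (rule sum_sq_pos)
  have "\<Theta> x = ?s * (exp (- 2 * (a0 \<bullet> x)) / \<alpha>0\<^sup>2)"
    unfolding \<Theta>_def sum_distrib_right
  proof (rule sum.cong)
    fix a
    have "(exp ((a - a0) \<bullet> x))\<^sup>2 = exp (2 * (a \<bullet> x)) * exp (- 2 * (a0 \<bullet> x))"
      by (simp add: exp_add[symmetric] exp_double[symmetric] inner_diff_left)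
    then show "(gexp a x)\<^sup>2 = (\<alpha> a)\<^sup>2 * exp (2 * (a \<bullet> x)) * (exp (- 2 * (a0 \<bullet> x)) / \<alpha>0\<^sup>2)"
      by (simp add: gexp_def power_mult_distrib power_divide)
  qed simp
  also have "\<dots> = exp (ln ?s) * (exp (- 2 * (a0 \<bullet> x)) / (exp (ln \<alpha>0))\<^sup>2)"
    using s \<alpha>0 by simp
  also have "\<dots> = exp (2 * Phi0 A \<alpha> a0 \<alpha>0 x)"
    by (simp add: Phi0_def exp_double[symmetric] exp_add[symmetric] exp_diff[symmetric] algebra_simps)
  finally show ?thesis .
qed

text \<open>Convexity in the form of the tangent inequality, from 1 + s \<le> exp s applied to each
  exponential.\<close>

lemma \<Theta>_convex: "\<Theta> x + (\<Sum>a\<in>A. (gexp a x)\<^sup>2 * (2 * ((a - a0) \<bullet> (y - x)))) \<le> \<Theta> y"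
  unfolding \<Theta>_def sum.distrib[symmetric]
proof (rule sum_mono)
  fix a
  let ?d = "(a - a0) \<bullet> (y - x)"
  have "gexp a y = gexp a x * exp ?d"
    by (simp add: gexp_def exp_add[symmetric] inner_diff_right)
  then have "(gexp a y)\<^sup>2 = (gexp a x)\<^sup>2 * exp (2 * ?d)"
    by (simp add: power_mult_distrib exp_double)
  moreover have "(gexp a x)\<^sup>2 * (1 + 2 * ?d) \<le> (gexp a x)\<^sup>2 * exp (2 * ?d)"
    by (intro mult_left_mono exp_ge_add_one_self) simp
  ultimately show "(gexp a x)\<^sup>2 + (gexp a x)\<^sup>2 * (2 * ?d) \<le> (gexp a y)\<^sup>2"
    by (simp add: distrib_left)
qed

section \<open>Level, boundedness and regularity of the frontier\<close>

lemma cont_Phi0: "continuous_on UNIV (Phi0 A \<alpha> a0 \<alpha>0)"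
  unfolding Phi0_def[abs_def] using sum_sq_pos
  by (intro continuous_intros) (auto simp: less_imp_neq[THEN not_sym])

lemma closed_Lambda: "closed (Lambda A \<alpha> a0 \<alpha>0 t)"
  unfolding Lambda_def using cont_Phi0 by (intro closed_Collect_le continuous_on_const)

text \<open>The points with a smaller value form an open subset of \<open>Lambda\<close>, so they
  are interior and cannot lie on the frontier.\<close>

lemma S_level: "x \<in> S \<Longrightarrow> Phi0 A \<alpha> a0 \<alpha>0 x = t"
proof -
  assume x: "x \<in> S"
  have "Phi0 A \<alpha> a0 \<alpha>0 x \<le> t"
    using x frontier_subset_closed[OF closed_Lambda] by (auto simp: S_hyp_def Lambda_def)
  moreover have "\<not> Phi0 A \<alpha> a0 \<alpha>0 x < t"
  proof
    assume "Phi0 A \<alpha> a0 \<alpha>0 x < t"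
    moreover have "open {x. Phi0 A \<alpha> a0 \<alpha>0 x < t}"
      using cont_Phi0 by (intro open_Collect_less continuous_on_const)
    ultimately have "x \<in> interior (Lambda A \<alpha> a0 \<alpha>0 t)"
      by (intro interiorI[of "{x. Phi0 A \<alpha> a0 \<alpha>0 x < t}"]) (auto simp: Lambda_def)
    with x show False by (simp add: S_hyp_def frontier_def)
  qed
  ultimately show ?thesis by simp
qed

lemma \<Theta>_S: "x \<in> S \<Longrightarrow> \<Theta> x = exp (2 * t)"
  by (simp add: \<Theta>_eq S_level)

text \<open>Otherwise moving the minimiser along \<open>v\<close> would not increase any term of
  \<Theta>, and minimality would force every term to stay constant. Then all points of
  \<open>A\<close> would lie in one hyperplane, against the full dimension of the convex hull. Here
  the attained minimum replaces the statement that \<open>a0\<close> is interior to the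
  hull.\<close>

lemma exists_positive_direction:
  assumes "v \<noteq> 0" shows "\<exists>a\<in>A. 0 < (a - a0) \<bullet> v"
proof (rule ccontr)
  assume "\<not> (\<exists>a\<in>A. 0 < (a - a0) \<bullet> v)"
  then have le: "(a - a0) \<bullet> v \<le> 0" if "a \<in> A" for a using that by (meson not_less)
  obtain x0 where x0: "tmin = Phi0 A \<alpha> a0 \<alpha>0 x0" using tmin(1) by auto
  have min: "\<Theta> x0 \<le> \<Theta> (x0 + v)" using tmin(2)[of "x0 + v"] by (simp add: \<Theta>_eq x0)
  have gexp_add: "gexp a (x0 + v) = gexp a x0 * exp ((a - a0) \<bullet> v)" for a
    by (simp add: gexp_def exp_add inner_add_right)
  have "(a - a0) \<bullet> v = 0" if a: "a \<in> A" for a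
  proof (rule ccontr)
    assume "(a - a0) \<bullet> v \<noteq> 0"
    with le[OF a] have "exp ((a - a0) \<bullet> v) < 1" by simp
    then have "gexp a (x0 + v) < gexp a x0" using gexp_pos[OF a, of x0] by (simp add: gexp_add)
    then have "(gexp a (x0 + v))\<^sup>2 < (gexp a x0)\<^sup>2"
      using gexp_pos[OF a, of "x0 + v"] by (intro power_strict_mono) auto
    moreover have "(gexp a (x0 + v))\<^sup>2 \<le> (gexp a x0)\<^sup>2" if a: "a \<in> A" for a
      using le[OF a] gexp_pos[OF a] by (intro power_mono) (auto simp: gexp_add less_imp_le intro!: mult_left_le)
    ultimately have "\<Theta> (x0 + v) < \<Theta> x0"
      unfolding \<Theta>_def using A(1) a by (intro sum_strict_mono_ex1) auto
    with min show False by simp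
  qed
  then have "a \<bullet> v = a0 \<bullet> v" if "a \<in> A" for a using that by (simp add: inner_diff_left)
  then have "A \<subseteq> {x. v \<bullet> x = v \<bullet> a0}" by (auto simp: inner_commute[of v])
  then have "aff_dim A \<le> aff_dim {x. v \<bullet> x = v \<bullet> a0}" by (rule aff_dim_subset)
  also have "\<dots> = int CARD('m) - 1" using assms by (simp add: aff_dim_hyperplane)
  finally show False using A(2) by (simp add: aff_dim_convex_hull)
qed

text \<open>The function \<open>N\<close> is continuous, positively homogeneous and positive away
  from 0, hence at least a positive multiple of the norm; the constant variance on \<open>S\<close>
  bounds it from above.\<close>

lemma bounded_S: "bounded S"
proof -
  define N where "N v = (\<Sum>a\<in>A. max 0 ((a - a0) \<bullet> v))" for v
  have contN: "continuous_on T N" for T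
    unfolding N_def by (intro continuous_intros)
  have N_pos: "0 < N v" if v: "v \<noteq> 0" for v
  proof -
    obtain a where "a \<in> A" "0 < (a - a0) \<bullet> v" using exists_positive_direction[OF v] by auto
    then show ?thesis unfolding N_def using A(1) by (intro sum_pos2[of A a]) auto
  qed
  have N_scale: "N (c *\<^sub>R v) = c * N v" if "0 \<le> c" for c v
    using that unfolding N_def sum_distrib_left
    by (intro sum.cong) (auto simp: max_mult_distrib_left)
  obtain v where v: "v \<in> sphere 0 1" "\<And>w. w \<in> sphere (0 :: real^'m) 1 \<Longrightarrow> N v \<le> N w"
    using continuous_attains_inf[OF compact_sphere _ contN, of 0 1] by auto
  then have \<delta>: "0 < N v" "\<And>w. norm w = 1 \<Longrightarrow> N v \<le> N w"
    using v by (auto intro!: N_pos)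
  \<comment> \<open>Each coefficient function is at most exp t on \<open>S\<close>; taking
    logarithms bounds the inner product with a - a0 by the corresponding term.\<close>
  define B where "B = (\<Sum>a\<in>A. max 0 (t - ln (\<alpha> a / \<alpha>0)))"
  have "norm x \<le> B / N v" if x: "x \<in> S" for x
  proof (cases "x = 0")
    case True
    then show ?thesis using \<delta>(1) by (auto simp: B_def intro!: divide_nonneg_pos sum_nonneg)
  next
    case False
    have "N x \<le> B"
      unfolding N_def B_def
    proof (intro sum_mono max.mono order_refl)
      fix a assume a: "a \<in> A"
      have "(gexp a x)\<^sup>2 \<le> \<Theta> x" unfolding \<Theta>_def using A(1) a by (intro member_le_sum) auto
      also have "\<dots> = (exp t)\<^sup>2" by (simp add: \<Theta>_S[OF x] exp_double)
      finally have "gexp a x \<le> exp t" using power2_le_imp_le by (metis exp_ge_zero)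
      then have "ln (gexp a x) \<le> t" using gexp_pos[OF a, of x] ln_le_cancel_iff[of "gexp a x" "exp t"] by simp
      moreover have "ln (gexp a x) = ln (\<alpha> a / \<alpha>0) + (a - a0) \<bullet> x"
        unfolding gexp_def using \<alpha>[OF a] \<alpha>0 by (subst ln_mult_pos) auto
      ultimately show "(a - a0) \<bullet> x \<le> t - ln (\<alpha> a / \<alpha>0)" by simp
    qed
    moreover have "N x = norm x * N (x /\<^sub>R norm x)"
      using N_scale[of "norm x" "x /\<^sub>R norm x"] False by simp
    moreover have "norm x * N v \<le> norm x * N (x /\<^sub>R norm x)"
      using \<delta>(2)[of "x /\<^sub>R norm x"] False by (intro mult_left_mono) auto
    ultimately show ?thesis using \<delta>(1) by (simp add: pos_le_divide_eq)
  qed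
  then show ?thesis unfolding bounded_iff by blast
qed

lemma compact_S: "compact S"
  using bounded_S by (simp add: compact_eq_bounded_closed S_hyp_def)

lemma partial_\<Theta>: "partial l \<Theta> x = (\<Sum>a\<in>A. (gexp a x)\<^sup>2 * (2 * (a - a0) $ l))"
proof -
  have "(gexp a has_derivative (\<lambda>v. gexp a x * ((a - a0) \<bullet> v))) (at x)" for a
    unfolding gexp_def[abs_def] using \<alpha>0 by (auto intro!: derivative_eq_intros)
  then have "((\<lambda>x. gexp a x * gexp a x) has_derivative
      (\<lambda>v. gexp a x * (gexp a x * ((a - a0) \<bullet> v)) + gexp a x * ((a - a0) \<bullet> v) * gexp a x)) (at x)" for a
    by (intro has_derivative_mult)
  then have "(\<Theta> has_derivative
      (\<lambda>v. \<Sum>a\<in>A. gexp a x * (gexp a x * ((a - a0) \<bullet> v)) + gexp a x * ((a - a0) \<bullet> v) * gexp a x)) (at x)"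
    unfolding \<Theta>_def[abs_def] power2_eq_square by (intro has_derivative_sum)
  then have "partial l \<Theta> x = (\<Sum>a\<in>A. gexp a x * (gexp a x * ((a - a0) \<bullet> axis l 1)) + gexp a x * ((a - a0) \<bullet> axis l 1) * gexp a x)"
    by (rule partial_eq)
  then show ?thesis by (simp add: inner_axis power2_eq_square algebra_simps)
qed

text \<open>By convexity a critical point is a global minimum, but on \<open>S\<close> the value of
  \<open>Phi0\<close> is \<open>t\<close>, above the minimum.\<close>

lemma grad_\<Theta>: assumes "x \<in> S" shows "\<exists>l. partial l \<Theta> x \<noteq> 0"
proof (rule ccontr)
  assume "\<nexists>l. partial l \<Theta> x \<noteq> 0"
  then have 0: "partial l \<Theta> x = 0" for l by simp
  obtain x0 where x0: "tmin = Phi0 A \<alpha> a0 \<alpha>0 x0" using tmin(1) by auto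
  have "(\<Sum>a\<in>A. (gexp a x)\<^sup>2 * (2 * ((a - a0) \<bullet> (x0 - x)))) = (\<Sum>l\<in>UNIV. (x0 - x) $ l * partial l \<Theta> x)"
    unfolding partial_\<Theta> sum_distrib_left inner_vec_def by (subst sum.swap) (simp add: algebra_simps)
  also have "\<dots> = 0" by (simp add: 0)
  finally have "\<Theta> x \<le> \<Theta> x0" using \<Theta>_convex[of x x0] by simp
  then show False using tmin(3) S_level[OF assms] by (simp add: \<Theta>_eq x0[symmetric])
qed

end

section \<open>Reduction to the coefficients\<close>

lemma sum_fun_apply: "(\<Sum>i\<in>I. f i) x = (\<Sum>i\<in>I. f i x)"
  by (induction I rule: infinite_finite_induct) auto

lemma fscale_sum_apply: "(\<Sum>i\<in>I. fscale (c i) (b i)) x j = (\<Sum>i\<in>I. c i * b i x j)"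
  by (simp add: sum_fun_apply fscale_def)

lemma smooth_on_local_C1:
  assumes "smooth_on S f" "x \<in> S"
  shows "\<exists>T F. open T \<and> x \<in> T \<and> C1_on T F \<and> (\<forall>y\<in>S \<inter> T. F y = f y)"
proof -
  obtain T F where "open T" "x \<in> T" "\<forall>n. C_k_on n F T" "\<forall>y\<in>S \<inter> T. F y = f y"
    using assms unfolding smooth_on_def by auto
  moreover from this have "C1_on T F" by (intro C1_on_C_k_on) simp
  ultimately show ?thesis by blast
qed

lemma nn_integral_distr':
  "T \<in> measurable M N \<Longrightarrow> f \<in> borel_measurable N \<Longrightarrow> (\<integral>\<^sup>+y. f y \<partial>distr M N T) = (\<integral>\<^sup>+x. f (T x) \<partial>M)"
  by (rule nn_integral_distr) simp_all

lemma smooth_on_continuous: "smooth_on S f \<Longrightarrow> continuous_on S f"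
  by (rule continuous_on_local_C1) (rule smooth_on_local_C1)

lemma nn_integral_indep_pair:
  assumes M: "prob_space M" and W: "W \<in> measurable M N" and E: "E \<in> measurable M N'"
    and indep: "\<And>B C. B \<in> sets N \<Longrightarrow> C \<in> sets N' \<Longrightarrow>
      measure M ((W -` B \<inter> space M) \<inter> (E -` C \<inter> space M)) = measure M (W -` B \<inter> space M) * measure M (E -` C \<inter> space M)"
    and \<Psi>: "\<Psi> \<in> borel_measurable (N \<Otimes>\<^sub>M N')"
  shows "(\<integral>\<^sup>+\<omega>. \<Psi> (W \<omega>, E \<omega>) \<partial>M) = (\<integral>\<^sup>+f. \<integral>\<^sup>+e. \<Psi> (f, e) \<partial>distr M N' E \<partial>distr M N W)"
proof -
  interpret M: prob_space M by fact
  interpret W: prob_space "distr M N W" by (rule M.prob_space_distr[OF W])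
  interpret E: prob_space "distr M N' E" by (rule M.prob_space_distr[OF E])
  have WE: "(\<lambda>\<omega>. (W \<omega>, E \<omega>)) \<in> measurable M (N \<Otimes>\<^sub>M N')" using W E by measurable
  have "distr M N W \<Otimes>\<^sub>M distr M N' E = distr M (N \<Otimes>\<^sub>M N') (\<lambda>\<omega>. (W \<omega>, E \<omega>))"
  proof (rule pair_measure_eqI)
    show "sets (distr M N W \<Otimes>\<^sub>M distr M N' E) = sets (distr M (N \<Otimes>\<^sub>M N') (\<lambda>\<omega>. (W \<omega>, E \<omega>)))"
      by (simp cong: sets_pair_measure_cong)
    fix B C assume "B \<in> sets (distr M N W)" "C \<in> sets (distr M N' E)"
    then have BC: "B \<in> sets N" "C \<in> sets N'" by auto
    have "(\<lambda>\<omega>. (W \<omega>, E \<omega>)) -` (B \<times> C) \<inter> space M = (W -` B \<inter> space M) \<inter> (E -` C \<inter> space M)" by auto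
    then have "emeasure (distr M (N \<Otimes>\<^sub>M N') (\<lambda>\<omega>. (W \<omega>, E \<omega>))) (B \<times> C) =
        ennreal (measure M (W -` B \<inter> space M) * measure M (E -` C \<inter> space M))"
      using BC by (simp add: emeasure_distr[OF WE] M.emeasure_eq_measure indep)
    then show "emeasure (distr M N W) B * emeasure (distr M N' E) C =
        emeasure (distr M (N \<Otimes>\<^sub>M N') (\<lambda>\<omega>. (W \<omega>, E \<omega>))) (B \<times> C)"
      using BC by (simp add: emeasure_distr[OF W] emeasure_distr[OF E] M.emeasure_eq_measure ennreal_mult)
  qed (unfold_locales)
  then have "(\<integral>\<^sup>+\<omega>. \<Psi> (W \<omega>, E \<omega>) \<partial>M) = (\<integral>\<^sup>+p. \<Psi> p \<partial>(distr M N W \<Otimes>\<^sub>M distr M N' E))"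
    using nn_integral_distr'[OF WE \<Psi>] by simp
  also have "\<dots> = (\<integral>\<^sup>+f. \<integral>\<^sup>+e. \<Psi> (f, e) \<partial>distr M N' E \<partial>distr M N W)"
    using \<Psi> by (intro E.nn_integral_fst[symmetric]) (simp cong: measurable_cong_sets sets_pair_measure_cong)
  finally show ?thesis .
qed

text \<open>Measurability of the number of zeros rests on continuity of the paths, so the product
  sigma-algebra is restricted to the continuous functions.\<close>

definition cont_space :: "('a::euclidean_space \<Rightarrow> real) measure" where
  "cont_space = restrict_space (PiM UNIV (\<lambda>_. borel)) {e. continuous_on UNIV e}"

lemma space_cont_space: "space cont_space = {e. continuous_on UNIV e}"
  by (auto simp: cont_space_def space_restrict_space space_PiM)

lemma cont_space_eval: "(\<lambda>e. e y) \<in> borel_measurable cont_space"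
  unfolding cont_space_def by (rule measurable_restrict_space1) simp

lemma measurable_cont_spaceI:
  assumes "\<And>\<omega>. \<omega> \<in> space M \<Longrightarrow> continuous_on UNIV (E \<omega>)" "\<And>y. (\<lambda>\<omega>. E \<omega> y) \<in> borel_measurable M"
  shows "E \<in> measurable M cont_space"
  unfolding cont_space_def using assms
  by (intro measurable_restrict_space2 measurable_PiM_single') auto

lemma space_field_space: "space (field_space S k) = smooth_fields S k"
  by (auto simp: field_space_def space_restrict_space space_PiM)

lemma field_space_eval: "(\<lambda>f. f y i) \<in> borel_measurable (field_space S k)"
proof -
  have 1: "(\<lambda>f :: 'a \<Rightarrow> nat \<Rightarrow> real. f y) \<in> measurable (PiM UNIV (\<lambda>_. PiM UNIV (\<lambda>_. borel))) (PiM UNIV (\<lambda>_. borel))"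
    by (rule measurable_component_singleton) simp
  have 2: "(\<lambda>g :: nat \<Rightarrow> real. g i) \<in> measurable (PiM UNIV (\<lambda>_. borel)) borel"
    by (rule measurable_component_singleton) simp
  show ?thesis
    unfolding field_space_def by (rule measurable_restrict_space1[OF measurable_compose[OF 1 2]])
qed

lemma measurable_field_spaceI:
  assumes "\<And>\<omega>. \<omega> \<in> space M \<Longrightarrow> W \<omega> \<in> smooth_fields S k" "\<And>y i. (\<lambda>\<omega>. W \<omega> y i) \<in> borel_measurable M"
  shows "W \<in> measurable M (field_space S k)"
  unfolding field_space_def using assms
  by (intro measurable_restrict_space2 measurable_PiM_single') (auto simp: space_PiM intro!: measurable_PiM_single')

lemma smooth_fields_continuous:
  "f \<in> smooth_fields S k \<Longrightarrow> i < k \<Longrightarrow> continuous_on S (\<lambda>x. f x i)"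
  by (auto simp: smooth_fields_def intro: smooth_on_continuous)

lemma zero_count_measurable:
  assumes U: "fsigma U" "U \<subseteq> S"
  shows "(\<lambda>p. ecount {y \<in> U. snd p y = 0 \<and> (\<forall>i<k. fst p y i = 0)}) \<in>
    borel_measurable (field_space S k \<Otimes>\<^sub>M cont_space)"
proof -
  define r where "r p y = \<bar>snd p y\<bar> + (\<Sum>i<k. \<bar>fst p y i\<bar>)" for p :: "('a \<Rightarrow> nat \<Rightarrow> real) \<times> ('a \<Rightarrow> real)" and y
  have "{y \<in> U. snd p y = 0 \<and> (\<forall>i<k. fst p y i = 0)} = {y \<in> U. r p y = 0}" for p
    unfolding r_def by (auto simp: add_nonneg_eq_0_iff sum_nonneg sum_nonneg_eq_0_iff)
  moreover have "(\<lambda>p. ecount {y \<in> U. r p y = 0}) \<in> borel_measurable (field_space S k \<Otimes>\<^sub>M cont_space)"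
  proof (rule borel_measurable_ecount_zeros[OF U(1)])
    fix p :: "('a \<Rightarrow> nat \<Rightarrow> real) \<times> ('a \<Rightarrow> real)"
    assume "p \<in> space (field_space S k \<Otimes>\<^sub>M cont_space)"
    then have fsp: "fst p \<in> smooth_fields S k" "continuous_on UNIV (snd p)"
      by (auto simp: space_pair_measure space_field_space space_cont_space)
    have "continuous_on U (\<lambda>y. fst p y i)" if "i < k" for i
      using U(2) smooth_fields_continuous[OF fsp(1) that] by (auto intro: continuous_on_subset)
    moreover have "continuous_on U (snd p)"
      using fsp(2) by (rule continuous_on_subset) simp
    ultimately show "continuous_on U (r p)"
      unfolding r_def by (intro continuous_intros) auto
  next
    fix y
    have "(\<lambda>p. fst p y i) \<in> borel_measurable (field_space S k \<Otimes>\<^sub>M cont_space)" for i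
      by (rule measurable_compose[OF measurable_fst field_space_eval])
    moreover have "(\<lambda>p. snd p y) \<in> borel_measurable (field_space S k \<Otimes>\<^sub>M cont_space)"
      by (rule measurable_compose[OF measurable_snd cont_space_eval])
    ultimately show "(\<lambda>p. r p y) \<in> borel_measurable (field_space S k \<Otimes>\<^sub>M cont_space)"
      unfolding r_def by (intro borel_measurable_add borel_measurable_abs borel_measurable_sum)
  qed
  ultimately show ?thesis by simp
qed

text \<open>Independence is given between W and the field \<open>E\<close>, not its coefficients.
  The count is therefore first treated as a function of the pair of fields; only afterwards are the
  laws rewritten, that of \<open>E\<close> through the Gaussian coefficients and that of W through
  coordinates in the basis \<open>b\<close>.\<close>

lemma expected_zeros_eq:
  fixes h :: "'k \<Rightarrow> 'a::euclidean_space \<Rightarrow> real" and X :: "'k \<Rightarrow> 'w \<Rightarrow> real"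
  assumes M: "prob_space M" and U: "fsigma U" "U \<subseteq> S" and K: "finite K"
    and h: "\<And>k. k \<in> K \<Longrightarrow> continuous_on UNIV (h k)"
    and Wc: "\<And>c. (\<Sum>i<d. fscale (c i) (b i)) \<in> smooth_fields S n"
    and dist: "distributed M (lebesgue_span S n d b) W F"
    and indep: "indep_rv M (field_space S n) W (PiM UNIV (\<lambda>_. borel)) E"
    and E: "\<And>\<omega> y. E \<omega> y = (\<Sum>k\<in>K. X k \<omega> * h k y)"
    and X: "\<And>k. k \<in> K \<Longrightarrow> X k \<in> borel_measurable M"
    and law: "distr M (PiM K (\<lambda>_. borel)) (\<lambda>\<omega>. \<lambda>k\<in>K. X k \<omega>) = PiM K (\<lambda>_. std_normal)"
  shows "expected_zeros M E n W U = (\<integral>\<^sup>+c. F (\<Sum>i<d. fscale (c i) (b i)) *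
    (\<integral>\<^sup>+x. ecount {y \<in> U. (\<Sum>k\<in>K. x k * h k y) = 0 \<and> (\<forall>j<n. (\<Sum>i<d. c i * b i y j) = 0)} \<partial>PiM K (\<lambda>_. std_normal))
    \<partial>lborel_PiM {..<d})"
proof -
  let ?FS = "field_space S n"
  let ?Wc = "\<lambda>c. \<Sum>i<d. fscale (c i) (b i)"
  let ?e = "\<lambda>x y. \<Sum>k\<in>K. x k * h k y"
  define \<Psi> where "\<Psi> p = ecount {y \<in> U. snd p y = 0 \<and> (\<forall>i<n. fst p y i = 0)}" for p :: "('a \<Rightarrow> nat \<Rightarrow> real) \<times> ('a \<Rightarrow> real)"
  have \<Psi>: "\<Psi> \<in> borel_measurable (?FS \<Otimes>\<^sub>M cont_space)"
    unfolding \<Psi>_def by (rule zero_count_measurable[OF U])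
  interpret M: prob_space M by fact
  have WM: "W \<in> measurable M ?FS" and EM: "E \<in> measurable M (PiM UNIV (\<lambda>_. borel))"
    and ind: "M.indep_set {W -` B \<inter> space M | B. B \<in> sets ?FS} {E -` C \<inter> space M | C. C \<in> sets (PiM UNIV (\<lambda>_. borel))}"
    using indep by (auto simp: indep_rv_def)
  have cont_e: "continuous_on UNIV (?e x)" for x by (intro continuous_intros h)
  have E_e: "E \<omega> = ?e (\<lambda>k. X k \<omega>)" for \<omega> by (auto simp: E)
  have EC: "E \<in> measurable M cont_space"
    unfolding cont_space_def using EM cont_e E_e by (intro measurable_restrict_space2) auto
  have e_meas: "?e \<in> measurable (PiM K (\<lambda>_. borel)) cont_space"
    using cont_e by (intro measurable_cont_spaceI) measurable
  have X_meas: "(\<lambda>\<omega>. \<lambda>k\<in>K. X k \<omega>) \<in> measurable M (PiM K (\<lambda>_. borel))"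
    using X by (intro measurable_restrict) auto
  have "expected_zeros M E n W U = (\<integral>\<^sup>+\<omega>. \<Psi> (W \<omega>, E \<omega>) \<partial>M)"
    unfolding expected_zeros_def \<Psi>_def common_zeros_def
    by (intro nn_integral_cong arg_cong[where f = ecount]) auto
  also have "\<dots> = (\<integral>\<^sup>+f. \<integral>\<^sup>+e. \<Psi> (f, e) \<partial>distr M cont_space E \<partial>distr M ?FS W)"
  proof (rule nn_integral_indep_pair[OF M WM EC _ \<Psi>])
    fix B C assume B: "B \<in> sets ?FS" and "C \<in> sets (cont_space :: ('a \<Rightarrow> real) measure)"
    then obtain C' where C': "C' \<in> sets (PiM UNIV (\<lambda>_. borel))" "C = {e. continuous_on UNIV e} \<inter> C'"
      by (auto simp: cont_space_def sets_restrict_space)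
    \<comment> \<open>Every path of \<open>E\<close> is continuous, so events of the restricted
      space are events of the full product space, for which the independence is assumed.\<close>
    have "E -` C \<inter> space M = E -` C' \<inter> space M"
      using cont_e E_e C'(2) by auto
    then show "measure M ((W -` B \<inter> space M) \<inter> (E -` C \<inter> space M)) =
        measure M (W -` B \<inter> space M) * measure M (E -` C \<inter> space M)"
      using M.indep_setD[OF ind, of "W -` B \<inter> space M" "E -` C' \<inter> space M"] B C'(1) by auto
  qed
  also have "\<dots> = (\<integral>\<^sup>+f. (\<integral>\<^sup>+x. \<Psi> (f, ?e x) \<partial>PiM K (\<lambda>_. std_normal)) \<partial>distr M ?FS W)"
  proof (rule nn_integral_cong)
    fix f assume "f \<in> space (distr M ?FS W)"
    then have f: "f \<in> space ?FS" by simp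
    have \<Psi>f: "(\<lambda>e. \<Psi> (f, e)) \<in> borel_measurable cont_space"
      using measurable_compose[OF measurable_Pair1'[OF f] \<Psi>] .
    have \<Psi>e: "(\<lambda>x. \<Psi> (f, ?e x)) \<in> borel_measurable (PiM K (\<lambda>_. borel))"
      using measurable_compose[OF e_meas \<Psi>f] .
    have "(\<integral>\<^sup>+e. \<Psi> (f, e) \<partial>distr M cont_space E) = (\<integral>\<^sup>+\<omega>. \<Psi> (f, E \<omega>) \<partial>M)"
      by (rule nn_integral_distr'[OF EC \<Psi>f])
    also have "\<dots> = (\<integral>\<^sup>+\<omega>. \<Psi> (f, ?e (\<lambda>k\<in>K. X k \<omega>)) \<partial>M)"
      by (intro nn_integral_cong arg_cong[where f = \<Psi>]) (auto simp: E_e)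
    also have "\<dots> = (\<integral>\<^sup>+x. \<Psi> (f, ?e x) \<partial>distr M (PiM K (\<lambda>_. borel)) (\<lambda>\<omega>. \<lambda>k\<in>K. X k \<omega>))"
      by (rule nn_integral_distr'[OF X_meas \<Psi>e, symmetric])
    finally show "(\<integral>\<^sup>+e. \<Psi> (f, e) \<partial>distr M cont_space E) = (\<integral>\<^sup>+x. \<Psi> (f, ?e x) \<partial>PiM K (\<lambda>_. std_normal))"
      unfolding law .
  qed
  also have "distr M ?FS W = density (lebesgue_span S n d b) F"
  proof -
    have "distr M ?FS W = distr M (lebesgue_span S n d b) W"
      by (rule distr_cong) (auto simp: lebesgue_span_def)
    then show ?thesis using dist by (simp add: distributed_def)
  qed
  also have "(\<integral>\<^sup>+f. (\<integral>\<^sup>+x. \<Psi> (f, ?e x) \<partial>PiM K (\<lambda>_. std_normal)) \<partial>density (lebesgue_span S n d b) F) =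
      (\<integral>\<^sup>+c. F (?Wc c) * (\<integral>\<^sup>+x. \<Psi> (?Wc c, ?e x) \<partial>PiM K (\<lambda>_. std_normal)) \<partial>lborel_PiM {..<d})"
  proof -
    interpret PN: product_sigma_finite "\<lambda>_ :: 'k. std_normal"
      by (intro product_sigma_finite.intro prob_space_imp_sigma_finite prob_space_std_normal)
    interpret KN: sigma_finite_measure "PiM K (\<lambda>_. std_normal)" by (rule PN.sigma_finite[OF K])
    have F: "F \<in> borel_measurable (lebesgue_span S n d b)" using dist by (simp add: distributed_def)
    then have F': "F \<in> borel_measurable ?FS" by (simp add: lebesgue_span_def)
    have e_meas': "?e \<in> measurable (PiM K (\<lambda>_. std_normal)) cont_space"
      using e_meas by (simp cong: measurable_cong_sets sets_PiM_cong)
    have "(\<lambda>p. (fst p, ?e (snd p))) \<in> measurable (?FS \<Otimes>\<^sub>M PiM K (\<lambda>_. std_normal)) (?FS \<Otimes>\<^sub>M cont_space)"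
      using measurable_compose[OF measurable_snd e_meas'] by (intro measurable_Pair measurable_fst)
    from measurable_compose[OF this \<Psi>]
    have int_meas: "(\<lambda>f. \<integral>\<^sup>+x. \<Psi> (f, ?e x) \<partial>PiM K (\<lambda>_. std_normal)) \<in> borel_measurable ?FS"
      by (intro KN.borel_measurable_nn_integral) (simp add: case_prod_unfold)
    have Wc_meas: "?Wc \<in> measurable (lborel_PiM {..<d}) ?FS"
      by (intro measurable_field_spaceI Wc) (unfold fscale_sum_apply,
        intro borel_measurable_sum borel_measurable_times borel_measurable_const, measurable)
    note FI = borel_measurable_times_ennreal[OF F' int_meas]
    have "(\<integral>\<^sup>+f. (\<integral>\<^sup>+x. \<Psi> (f, ?e x) \<partial>PiM K (\<lambda>_. std_normal)) \<partial>density (lebesgue_span S n d b) F) =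
        (\<integral>\<^sup>+f. F f * (\<integral>\<^sup>+x. \<Psi> (f, ?e x) \<partial>PiM K (\<lambda>_. std_normal)) \<partial>lebesgue_span S n d b)"
      using F int_meas
      by (intro nn_integral_density) (simp_all add: lebesgue_span_def)
    also have "(\<integral>\<^sup>+f. F f * (\<integral>\<^sup>+x. \<Psi> (f, ?e x) \<partial>PiM K (\<lambda>_. std_normal)) \<partial>lebesgue_span S n d b) =
        (\<integral>\<^sup>+c. F (?Wc c) * (\<integral>\<^sup>+x. \<Psi> (?Wc c, ?e x) \<partial>PiM K (\<lambda>_. std_normal)) \<partial>lborel_PiM {..<d})"
      unfolding lebesgue_span_def by (rule nn_integral_distr'[OF Wc_meas FI])
    finally show ?thesis .
  qed
  finally show ?thesis
    by (simp only: \<Psi>_def fst_conv snd_conv fscale_sum_apply)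
qed

lemma (in prob_space) distr_std_normal_family:
  assumes ind: "indep_vars (\<lambda>_. borel) X K" and K: "finite K" "K \<noteq> {}"
    and dist: "\<And>k. k \<in> K \<Longrightarrow> distributed M lborel (X k) (\<lambda>r. ennreal (std_normal_density r))"
  shows "distr M (PiM K (\<lambda>_. borel)) (\<lambda>\<omega>. \<lambda>k\<in>K. X k \<omega>) = PiM K (\<lambda>_. std_normal)"
proof -
  have X: "X k \<in> borel_measurable M" if "k \<in> K" for k
    using dist[OF that] by (simp add: distributed_def)
  have "distr M (PiM K (\<lambda>_. borel)) (\<lambda>\<omega>. \<lambda>k\<in>K. X k \<omega>) = PiM K (\<lambda>k. distr M borel (X k))"
    using ind X K(2) by (subst (asm) indep_vars_iff_distr_eq_PiM') auto
  also have "\<dots> = PiM K (\<lambda>_. std_normal)"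
  proof (rule PiM_cong)
    fix k assume "k \<in> K"
    have "distr M borel (X k) = distr M lborel (X k)" by (rule distr_cong) auto
    then show "distr M borel (X k) = std_normal"
      using dist[OF \<open>k \<in> K\<close>] by (simp add: distributed_def std_normal_def)
  qed simp
  finally show ?thesis .
qed

text \<open>Far out the growth hypothesis applies, as the scalar product norm is the Euclidean norm
  of the coordinates; on the remaining ball the density is bounded by continuity and compactness.
  Both cases are absorbed into one constant times a power of \<open>wt\<close>.\<close>

lemma admissible_density_bound:
  fixes G :: "('a \<Rightarrow> nat \<Rightarrow> real) set"
  assumes sub: "module.subspace fscale G" and sp: "scalar_product_on G ip"
    and onb: "orthonormal_basis_of G ip d b"
    and cont: "\<forall>f\<in>G. \<forall>e>0. \<exists>\<delta>>0. \<forall>g\<in>G. ip_norm ip (g - f) < \<delta> \<longrightarrow> \<bar>\<rho> g - \<rho> f\<bar> < e"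
    and \<beta>: "real d < \<beta>"
    and bigo: "\<rho> \<in> O[inf (filtercomap (ip_norm ip) at_top) (principal G)](\<lambda>f. ip_norm ip f powr (- \<beta>))"
  shows "\<exists>C\<ge>0. \<forall>c. \<rho> (\<Sum>i<d. fscale (c i) (b i)) \<le> C * wt {..<d} c powr - \<beta>"
proof -
  let ?W = "\<lambda>c. \<Sum>i<d. fscale (c i) (b i)"
  have b: "b i \<in> G" if "i < d" for i using onb that by (simp add: orthonormal_basis_of_def)
  have orth: "ip (b i) (b j) = (if i = j then 1 else 0)" if "i < d" "j < d" for i j
    using onb that by (simp add: orthonormal_basis_of_def)
  have sym: "ip f g = ip g f" if "f \<in> G" "g \<in> G" for f g
    using sp that by (simp add: scalar_product_on_def)
  have add: "ip (f + g) h = ip f h + ip g h" if "f \<in> G" "g \<in> G" "h \<in> G" for f g h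
    using sp that by (simp add: scalar_product_on_def)
  have scale: "ip (fscale c f) g = c * ip f g" if "f \<in> G" "g \<in> G" for c f g
    using sp that by (simp add: scalar_product_on_def)
  have sc: "fscale c f \<in> G" if "f \<in> G" for c f
    by (rule module.subspace_scale[OF module_fscale sub that])
  have sumG: "(\<Sum>i\<in>F. fscale (c i) (b i)) \<in> G" if "F \<subseteq> {..<d}" for c F
    using that b sc by (intro module.subspace_sum[OF module_fscale sub]) auto
  have WG: "?W c \<in> G" for c by (rule sumG) simp
  have lin: "ip (\<Sum>i\<in>F. fscale (c i) (b i)) h = (\<Sum>i\<in>F. c i * ip (b i) h)"
    if F: "finite F" "F \<subseteq> {..<d}" and hG: "h \<in> G" for F c h
    using F
  proof (induction F rule: finite_induct)
    case empty
    have "fscale 0 h = 0" by (simp add: fscale_def fun_eq_iff)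
    then have "ip 0 h = 0" using scale[OF hG hG, of 0] by simp
    then show ?case by (simp add: zero_fun_def)
  next
    case (insert i F)
    then have "i < d" "F \<subseteq> {..<d}" by simp_all
    have "(\<Sum>i\<in>insert i F. fscale (c i) (b i)) = fscale (c i) (b i) + (\<Sum>i\<in>F. fscale (c i) (b i))"
      using insert.hyps by (rule sum.insert)
    then have "ip (\<Sum>i\<in>insert i F. fscale (c i) (b i)) h = c i * ip (b i) h + (\<Sum>i\<in>F. c i * ip (b i) h)"
      using insert.IH[OF \<open>F \<subseteq> {..<d}\<close>]
      by (simp only: add[OF sc[OF b[OF \<open>i < d\<close>]] sumG[OF \<open>F \<subseteq> {..<d}\<close>] hG] scale[OF b[OF \<open>i < d\<close>] hG])
    then show ?case by (simp only: sum.insert[OF insert.hyps])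
  qed
  have ipW: "ip (?W c) (?W c) = (\<Sum>i<d. (c i)\<^sup>2)" for c
  proof -
    have "ip (?W c) (?W c) = (\<Sum>i<d. c i * ip (b i) (?W c))"
      using lin[of "{..<d}" "?W c" c] WG by simp
    also have "\<dots> = (\<Sum>i<d. c i * ip (?W c) (b i))"
      using sym[OF b WG] by (intro sum.cong) auto
    also have "\<dots> = (\<Sum>i<d. c i * (\<Sum>j<d. c j * ip (b j) (b i)))"
      using lin[of "{..<d}"] b by (intro sum.cong) auto
    also have "\<dots> = (\<Sum>i<d. c i * c i)"
    proof (intro sum.cong refl arg_cong2[where f = "(*)"])
      fix i assume i: "i \<in> {..<d}"
      have "(\<Sum>j<d. c j * ip (b j) (b i)) = (\<Sum>j<d. if j = i then c j else 0)"
        using i by (intro sum.cong) (auto simp: orth)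
      then show "(\<Sum>j<d. c j * ip (b j) (b i)) = c i" using i by simp
    qed
    finally show ?thesis by (simp add: power2_eq_square)
  qed
  have norm: "ip_norm ip (?W c) = L2_set c {..<d}" for c
    by (simp add: ip_norm_def ipW L2_set_def)
  have diff: "?W c' - ?W c = ?W (\<lambda>i. c' i - c i)" for c c'
    by (simp add: fun_eq_iff fscale_sum_apply left_diff_distrib sum_subtractf)
  have abs_le: "\<bar>c i\<bar> \<le> L2_set c {..<d}" if "i < d" for c i
  proof -
    have "(c i)\<^sup>2 \<le> (\<Sum>i<d. (c i)\<^sup>2)" using that by (intro member_le_sum) auto
    then have "sqrt ((c i)\<^sup>2) \<le> L2_set c {..<d}" unfolding L2_set_def by (rule real_sqrt_le_mono)
    then show ?thesis by simp
  qed
  have wt_le: "wt {..<d} c \<le> 1 + real d * L2_set c {..<d}" for c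
  proof -
    have "(\<Sum>i<d. \<bar>c i\<bar>) \<le> (\<Sum>i<d. L2_set c {..<d})" by (intro sum_mono abs_le) simp
    then show ?thesis by (simp add: wt_def)
  qed
  have \<beta>0: "0 < \<beta>" using \<beta> by linarith
  obtain C0 where C0: "0 < C0" "eventually (\<lambda>f. norm (\<rho> f) \<le> C0 * norm (ip_norm ip f powr (- \<beta>)))
      (inf (filtercomap (ip_norm ip) at_top) (principal G))"
    using landau_o.bigE[OF bigo] by blast
  then have "eventually (\<lambda>f. f \<in> G \<longrightarrow> norm (\<rho> f) \<le> C0 * norm (ip_norm ip f powr (- \<beta>)))
      (filtercomap (ip_norm ip) at_top)"
    by (simp add: eventually_inf_principal)
  then obtain R0 where R0: "\<And>f. f \<in> G \<Longrightarrow> R0 \<le> ip_norm ip f \<Longrightarrow> \<rho> f \<le> C0 * ip_norm ip f powr (- \<beta>)"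
    unfolding eventually_filtercomap_at_top_linorder by (auto simp: abs_le_iff)
  define R where "R = max R0 1"
  \<comment> \<open>The cube is placed in the space of sequences, with coordinates 0 from
    \<open>d\<close> on, so that it is compact for the product topology.\<close>
  define Z where "Z = (PiE UNIV (\<lambda>i. if i < d then {-R..R} else {0}) :: (nat \<Rightarrow> real) set)"
  have "compactin (product_topology (\<lambda>_. euclidean) UNIV) Z"
    unfolding Z_def compactin_PiE by auto
  then have Z: "compact Z" by (simp add: euclidean_product_topology)
  have "\<exists>B0. \<forall>c\<in>Z. \<rho> (?W c) \<le> B0"
  proof -
    have "\<exists>\<delta>>0. \<forall>g\<in>G. ip_norm ip (g - ?W c) < \<delta> \<longrightarrow> \<bar>\<rho> g - \<rho> (?W c)\<bar> < 1" for c
      using cont WG[of c] by auto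
    then have "\<exists>\<delta>. \<forall>c. 0 < \<delta> c \<and> (\<forall>g\<in>G. ip_norm ip (g - ?W c) < \<delta> c \<longrightarrow> \<bar>\<rho> g - \<rho> (?W c)\<bar> < 1)"
      by (intro choice allI)
    then obtain \<delta> where \<delta>': "\<forall>c. 0 < \<delta> c \<and> (\<forall>g\<in>G. ip_norm ip (g - ?W c) < \<delta> c \<longrightarrow> \<bar>\<rho> g - \<rho> (?W c)\<bar> < 1)" ..
    have \<delta>: "0 < \<delta> c" "g \<in> G \<Longrightarrow> ip_norm ip (g - ?W c) < \<delta> c \<Longrightarrow> \<bar>\<rho> g - \<rho> (?W c)\<bar> < 1" for c g
      using \<delta>'[rule_format, of c] by blast+
    \<comment> \<open>Sums of absolute differences are continuous for the product topology and
      dominate the Euclidean distance, which links these open sets to the continuity of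
      \<open>\<rho>\<close> in the scalar product norm.\<close>
    define V where "V c = {c' :: nat \<Rightarrow> real. (\<Sum>i<d. \<bar>c' i - c i\<bar>) < \<delta> c}" for c
    have V: "open (V c)" if "c \<in> Z" for c
      unfolding V_def by (intro open_Collect_less continuous_intros continuous_on_product_coordinates)
    have "c \<in> V c" for c using \<delta>(1) by (simp add: V_def)
    then have ZV: "Z \<subseteq> (\<Union>c\<in>Z. V c)" by blast
    obtain F where F: "F \<subseteq> Z" "finite F" "Z \<subseteq> (\<Union>c\<in>F. V c)"
      by (rule compactE_image[OF Z V ZV]) (assumption, rule that)
    have "\<rho> (?W c) \<le> (\<Sum>c'\<in>F. \<bar>\<rho> (?W c')\<bar> + 1)" if cZ: "c \<in> Z" for c
    proof -
      obtain c' where c': "c' \<in> F" "c \<in> V c'" using F(3) cZ by auto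
      have "ip_norm ip (?W c - ?W c') \<le> (\<Sum>i<d. \<bar>c i - c' i\<bar>)"
        unfolding diff norm by (rule L2_set_le_sum_abs)
      also have "\<dots> < \<delta> c'" using c'(2) by (simp add: V_def)
      finally have "\<rho> (?W c) \<le> \<bar>\<rho> (?W c')\<bar> + 1" using \<delta>(2)[OF WG[of c], of c'] by linarith
      also have "\<dots> \<le> (\<Sum>c'\<in>F. \<bar>\<rho> (?W c')\<bar> + 1)"
        using F(2) c'(1) by (intro member_le_sum) auto
      finally show ?thesis .
    qed
    then show ?thesis by blast
  qed
  then obtain B0 where B0: "\<And>c. c \<in> Z \<Longrightarrow> \<rho> (?W c) \<le> B0" by blast
  \<comment> \<open>The first term serves where the norm is at least \<open>R\<close>, with
    \<open>wt\<close> at most \<open>1 + d\<close> times the norm because \<open>R\<close> is at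
    least 1; the second serves inside, where \<open>wt\<close> is at most
    \<open>1 + d * R\<close>.\<close>
  define C where "C = C0 * (1 + real d) powr \<beta> + \<bar>B0\<bar> * (1 + real d * R) powr \<beta>"
  have "\<rho> (?W c) \<le> C * wt {..<d} c powr - \<beta>" for c
  proof (cases "R \<le> L2_set c {..<d}")
    case True
    let ?n = "L2_set c {..<d}"
    have n1: "1 \<le> ?n" using True by (simp add: R_def)
    have "wt {..<d} c \<le> (1 + real d) * ?n" using wt_le[of c] n1 by (simp add: algebra_simps)
    then have "((1 + real d) * ?n) powr - \<beta> \<le> wt {..<d} c powr - \<beta>"
      using wt_pos \<beta>0 by (intro powr_mono2') auto
    then have "(1 + real d) powr \<beta> * ((1 + real d) * ?n) powr - \<beta> \<le> (1 + real d) powr \<beta> * wt {..<d} c powr - \<beta>"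
      by (intro mult_left_mono) auto
    moreover have "((1 + real d) * ?n) powr - \<beta> = (1 + real d) powr - \<beta> * ?n powr - \<beta>"
      using n1 by (intro powr_mult)
    moreover have "(1 + real d) powr \<beta> * (1 + real d) powr - \<beta> = 1"
      by (simp add: powr_add[symmetric])
    ultimately have "?n powr - \<beta> \<le> (1 + real d) powr \<beta> * wt {..<d} c powr - \<beta>"
      by (simp only: mult.assoc[symmetric] mult_1)
    then have "C0 * ?n powr - \<beta> \<le> C0 * (1 + real d) powr \<beta> * wt {..<d} c powr - \<beta>"
      using C0(1) by simp
    moreover have "\<rho> (?W c) \<le> C0 * ?n powr - \<beta>"
      using R0[OF WG, of c] True by (simp add: norm R_def)
    moreover have "0 \<le> \<bar>B0\<bar> * (1 + real d * R) powr \<beta> * wt {..<d} c powr - \<beta>" by simp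
    ultimately show ?thesis unfolding C_def distrib_right by linarith
  next
    case False
    \<comment> \<open>Truncation puts the coordinates into the compact cube without changing the
      field they represent.\<close>
    define c' where "c' i = (if i < d then c i else 0)" for i
    have "\<bar>c i\<bar> \<le> R" if "i < d" for i using abs_le[OF that, of c] False by linarith
    then have "c' \<in> Z" by (auto simp: Z_def c'_def abs_le_iff minus_le_iff)
    moreover have "?W c' = ?W c" by (intro sum.cong) (auto simp: c'_def)
    ultimately have "\<rho> (?W c) \<le> \<bar>B0\<bar>" using B0[of c'] by simp
    moreover have "\<bar>B0\<bar> \<le> \<bar>B0\<bar> * ((1 + real d * R) powr \<beta> * wt {..<d} c powr - \<beta>)"
    proof -
      have "real d * L2_set c {..<d} \<le> real d * R" using False by (intro mult_left_mono) auto
      then have "wt {..<d} c \<le> 1 + real d * R" using wt_le[of c] by linarith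
      then have "(1 + real d * R) powr - \<beta> \<le> wt {..<d} c powr - \<beta>"
        using wt_pos \<beta>0 by (intro powr_mono2') auto
      moreover have "0 < 1 + real d * R" by (simp add: R_def add_pos_nonneg)
      ultimately have "1 \<le> (1 + real d * R) powr \<beta> * wt {..<d} c powr - \<beta>"
        by (simp add: powr_minus field_simps)
      then show ?thesis by (simp add: mult_le_cancel_left1)
    qed
    moreover have "0 \<le> C0 * (1 + real d) powr \<beta> * wt {..<d} c powr - \<beta>" using C0(1) by simp
    ultimately show ?thesis unfolding C_def distrib_right by (simp add: mult.assoc)
  qed
  moreover have "0 \<le> C" unfolding C_def using C0(1) by simp
  ultimately show ?thesis by blast
qed

section \<open>Independent copies\<close>

lemma product_sigma_finite_std_normal: "product_sigma_finite (\<lambda>_. std_normal)"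
  by (intro product_sigma_finite.intro prob_space_imp_sigma_finite prob_space_std_normal)

text \<open>A box for the doubly indexed family is a product over the copies of events of a single
  copy; evaluating the copies one by one gives the product of the normal probabilities.\<close>

lemma distr_iid_std_normal_family:
  fixes X :: "'k \<Rightarrow> 'w \<Rightarrow> real"
  assumes M: "prob_space M" and K: "finite K" and X: "\<And>k. k \<in> K \<Longrightarrow> X k \<in> borel_measurable M"
    and law: "distr M (PiM K (\<lambda>_. borel)) (\<lambda>\<omega>. \<lambda>k\<in>K. X k \<omega>) = PiM K (\<lambda>_. std_normal)"
  shows "distr (PiM {..<n :: nat} (\<lambda>_. M)) (PiM ({..<n} \<times> K) (\<lambda>_. borel)) (\<lambda>\<omega>. \<lambda>p\<in>{..<n} \<times> K. X (snd p) (\<omega> (fst p))) =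
    PiM ({..<n} \<times> K) (\<lambda>_. std_normal)"
proof (rule product_sigma_finite.PiM_eqI[OF product_sigma_finite_std_normal])
  let ?Z = "\<lambda>\<omega>. \<lambda>p\<in>{..<n} \<times> K. X (snd p) (\<omega> (fst p))"
  let ?P = "PiM {..<n} (\<lambda>_. M)"
  interpret PN: product_sigma_finite "\<lambda>_ :: 'k. std_normal" by (rule product_sigma_finite_std_normal)
  interpret PM: product_sigma_finite "\<lambda>_ :: nat. M"
    by (intro product_sigma_finite.intro prob_space_imp_sigma_finite M)
  show "finite ({..<n} \<times> K)" using K by simp
  show "sets (distr ?P (PiM ({..<n} \<times> K) (\<lambda>_. borel)) ?Z) = sets (PiM ({..<n} \<times> K) (\<lambda>_. std_normal))"
    by (simp cong: sets_PiM_cong)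
  fix B :: "nat \<times> 'k \<Rightarrow> real set" assume "\<And>p. p \<in> {..<n} \<times> K \<Longrightarrow> B p \<in> sets std_normal"
  then have B: "\<And>i k. i < n \<Longrightarrow> k \<in> K \<Longrightarrow> B (i, k) \<in> sets borel" by simp
  have X_meas: "(\<lambda>\<omega>. \<lambda>k\<in>K. X k \<omega>) \<in> measurable M (PiM K (\<lambda>_. borel))"
    using X by (intro measurable_restrict) auto
  have Z: "?Z \<in> measurable ?P (PiM ({..<n} \<times> K) (\<lambda>_. borel))"
  proof (rule measurable_restrict)
    fix p assume p: "p \<in> {..<n} \<times> K"
    have "(\<lambda>\<omega>. \<omega> (fst p)) \<in> measurable ?P M"
      by (rule measurable_component_singleton) (use p in auto)
    moreover have "X (snd p) \<in> borel_measurable M" using p by (intro X) auto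
    ultimately show "(\<lambda>\<omega>. X (snd p) (\<omega> (fst p))) \<in> borel_measurable ?P"
      by (rule measurable_compose)
  qed
  define C where "C i = (\<lambda>\<omega>. \<lambda>k\<in>K. X k \<omega>) -` (Pi\<^sub>E K (\<lambda>k. B (i, k))) \<inter> space M" for i
  have box: "Pi\<^sub>E K (\<lambda>k. B (i, k)) \<in> sets (PiM K (\<lambda>_. borel))" if "i < n" for i
    using B[OF that] K by (intro sets_PiM_I_finite) auto
  have C: "C i \<in> sets M" if "i < n" for i
    unfolding C_def by (rule measurable_sets[OF X_meas box[OF that]])
  have pre: "?Z -` Pi\<^sub>E ({..<n} \<times> K) B \<inter> space ?P = Pi\<^sub>E {..<n} C"
  proof -
    have "C i = {w \<in> space M. \<forall>k\<in>K. X k w \<in> B (i, k)}" for i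
      unfolding C_def vimage_def restrict_PiE_iff by auto
    moreover have "?Z -` Pi\<^sub>E ({..<n} \<times> K) B = {\<omega>. \<forall>i<n. \<forall>k\<in>K. X k (\<omega> i) \<in> B (i, k)}"
      unfolding vimage_def restrict_PiE_iff by auto
    ultimately show ?thesis by (auto simp: space_PiM PiE_iff)
  qed
  have "Pi\<^sub>E ({..<n} \<times> K) B \<in> sets (PiM ({..<n} \<times> K) (\<lambda>_. borel))"
    using B K by (intro sets_PiM_I_finite) auto
  then have "emeasure (distr ?P (PiM ({..<n} \<times> K) (\<lambda>_. borel)) ?Z) (Pi\<^sub>E ({..<n} \<times> K) B) = emeasure ?P (Pi\<^sub>E {..<n} C)"
    by (simp add: emeasure_distr[OF Z] pre)
  also have "\<dots> = (\<Prod>i<n. emeasure M (C i))"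
    using C by (intro PM.emeasure_PiM) auto
  also have "\<dots> = (\<Prod>i<n. \<Prod>k\<in>K. emeasure std_normal (B (i, k)))"
  proof (rule prod.cong)
    fix i assume "i \<in> {..<n}"
    then have i: "i < n" by simp
    have "emeasure M (C i) = emeasure (PiM K (\<lambda>_. std_normal)) (Pi\<^sub>E K (\<lambda>k. B (i, k)))"
      unfolding law[symmetric] C_def by (rule emeasure_distr[OF X_meas box[OF i], symmetric])
    also have "\<dots> = (\<Prod>k\<in>K. emeasure std_normal (B (i, k)))"
      using B[OF i] K by (intro PN.emeasure_PiM) auto
    finally show "emeasure M (C i) = (\<Prod>k\<in>K. emeasure std_normal (B (i, k)))" .
  qed simp
  also have "\<dots> = (\<Prod>p\<in>{..<n} \<times> K. emeasure std_normal (B p))"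
    by (simp add: prod.cartesian_product)
  finally show "emeasure (distr ?P (PiM ({..<n} \<times> K) (\<lambda>_. borel)) ?Z) (Pi\<^sub>E ({..<n} \<times> K) B) =
    (\<Prod>p\<in>{..<n} \<times> K. emeasure std_normal (B p))" .
qed

context exp_setting
begin

abbreviation "AN \<equiv> insert None (Some ` A)"

text \<open>The copies with index below \<open>j\<close> contain the additional term, the others do not; raising \<open>j\<close> by one
  changes a single copy, the remaining ones playing the role of \<open>W\<close>.\<close>

definition "hyb_field j z i y = (\<Sum>a\<in>A. z (i, Some a) * gexp a y) + (if i < j then z (i, None) else 0)"
  for j i :: nat and z :: "nat \<times> (real^'m) option \<Rightarrow> real"

definition "hyb n U j =
  (\<integral>\<^sup>+z. ecount {y \<in> U. \<forall>i<n. hyb_field j z i y = 0} \<partial>PiM ({..<n} \<times> AN) (\<lambda>_. std_normal))"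

lemma hyb_measurable:
  assumes "fsigma U"
  shows "(\<lambda>z. ecount {y \<in> U. \<forall>i<n. hyb_field j z i y = 0}) \<in> borel_measurable (PiM ({..<n} \<times> AN) (\<lambda>_. borel))"
proof -
  define r where "r z y = (\<Sum>i<n. \<bar>hyb_field j z i y\<bar>)" for z y
  have "{y \<in> U. \<forall>i<n. hyb_field j z i y = 0} = {y \<in> U. r z y = 0}" for z
    unfolding r_def by (auto simp: sum_nonneg_eq_0_iff)
  moreover have "(\<lambda>z. ecount {y \<in> U. r z y = 0}) \<in> borel_measurable (PiM ({..<n} \<times> AN) (\<lambda>_. borel))"
  proof (rule borel_measurable_ecount_zeros[OF assms])
    show "continuous_on U (r z)" for z
      unfolding r_def hyb_field_def by (intro continuous_intros C1_on_continuous C1_gexp)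
    show "(\<lambda>z. r z y) \<in> borel_measurable (PiM ({..<n} \<times> AN) (\<lambda>_. borel))" for y
    proof -
      have "(\<lambda>z. hyb_field j z i y) \<in> borel_measurable (PiM ({..<n} \<times> AN) (\<lambda>_. borel))" if "i < n" for i
      proof -
        have 1: "(\<lambda>z. z (i, k)) \<in> borel_measurable (PiM ({..<n} \<times> AN) (\<lambda>_. borel))" if "k \<in> AN" for k
          using that \<open>i < n\<close> by (intro measurable_component_singleton) auto
        show ?thesis
          unfolding hyb_field_def
          by (cases "i < j") (auto intro!: borel_measurable_add borel_measurable_sum borel_measurable_times 1)
      qed
      then show ?thesis unfolding r_def by (intro borel_measurable_sum borel_measurable_abs) auto
    qed
  qed
  ultimately show ?thesis by simp
qed

text \<open>Copy \<open>j\<close> is the Gaussian field of constant variance, and the other m - 2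
  copies form the vector field, whose coefficients have the Gaussian density. Passing from
  \<open>j\<close> to \<open>Suc j\<close> adds the random level to copy \<open>j\<close> and
  changes nothing else.\<close>

lemma hyb_step:
  assumes U: "fsigma U" "U \<subseteq> S" and m: "2 \<le> CARD('m)" and n: "n = CARD('m) - 1" and j: "j < n"
  shows "hyb n U (Suc j) = tilt_factor (exp (2 * t)) * hyb n U j \<and> hyb n U j < \<infinity>"
proof -
  define Gop where "Gop k y = (case k of Some a \<Rightarrow> gexp a y | None \<Rightarrow> 1)" for k :: "(real^'m) option" and y
  \<comment> \<open>Coefficient (i, k) enters component \<open>i\<close> only. The coefficient
    \<open>None\<close> multiplies the constant 1 in copies that already contain the additional term
    and 0 in the others, so a single index set serves all stages.\<close>
  define b where "b p y j' = (if fst p = j' then (if snd p = None then (if j' < j then 1 else 0) else Gop (snd p) y) else 0)"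
    for p :: "nat \<times> (real^'m) option" and y :: "real^'m" and j' :: nat
  define K where "K = {j} \<times> Some ` A"
  define I where "I = ({..<n} - {j}) \<times> AN"
  obtain a1 where a1: "a1 \<in> A" using A_nonempty by auto
  have finI: "finite I" and finK: "finite K" using A(1) by (auto simp: I_def K_def)
  obtain C where C: "\<And>x. gauss_density I x \<le> C * wt I x powr - (real (card I) + 1)" "0 \<le> C"
    by (rule gauss_density_le_wt[OF finI, of "real (card I) + 1"]) auto
  have sumK: "(\<Sum>k\<in>K. F k) = (\<Sum>a\<in>A. F (j, Some a))" for F :: "nat \<times> (real^'m) option \<Rightarrow> real"
  proof -
    have "K = (\<lambda>a. (j, Some a)) ` A" by (auto simp: K_def)
    then show ?thesis by (simp add: sum.reindex inj_on_def)
  qed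
  have sumI: "(\<Sum>p\<in>I. c p * b p y j') = (\<Sum>a\<in>A. c (j', Some a) * gexp a y) + (if j' < j then c (j', None) else 0)"
    if j': "j' \<in> {..<n} - {j}" for c y j'
  proof -
    have "(\<Sum>p\<in>I. c p * b p y j') = (\<Sum>i\<in>{..<n} - {j}. \<Sum>k\<in>AN. c (i, k) * b (i, k) y j')"
      unfolding I_def by (simp only: sum.cartesian_product case_prod_unfold prod.collapse)
    also have "\<dots> = (\<Sum>i\<in>{..<n} - {j}. if i = j' then \<Sum>k\<in>AN. c (i, k) * b (i, k) y j' else 0)"
      by (intro sum.cong) (auto simp: b_def)
    also have "\<dots> = (\<Sum>k\<in>AN. c (j', k) * b (j', k) y j')"
      using j' by (subst sum.delta) auto
    also have "\<dots> = (\<Sum>a\<in>A. c (j', Some a) * gexp a y) + (if j' < j then c (j', None) else 0)"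
      using A(1) by (subst sum.insert) (auto simp: sum.reindex b_def Gop_def)
    finally show ?thesis .
  qed
  interpret level_fields S K I "{..<n} - {j}" "\<lambda>p. Gop (snd p)" b "(j, Some a1)" "exp (2 * t)"
    "real (card I) + 1" C "\<lambda>c. ennreal (gauss_density I c)"
  proof
    show "compact S" "2 \<le> CARD('m)" "finite I" "finite K" "finite ({..<n} - {j})" "0 < exp (2 * t)" "0 \<le> C"
      using finI finK m C(2) compact_S by auto
    show "(j, Some a1) \<in> K" using a1 by (simp add: K_def)
    show "card ({..<n} - {j}) = CARD('m) - 2" using j n by (simp add: card_Diff_subset)
    show "C1_on UNIV (Gop (snd k))" if "k \<in> K" for k
      using that by (auto simp: K_def Gop_def[abs_def] intro: C1_gexp)
    show "Gop (snd (j, Some a1)) x \<noteq> 0" for x using gexp_pos[OF a1, of x] by (simp add: Gop_def)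
    have sq: "(\<Sum>k\<in>K. (Gop (snd k) x)\<^sup>2) = \<Theta> x" for x
      by (simp add: sumK Gop_def \<Theta>_def)
    show "(\<Sum>k\<in>K. (Gop (snd k) x)\<^sup>2) = exp (2 * t)" if "x \<in> S" for x using sq \<Theta>_S[OF that] by simp
    show "\<exists>l. partial l (\<lambda>x. \<Sum>k\<in>K. (Gop (snd k) x)\<^sup>2) x \<noteq> 0" if "x \<in> S" for x
      using grad_\<Theta>[OF that] by (simp add: sq)
    show "\<exists>T F. open T \<and> x \<in> T \<and> C1_on T F \<and> (\<forall>y\<in>S \<inter> T. F y = b p y j')" for p j' x
    proof (intro exI[of _ UNIV] exI[of _ "\<lambda>y. b p y j'"] conjI)
      show "C1_on UNIV (\<lambda>y. b p y j')"
        by (cases "fst p = j'"; cases "snd p") (auto simp: b_def Gop_def C1_on_const C1_gexp)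
    qed auto
    show "\<exists>c. \<forall>j'\<in>{..<n} - {j}. (\<Sum>p\<in>I. c p * b p x j') = v j'" for x v
    proof (intro exI ballI)
      fix j' assume j': "j' \<in> {..<n} - {j}"
      \<comment> \<open>The positive function belonging to \<open>a1\<close> alone can produce any
        prescribed value in each copy.\<close>
      let ?c = "\<lambda>p. if snd p = Some a1 then v (fst p) / gexp a1 x else 0"
      have "(\<Sum>a\<in>A. ?c (j', Some a) * gexp a x) = (\<Sum>a\<in>A. if a = a1 then v j' else 0)"
        using gexp_pos[OF a1, of x] by (intro sum.cong) auto
      also have "\<dots> = v j'" using a1 A(1) by simp
      finally show "(\<Sum>p\<in>I. ?c p * b p x j') = v j'" by (simp add: sumI[OF j'])
    qed
    show "(\<lambda>c. ennreal (gauss_density I c)) \<in> borel_measurable (lborel_PiM I)" by measurable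
    show "ennreal (gauss_density I c) \<le> ennreal (C * wt I c powr - (real (card I) + 1))" for c
      by (intro ennreal_leI C(1))
    show "real (card I) < real (card I) + 1" by simp
  qed
  let ?K' = "insert (j, None) K"
  have K': "?K' = {j} \<times> AN" by (auto simp: K_def)
  have split: "I \<union> ?K' = {..<n} \<times> AN" "I \<inter> ?K' = {}" using j by (auto simp: I_def K_def)
  have nK: "(j, None) \<notin> K" by (auto simp: K_def)
  interpret PN: product_sigma_finite "\<lambda>_ :: nat \<times> (real^'m) option. std_normal"
    by (rule product_sigma_finite_std_normal)
  \<comment> \<open>For the copies different from \<open>j\<close>, the conditions i < j and i < Suc
    j agree; hence only the level of copy \<open>j\<close> depends on the stage.\<close>
  have set_eq: "{y \<in> U. \<forall>i<n. hyb_field j1 (merge I ?K' (c, x)) i y = 0} =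
      zeros U (if j < j1 then x (j, None) else 0) (c, x)" if "j1 = j \<or> j1 = Suc j" for j1 c x
  proof -
    let ?z = "merge I ?K' (c, x)"
    have zj: "?z (j, k) = x (j, k)" if "k \<in> AN" for k using that by (auto simp: merge_def K' I_def)
    have zi: "?z (i, k) = c (i, k)" if "i \<in> {..<n} - {j}" "k \<in> AN" for i k using that by (auto simp: merge_def I_def)
    have "hyb_field j1 ?z j y = (\<Sum>k\<in>K. x k * Gop (snd k) y) + (if j < j1 then x (j, None) else 0)" for y
      by (auto simp: hyb_field_def sumK Gop_def zj)
    moreover have "hyb_field j1 ?z i y = (\<Sum>p\<in>I. c p * b p y i)" if i: "i \<in> {..<n} - {j}" for i y
    proof -
      have "i < j1 \<longleftrightarrow> i < j" using i \<open>j1 = j \<or> j1 = Suc j\<close> by auto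
      then show ?thesis using zi[OF i] by (simp add: hyb_field_def sumI[OF i])
    qed
    moreover have "(\<forall>i<n. P i) \<longleftrightarrow> P j \<and> (\<forall>i\<in>{..<n} - {j}. P i)" for P using j by auto
    ultimately show ?thesis unfolding zeros_def by auto
  qed
  have hyb_eq: "hyb n U j1 = (\<integral>\<^sup>+c. ennreal (gauss_density I c) *
      (\<integral>\<^sup>+x. ecount (zeros U (if j < j1 then x (j, None) else 0) (c, x)) \<partial>PiM ?K' (\<lambda>_. std_normal)) \<partial>lborel_PiM I)"
    if j1: "j1 = j \<or> j1 = Suc j" for j1
  proof -
    let ?g = "\<lambda>c. \<integral>\<^sup>+x. ecount (zeros U (if j < j1 then x (j, None) else 0) (c, x)) \<partial>PiM ?K' (\<lambda>_. std_normal)"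
    interpret KN: sigma_finite_measure "PiM ?K' (\<lambda>_. std_normal)" using finK by (intro PN.sigma_finite) auto
    have f: "(\<lambda>z. ecount {y \<in> U. \<forall>i<n. hyb_field j1 z i y = 0}) \<in> borel_measurable (PiM (I \<union> ?K') (\<lambda>_. std_normal))"
      using hyb_measurable[OF U(1)] unfolding split by (simp cong: measurable_cong_sets sets_PiM_cong)
    have "hyb n U j1 = (\<integral>\<^sup>+c. \<integral>\<^sup>+x. ecount {y \<in> U. \<forall>i<n. hyb_field j1 (merge I ?K' (c, x)) i y = 0}
        \<partial>PiM ?K' (\<lambda>_. std_normal) \<partial>PiM I (\<lambda>_. std_normal))"
      unfolding hyb_def split(1)[symmetric]
      using finI finK by (intro PN.product_nn_integral_fold[OF split(2) _ _ f]) auto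
    also have "\<dots> = (\<integral>\<^sup>+c. ?g c \<partial>PiM I (\<lambda>_. std_normal))"
      by (simp only: set_eq[OF j1])
    also have "\<dots> = (\<integral>\<^sup>+c. ennreal (gauss_density I c) * ?g c \<partial>lborel_PiM I)"
      unfolding PiM_std_normal[OF finI]
    proof (rule nn_integral_density)
      show "?g \<in> borel_measurable (lborel_PiM I)"
      proof (rule KN.borel_measurable_nn_integral)
        have "(\<lambda>p. ecount (zeros U (if j < j1 then snd p (j, None) else 0) (fst p, snd p))) \<in>
            borel_measurable (lborel_PiM I \<Otimes>\<^sub>M PiM ?K' (\<lambda>_. std_normal))"
          by (rule zeros_measurable[OF U]) measurable
        then show "(\<lambda>(c, x). ecount (zeros U (if j < j1 then x (j, None) else 0) (c, x))) \<in>
            borel_measurable (lborel_PiM I \<Otimes>\<^sub>M PiM ?K' (\<lambda>_. std_normal))"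
          by (simp add: case_prod_unfold)
      qed
    qed measurable
    finally show ?thesis .
  qed
  have "hyb n U (Suc j) = tilt_factor (exp (2 * t)) * mean_zeros U 0"
    using random_level_mean[OF U nK] by (simp add: hyb_eq)
  moreover have "hyb n U j = mean_zeros U 0"
  proof -
    \<comment> \<open>At level 0 the zeros do not depend on the coefficient (j, None), and
      integrating it out against a probability measure leaves the value unchanged.\<close>
    have "(\<integral>\<^sup>+x. ecount (zeros U 0 (c, x)) \<partial>PiM ?K' (\<lambda>_. std_normal)) =
        (\<integral>\<^sup>+x. ecount (zeros U 0 (c, x)) \<partial>PiM K (\<lambda>_. std_normal))" for c
    proof -
      have "(\<lambda>x. ecount (zeros U 0 (c, x))) \<in> borel_measurable (PiM ?K' (\<lambda>_. std_normal))"
        by (rule zeros_measurable[OF U]) measurable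
      from PN.product_nn_integral_insert_rev[OF finK nK this]
      have "(\<integral>\<^sup>+x. ecount (zeros U 0 (c, x)) \<partial>PiM ?K' (\<lambda>_. std_normal)) =
          (\<integral>\<^sup>+u. \<integral>\<^sup>+x. ecount (zeros U 0 (c, x((j, None) := u))) \<partial>PiM K (\<lambda>_. std_normal) \<partial>std_normal)" .
      moreover have "zeros U 0 (c, x((j, None) := u)) = zeros U 0 (c, x)" for u x
      proof -
        have "(\<Sum>k\<in>K. (x((j, None) := u)) k * Gop (snd k) y) = (\<Sum>k\<in>K. x k * Gop (snd k) y)" for y
          using nK by (intro sum.cong) auto
        then show ?thesis unfolding zeros_def by simp
      qed
      ultimately show ?thesis
        using prob_space.emeasure_space_1[OF prob_space_std_normal] by simp
    qed
    then show ?thesis using hyb_eq[of j] by (simp add: mean_zeros_eq[OF U])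
  qed
  ultimately show ?thesis using mean_zeros_level(2)[OF U] by simp
qed

end

section \<open>The comparison\<close>

lemma ennreal_power_less_1:
  fixes c :: ennreal
  assumes "c < 1" "0 < n" shows "c ^ n < 1"
proof -
  obtain k where k: "c = ennreal k" "0 \<le> k" using assms(1) by (cases c) auto
  then have "k < 1" using assms(1) by (simp add: ennreal_less_one_iff)
  then have "k ^ n < 1" using k(2) assms(2) by (simp add: power_less_one_iff)
  then show ?thesis using k by (simp add: ennreal_power ennreal_less_one_iff)
qed

context exp_setting
begin

definition "hfun k y = (case k of Some a \<Rightarrow> \<alpha> a * exp (a \<bullet> y) | None \<Rightarrow> \<alpha>0 * exp (a0 \<bullet> y))"

lemma continuous_hfun: "continuous_on UNIV (hfun k)"
  unfolding hfun_def by (cases k) (auto intro!: continuous_intros)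

lemma hfun_Some: "hfun (Some a) y = \<alpha>0 * exp (a0 \<bullet> y) * gexp a y"
  using \<alpha>0 by (simp add: hfun_def gexp_def inner_diff_left exp_diff)

lemma exp_sum_eq: "exp_sum A \<alpha> \<xi> \<omega> y = (\<Sum>k\<in>Some ` A. case_option \<xi>0 \<xi> k \<omega> * hfun k y)"
  by (simp add: exp_sum_def sum.reindex hfun_def mult.assoc)

lemma exp_sum0_eq: "exp_sum0 A \<alpha> \<xi> a0 \<alpha>0 \<xi>0 \<omega> y = (\<Sum>k\<in>AN. case_option \<xi>0 \<xi> k \<omega> * hfun k y)"
  using A(1) by (simp add: exp_sum0_def exp_sum_def sum.reindex hfun_def mult.assoc)

lemma exp_sum_zero_iff: "exp_sum A \<alpha> \<xi> \<omega> y = 0 \<longleftrightarrow> (\<Sum>a\<in>A. \<xi> a \<omega> * gexp a y) = 0"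
proof -
  have "exp_sum A \<alpha> \<xi> \<omega> y = \<alpha>0 * exp (a0 \<bullet> y) * (\<Sum>a\<in>A. \<xi> a \<omega> * gexp a y)"
    unfolding exp_sum_eq[of \<xi> \<omega> y undefined] by (simp add: sum.reindex hfun_Some sum_distrib_left mult_ac)
  then show ?thesis using \<alpha>0 by simp
qed

lemma exp_sum0_zero_iff:
  "exp_sum0 A \<alpha> \<xi> a0 \<alpha>0 \<xi>0 \<omega> y = 0 \<longleftrightarrow> (\<Sum>a\<in>A. \<xi> a \<omega> * gexp a y) + \<xi>0 \<omega> = 0"
proof -
  have "exp_sum0 A \<alpha> \<xi> a0 \<alpha>0 \<xi>0 \<omega> y = \<alpha>0 * exp (a0 \<bullet> y) * ((\<Sum>a\<in>A. \<xi> a \<omega> * gexp a y) + \<xi>0 \<omega>)"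
    using A(1) unfolding exp_sum0_eq
    by (simp add: sum.reindex hfun_Some sum_distrib_left distrib_left mult_ac) (simp add: hfun_def)
  then show ?thesis using \<alpha>0 by simp
qed

text \<open>Division by a positive function keeps the zeros, and the coefficients of the copies on
  the product space form a family of independent standard normal variables indexed by pairs. The two
  ends of the interpolation are thus the two expectations.\<close>

lemma iid_eq_hyb:
  assumes M: "prob_space M" and U: "fsigma U"
    and X: "\<And>k. k \<in> AN \<Longrightarrow> case_option \<xi>0 \<xi> k \<in> borel_measurable M"
    and law: "distr M (PiM AN (\<lambda>_. borel)) (\<lambda>\<omega>. \<lambda>k\<in>AN. case_option \<xi>0 \<xi> k \<omega>) = PiM AN (\<lambda>_. std_normal)"
  shows "expected_zeros_iid M n (exp_sum A \<alpha> \<xi>) U = hyb n U 0"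
    and "expected_zeros_iid M n (exp_sum0 A \<alpha> \<xi> a0 \<alpha>0 \<xi>0) U = hyb n U n"
proof -
  let ?X = "case_option \<xi>0 \<xi>"
  let ?P = "PiM {..<n} (\<lambda>_. M)"
  let ?Z = "\<lambda>\<omega>. \<lambda>p\<in>{..<n} \<times> AN. ?X (snd p) (\<omega> (fst p))"
  have finAN: "finite AN" using A(1) by simp
  have Z: "?Z \<in> measurable ?P (PiM ({..<n} \<times> AN) (\<lambda>_. borel))"
  proof (rule measurable_restrict)
    fix p assume p: "p \<in> {..<n} \<times> AN"
    have "(\<lambda>\<omega>. \<omega> (fst p)) \<in> measurable ?P M"
      by (rule measurable_component_singleton) (use p in auto)
    moreover have "?X (snd p) \<in> borel_measurable M" using p by (intro X) auto
    ultimately show "(\<lambda>\<omega>. ?X (snd p) (\<omega> (fst p))) \<in> borel_measurable ?P"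
      by (rule measurable_compose)
  qed
  have hyb: "hyb n U j = (\<integral>\<^sup>+\<omega>. ecount {y \<in> U. \<forall>i<n. hyb_field j (?Z \<omega>) i y = 0} \<partial>?P)" for j
  proof -
    have "hyb n U j = (\<integral>\<^sup>+z. ecount {y \<in> U. \<forall>i<n. hyb_field j z i y = 0} \<partial>distr ?P (PiM ({..<n} \<times> AN) (\<lambda>_. borel)) ?Z)"
      unfolding hyb_def by (subst distr_iid_std_normal_family[OF M finAN X law]) auto
    also have "\<dots> = (\<integral>\<^sup>+\<omega>. ecount {y \<in> U. \<forall>i<n. hyb_field j (?Z \<omega>) i y = 0} \<partial>?P)"
      by (rule nn_integral_distr'[OF Z hyb_measurable[OF U]])
    finally show ?thesis .
  qed
  have field: "hyb_field j (?Z \<omega>) i y = (\<Sum>a\<in>A. \<xi> a (\<omega> i) * gexp a y) + (if i < j then \<xi>0 (\<omega> i) else 0)"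
    if "i < n" for j \<omega> i y
    using that by (auto simp: hyb_field_def intro!: sum.cong)
  show "expected_zeros_iid M n (exp_sum A \<alpha> \<xi>) U = hyb n U 0"
    unfolding expected_zeros_iid_def hyb common_zeros_def
    by (intro nn_integral_cong arg_cong[where f = ecount]) (auto simp: field exp_sum_zero_iff)
  show "expected_zeros_iid M n (exp_sum0 A \<alpha> \<xi> a0 \<alpha>0 \<xi>0) U = hyb n U n"
    unfolding expected_zeros_iid_def hyb common_zeros_def
    by (intro nn_integral_cong arg_cong[where f = ecount]) (auto simp: field exp_sum0_zero_iff)
qed

lemma hyb_power:
  assumes U: "fsigma U" "U \<subseteq> S" and m: "2 \<le> CARD('m)" and n: "n = CARD('m) - 1" and j: "j \<le> n"
  shows "hyb n U j = tilt_factor (exp (2 * t)) ^ j * hyb n U 0"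
  using j
proof (induction j)
  case (Suc j)
  then show ?case using hyb_step[OF U m n, of j] by (simp add: mult.assoc)
qed simp

text \<open>In coordinates of an orthonormal basis the density of W becomes a function on a
  coefficient space with the decay required by \<open>level_fields\<close>, and surjectivity of the
  evaluations is surjectivity in these coordinates. Both expectations then are values of
  \<open>mean_zeros\<close> at level 0, one with the averaged tilt.\<close>

lemma admissible_comparison:
  fixes W :: "'w \<Rightarrow> real^'m \<Rightarrow> nat \<Rightarrow> real"
  assumes M: "prob_space M" and U: "fsigma U" "U \<subseteq> S" and m: "2 \<le> CARD('m)"
    and X: "\<And>k. k \<in> AN \<Longrightarrow> case_option \<xi>0 \<xi> k \<in> borel_measurable M"
    and law: "\<And>K. K \<subseteq> AN \<Longrightarrow> K \<noteq> {} \<Longrightarrow>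
      distr M (PiM K (\<lambda>_. borel)) (\<lambda>\<omega>. \<lambda>k\<in>K. case_option \<xi>0 \<xi> k \<omega>) = PiM K (\<lambda>_. std_normal)"
    and W: "admissible M S (CARD('m) - 2) W"
    and ind: "indep_rv M (field_space S (CARD('m) - 2)) W (PiM UNIV (\<lambda>_. borel)) (exp_sum A \<alpha> \<xi>)"
    and ind0: "indep_rv M (field_space S (CARD('m) - 2)) W (PiM UNIV (\<lambda>_. borel)) (exp_sum0 A \<alpha> \<xi> a0 \<alpha>0 \<xi>0)"
  shows "expected_zeros M (exp_sum0 A \<alpha> \<xi> a0 \<alpha>0 \<xi>0) (CARD('m) - 2) W U =
      tilt_factor (exp (2 * t)) * expected_zeros M (exp_sum A \<alpha> \<xi>) (CARD('m) - 2) W U"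
    and "expected_zeros M (exp_sum A \<alpha> \<xi>) (CARD('m) - 2) W U < \<infinity>"
proof -
  let ?n = "CARD('m) - 2"
  obtain V ip d b \<rho> \<beta> where V: "V \<subseteq> smooth_fields S ?n" "module.subspace fscale V"
    and sp: "scalar_product_on V ip" and onb: "orthonormal_basis_of V ip d b"
    and surj: "\<forall>x\<in>S. \<forall>v. \<exists>f\<in>V. \<forall>i<?n. f x i = v i"
    and \<rho>0: "\<forall>f\<in>V. 0 \<le> \<rho> f"
    and cont: "\<forall>f\<in>V. \<forall>e>0. \<exists>\<delta>>0. \<forall>g\<in>V. ip_norm ip (g - f) < \<delta> \<longrightarrow> \<bar>\<rho> g - \<rho> f\<bar> < e"
    and dist: "distributed M (lebesgue_span S ?n d b) W (\<lambda>f. ennreal (indicator V f * \<rho> f))"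
    and \<beta>: "real d < \<beta>"
    and bigo: "\<rho> \<in> O[inf (filtercomap (ip_norm ip) at_top) (principal V)](\<lambda>f. ip_norm ip f powr (- \<beta>))"
    using W unfolding admissible_def by (elim conjE exE) (rule that)
  let ?F = "\<lambda>f. ennreal (indicator V f * \<rho> f)"
  let ?Wc = "\<lambda>c. \<Sum>i<d. fscale (c i) (b i)"
  have bV: "b i \<in> V" if "i < d" for i using onb that by (simp add: orthonormal_basis_of_def)
  have WcV: "?Wc c \<in> V" for c
    using bV by (intro module.subspace_sum[OF module_fscale V(2)] module.subspace_scale[OF module_fscale V(2)]) auto
  then have Wc: "?Wc c \<in> smooth_fields S ?n" for c using V(1) by blast
  have Wc_meas: "?Wc \<in> measurable (lborel_PiM {..<d}) (field_space S ?n)"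
    by (intro measurable_field_spaceI Wc) (unfold fscale_sum_apply,
      intro borel_measurable_sum borel_measurable_times borel_measurable_const, measurable)
  obtain C where C: "0 \<le> C" "\<And>c. \<rho> (?Wc c) \<le> C * wt {..<d} c powr - \<beta>"
    using admissible_density_bound[OF V(2) sp onb cont \<beta> bigo] by auto
  obtain a1 where a1: "a1 \<in> A" using A_nonempty by auto
  define Gop where "Gop k y = (case k of Some a \<Rightarrow> gexp a y | None \<Rightarrow> 1)" for k :: "(real^'m) option" and y
  have sumG: "(\<Sum>k\<in>Some ` A. x k * Gop k y) = (\<Sum>a\<in>A. x (Some a) * gexp a y)" for x :: "(real^'m) option \<Rightarrow> real" and y
    by (simp add: sum.reindex Gop_def)
  have sq: "(\<Sum>k\<in>Some ` A. (Gop k x)\<^sup>2) = \<Theta> x" for x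
    by (simp add: sum.reindex Gop_def \<Theta>_def)
  interpret level_fields S "Some ` A" "{..<d}" "{..<?n}" Gop b "Some a1" "exp (2 * t)" \<beta> C "\<lambda>c. ?F (?Wc c)"
  proof
    show "compact S" "2 \<le> CARD('m)" "finite {..<d}" "finite (Some ` A)" "Some a1 \<in> Some ` A"
      "finite {..<?n}" "card {..<?n} = CARD('m) - 2" "0 < exp (2 * t)" "0 \<le> C" "real (card {..<d}) < \<beta>"
      using compact_S m A(1) a1 C(1) \<beta> by auto
    show "C1_on UNIV (Gop k)" if "k \<in> Some ` A" for k
      using that by (auto simp: Gop_def[abs_def] intro: C1_gexp)
    show "Gop (Some a1) x \<noteq> 0" for x using gexp_pos[OF a1, of x] by (simp add: Gop_def)
    show "(\<Sum>k\<in>Some ` A. (Gop k x)\<^sup>2) = exp (2 * t)" if "x \<in> S" for x using sq \<Theta>_S[OF that] by simp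
    show "\<exists>l. partial l (\<lambda>x. \<Sum>k\<in>Some ` A. (Gop k x)\<^sup>2) x \<noteq> 0" if "x \<in> S" for x
      using grad_\<Theta>[OF that] by (simp add: sq)
    show "\<exists>T F. open T \<and> x \<in> T \<and> C1_on T F \<and> (\<forall>y\<in>S \<inter> T. F y = b i y j)"
      if "i \<in> {..<d}" "j \<in> {..<?n}" "x \<in> S" for i j x
    proof -
      have "b i \<in> smooth_fields S ?n" using bV[of i] V(1) that(1) by auto
      then have "smooth_on S (\<lambda>y. b i y j)" using that(2) by (auto simp: smooth_fields_def)
      then show ?thesis using that(3) by (rule smooth_on_local_C1)
    qed
    show "\<exists>c. \<forall>j\<in>{..<?n}. (\<Sum>i<d. c i * b i x j) = v j" if x: "x \<in> S" for x v
    proof -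
      obtain f where f: "f \<in> V" "\<forall>i<?n. f x i = v i" using surj x by blast
      obtain c where c: "f = ?Wc c" using onb f(1) unfolding orthonormal_basis_of_def by blast
      show ?thesis using f(2) unfolding c fscale_sum_apply by auto
    qed
    have "?F \<in> borel_measurable (field_space S ?n)"
      using dist by (simp add: distributed_def lebesgue_span_def)
    from measurable_compose[OF Wc_meas this]
    show "(\<lambda>c. ?F (?Wc c)) \<in> borel_measurable (lborel_PiM {..<d})" .
    show "?F (?Wc c) \<le> ennreal (C * wt {..<d} c powr - \<beta>)" for c
      using C(2)[of c] WcV[of c] by (simp add: ennreal_leI)
  qed
  \<comment> \<open>The common factor is positive, so the zeros of the original fields are those of
    the fields of constant variance, with the extra term becoming a constant level.\<close>
  have h0: "(\<Sum>k\<in>Some ` A. x k * hfun k y) = \<alpha>0 * exp (a0 \<bullet> y) * (\<Sum>k\<in>Some ` A. x k * Gop k y)" for x y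
    by (simp add: sum.reindex Gop_def hfun_Some sum_distrib_left mult_ac)
  have h1: "(\<Sum>k\<in>AN. x k * hfun k y) = \<alpha>0 * exp (a0 \<bullet> y) * ((\<Sum>k\<in>Some ` A. x k * Gop k y) + x None)" for x y
    using A(1) h0[of x y] by (simp add: hfun_def[of None] distrib_left mult_ac)
  have z0: "{y \<in> U. (\<Sum>k\<in>Some ` A. x k * hfun k y) = 0 \<and> (\<forall>j<?n. (\<Sum>i<d. c i * b i y j) = 0)} = zeros U 0 (c, x)" for c x
    unfolding zeros_def h0 using \<alpha>0 by auto
  have z1: "{y \<in> U. (\<Sum>k\<in>AN. x k * hfun k y) = 0 \<and> (\<forall>j<?n. (\<Sum>i<d. c i * b i y j) = 0)} = zeros U (x None) (c, x)" for c x
    unfolding zeros_def h1 using \<alpha>0 by auto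
  have R: "expected_zeros M (exp_sum A \<alpha> \<xi>) ?n W U = mean_zeros U 0"
    unfolding mean_zeros_eq[OF U] z0[symmetric]
  proof (rule expected_zeros_eq[OF M U _ continuous_hfun Wc dist ind exp_sum_eq])
    show "distr M (PiM (Some ` A) (\<lambda>_. borel)) (\<lambda>\<omega>. \<lambda>k\<in>Some ` A. case_option \<xi>0 \<xi> k \<omega>) = PiM (Some ` A) (\<lambda>_. std_normal)"
      using A_nonempty by (intro law) auto
    show "case_option \<xi>0 \<xi> k \<in> borel_measurable M" if "k \<in> Some ` A" for k using that by (intro X) auto
  qed (use A(1) in simp)
  have L: "expected_zeros M (exp_sum0 A \<alpha> \<xi> a0 \<alpha>0 \<xi>0) ?n W U = tilt_factor (exp (2 * t)) * mean_zeros U 0"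
  proof -
    have "expected_zeros M (exp_sum0 A \<alpha> \<xi> a0 \<alpha>0 \<xi>0) ?n W U = (\<integral>\<^sup>+c. ?F (?Wc c) *
        (\<integral>\<^sup>+x. ecount (zeros U (x None) (c, x)) \<partial>PiM AN (\<lambda>_. std_normal)) \<partial>lborel_PiM {..<d})"
      unfolding z1[symmetric]
    proof (rule expected_zeros_eq[OF M U _ continuous_hfun Wc dist ind0 exp_sum0_eq X])
      show "distr M (PiM AN (\<lambda>_. borel)) (\<lambda>\<omega>. \<lambda>k\<in>AN. case_option \<xi>0 \<xi> k \<omega>) = PiM AN (\<lambda>_. std_normal)"
        by (intro law) auto
    qed (use A(1) in auto)
    also have "\<dots> = tilt_factor (exp (2 * t)) * mean_zeros U 0"
      by (rule random_level_mean[OF U]) auto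
    finally show ?thesis .
  qed
  show "expected_zeros M (exp_sum0 A \<alpha> \<xi> a0 \<alpha>0 \<xi>0) ?n W U =
      tilt_factor (exp (2 * t)) * expected_zeros M (exp_sum A \<alpha> \<xi>) ?n W U"
    by (simp only: L R)
  show "expected_zeros M (exp_sum A \<alpha> \<xi>) ?n W U < \<infinity>"
    using mean_zeros_level(2)[OF U] by (simp only: R)
qed

end

theorem proposition4p15:
  fixes M :: "'w measure"
    and A :: "(real ^ 'm) set"
    and \<alpha> :: "real ^ 'm \<Rightarrow> real"
    and \<xi> :: "real ^ 'm \<Rightarrow> 'w \<Rightarrow> real"
    and a0 :: "real ^ 'm"
    and \<alpha>0 :: real
    and \<xi>0 :: "'w \<Rightarrow> real"
    and t tmin :: real
    and U :: "(real ^ 'm) set"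
  assumes "prob_space M"
    and "1 < CARD('m)"
    and "finite A"
    and "aff_dim (convex hull A) = int CARD('m)"
    and "\<And>a. a \<in> A \<Longrightarrow> 0 < \<alpha> a"
    and "a0 \<notin> A"
    and "0 < \<alpha>0"
    and "prob_space.indep_vars M (\<lambda>_. borel) (case_option \<xi>0 \<xi>) (insert None (Some ` A))"
    and "distributed M lborel \<xi>0 (\<lambda>r. ennreal (std_normal_density r))"
    and "\<And>a. a \<in> A \<Longrightarrow> distributed M lborel (\<xi> a) (\<lambda>r. ennreal (std_normal_density r))"
    and "tmin \<in> range (Phi0 A \<alpha> a0 \<alpha>0)"
    and "\<And>x. tmin \<le> Phi0 A \<alpha> a0 \<alpha>0 x"
    and "tmin < t"
    and "openin (top_of_set (S_hyp A \<alpha> a0 \<alpha>0 t)) U"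
  shows
    "(\<forall>W :: 'w \<Rightarrow> real ^ 'm \<Rightarrow> nat \<Rightarrow> real.
        admissible M (S_hyp A \<alpha> a0 \<alpha>0 t) (CARD('m) - 2) W \<and>
        indep_rv M (field_space (S_hyp A \<alpha> a0 \<alpha>0 t) (CARD('m) - 2)) W
          (PiM UNIV (\<lambda>_. borel)) (exp_sum A \<alpha> \<xi>) \<and>
        indep_rv M (field_space (S_hyp A \<alpha> a0 \<alpha>0 t) (CARD('m) - 2)) W
          (PiM UNIV (\<lambda>_. borel)) (exp_sum0 A \<alpha> \<xi> a0 \<alpha>0 \<xi>0) \<longrightarrow>
        (let L = expected_zeros M (exp_sum0 A \<alpha> \<xi> a0 \<alpha>0 \<xi>0) (CARD('m) - 2) W U;
             R = expected_zeros M (exp_sum A \<alpha> \<xi>) (CARD('m) - 2) W U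
         in L \<le> R \<and> (L = R \<longleftrightarrow> R = 0) \<and> (R = 0 \<longrightarrow> L = 0))) \<and>
     (let L = expected_zeros_iid M (CARD('m) - 1) (exp_sum0 A \<alpha> \<xi> a0 \<alpha>0 \<xi>0) U;
          R = expected_zeros_iid M (CARD('m) - 1) (exp_sum A \<alpha> \<xi>) U
      in L \<le> R \<and> (L = R \<longleftrightarrow> R = 0) \<and> (R = 0 \<longrightarrow> L = 0))"
proof -
  interpret exp_setting A \<alpha> a0 \<alpha>0 t tmin
    using assms(3-5,7,11-13) by unfold_locales auto
  interpret prob_space M by fact
  have m: "2 \<le> CARD('m)" using assms(2) by simp
  obtain T where T: "open T" "U = S \<inter> T" using assms(14) by (auto simp: openin_open)
  \<comment> \<open>A relatively open subset of the compact hypersurface is the intersection of a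
    closed with an open set.\<close>
  have U: "fsigma U" "U \<subseteq> S"
    unfolding T(2) using T(1) compact_S by (auto intro!: fsigma_Int[OF fsigma_closed fsigma_open] compact_imp_closed)
  have dist: "distributed M lborel (case_option \<xi>0 \<xi> k) (\<lambda>r. ennreal (std_normal_density r))" if "k \<in> AN" for k
    using that assms(9,10) by auto
  have X: "case_option \<xi>0 \<xi> k \<in> borel_measurable M" if "k \<in> AN" for k
    using dist[OF that] by (simp add: distributed_def)
  have law: "distr M (PiM K (\<lambda>_. borel)) (\<lambda>\<omega>. \<lambda>k\<in>K. case_option \<xi>0 \<xi> k \<omega>) = PiM K (\<lambda>_. std_normal)"
    if K: "K \<subseteq> AN" "K \<noteq> {}" for K
  proof (rule distr_std_normal_family)
    show "indep_vars (\<lambda>_. borel) (case_option \<xi>0 \<xi>) K" by (rule indep_vars_subset[OF assms(8) K(1)])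
    show "finite K" by (rule finite_subset[OF K(1)]) (use A(1) in simp)
    show "distributed M lborel (case_option \<xi>0 \<xi> k) (\<lambda>r. ennreal (std_normal_density r))" if "k \<in> K" for k
      using dist that K(1) by blast
  qed fact
  have tilt: "tilt_factor (exp (2 * t)) < 1" by (rule tilt_factor_less_1) simp
  let ?n = "CARD('m) - 1"
  have "hyb ?n U ?n = tilt_factor (exp (2 * t)) ^ ?n * hyb ?n U 0"
    by (rule hyb_power[OF U m refl order_refl])
  \<comment> \<open>There is at least one copy since m > 1, so the power is still below 1.\<close>
  moreover have "tilt_factor (exp (2 * t)) ^ ?n < 1"
    using tilt m by (intro ennreal_power_less_1) auto
  moreover have "hyb ?n U 0 < \<infinity>" using hyb_step[OF U m refl, of 0] m by auto
  ultimately have iid: "hyb ?n U ?n \<le> hyb ?n U 0 \<and> (hyb ?n U ?n = hyb ?n U 0 \<longleftrightarrow> hyb ?n U 0 = 0) \<and>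
      (hyb ?n U 0 = 0 \<longrightarrow> hyb ?n U ?n = 0)"
    by (rule contraction_comparison)
  note iid_eq = iid_eq_hyb[OF assms(1) U(1) X law[OF order_refl], of ?n]
  show ?thesis
  proof (intro conjI allI impI)
    fix W :: "'w \<Rightarrow> real ^ 'm \<Rightarrow> nat \<Rightarrow> real"
    assume "admissible M S (CARD('m) - 2) W \<and>
        indep_rv M (field_space S (CARD('m) - 2)) W (PiM UNIV (\<lambda>_. borel)) (exp_sum A \<alpha> \<xi>) \<and>
        indep_rv M (field_space S (CARD('m) - 2)) W (PiM UNIV (\<lambda>_. borel)) (exp_sum0 A \<alpha> \<xi> a0 \<alpha>0 \<xi>0)"
    then have W: "admissible M S (CARD('m) - 2) W"
      "indep_rv M (field_space S (CARD('m) - 2)) W (PiM UNIV (\<lambda>_. borel)) (exp_sum A \<alpha> \<xi>)"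
      "indep_rv M (field_space S (CARD('m) - 2)) W (PiM UNIV (\<lambda>_. borel)) (exp_sum0 A \<alpha> \<xi> a0 \<alpha>0 \<xi>0)" by auto
    show "let L = expected_zeros M (exp_sum0 A \<alpha> \<xi> a0 \<alpha>0 \<xi>0) (CARD('m) - 2) W U;
             R = expected_zeros M (exp_sum A \<alpha> \<xi>) (CARD('m) - 2) W U
         in L \<le> R \<and> (L = R \<longleftrightarrow> R = 0) \<and> (R = 0 \<longrightarrow> L = 0)"
      unfolding Let_def
      by (rule contraction_comparison[OF admissible_comparison(1)[OF assms(1) U m X law W] tilt
          admissible_comparison(2)[OF assms(1) U m X law W]])
  next
    show "let L = expected_zeros_iid M (CARD('m) - 1) (exp_sum0 A \<alpha> \<xi> a0 \<alpha>0 \<xi>0) U;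
         R = expected_zeros_iid M (CARD('m) - 1) (exp_sum A \<alpha> \<xi>) U
      in L \<le> R \<and> (L = R \<longleftrightarrow> R = 0) \<and> (R = 0 \<longrightarrow> L = 0)"
      unfolding Let_def using iid iid_eq by simp
  qed
qed

end
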